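(* Let $m_1,m_2\in\mathbb{N}$, $m=m_1+m_2$, and consider the skew-self-adjoint Dirac system $$y'(x,z)=\mathrm{i}\big(zj+jV(x)\big)y(x,z),\quad x\ge 0,\qquad j=\begin{bmatrix} I_{m_1}&0\\0&-I_{m_2}\end{bmatrix},\quad V=\begin{bmatrix}0&v\\ -v^*&0\end{bmatrix},$$ where $v$ is an $m_1\times m_2$ matrix function on $\mathbb{R}_+=[0,\infty)$ and the entries of $V$ belong to $L^1(\mathbb{R}_+)$. Then the reflection coefficient $R_L(z)=Y_2(0,z)Y_1(0,z)^{-1}$ is defined almost everywhere on $\mathbb{R}$, and there exist $M,\widehat M>0$ such that $R_L$ admits a unique extension, also denoted by $R_L$, which is meromorphic on $\mathbb{C}_+$ and continuous on $\{z\in\mathbb{R}:|z|>\widehat M\}\cup\mathbb{C}_+$ (away from its poles in $\mathbb{C}_+$); this extension is given by $R_L(z)=Y_2(0,z)Y_1(0,z)^{-1}$ for $z\in\mathbb{C}_+$. For $z\in\mathbb{C}_M$ this extension coincides with the Weyl function $\varphi(z)$ of the system, and it has the property that on any finite interval $[0,l]$ $$\sup_{x\le l,\ z\in\mathbb{C}_M}\left\|\mathrm{e}^{-\mathrm{i}xz}u(x,z)\begin{bmatrix}I_{m_1}\\ R_L(z)\end{bmatrix}\right\|<\infty,$$ that is, it coincides with the GW-function as well.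
   Context: $\mathbb{C}_+$ is the open upper half-plane, $\overline{\mathbb{C}_+}$ the closed upper half-plane, $\mathbb{C}_M=\{z\in\mathbb{C}:\Im(z)>M\}$; $y'=\frac{d}{dx}y$; $I_k$ is the $k\times k$ identity matrix. Jost solution: for $z\in\mathbb{R}$, $F_L(x,z)$ is the unique fundamental ($m\times m$ matrix) solution of the Dirac system such that $F_L(x,z)=\mathrm{e}^{\mathrm{i}xzj}(I_m+o(1))$ as $x\to\infty$. For $z\in\mathbb{R}$ put $Y(x,z)=\begin{bmatrix}Y_1(x,z)\\ Y_2(x,z)\end{bmatrix}:=F_L(x,z)\begin{bmatrix}I_{m_1}\\0\end{bmatrix}$, with $Y_1$ of size $m_1\times m_1$ and $Y_2$ of size $m_2\times m_1$. It is known that $Y$ extends (uniquely; same notation) to $z\in\overline{\mathbb{C}_+}$ so that, for each $z\in\mathbb{C}_+$, it is a matrix solution of the Dirac system, and it is continuous in $z\in\overline{\mathbb{C}_+}$ and analytic in $z\in\mathbb{C}_+$. Reflection coefficient: $R_L(z):=Y_2(0,z)Y_1(0,z)^{-1}$ at those $z\in\mathbb{R}$ where $Y_1(0,z)$ is invertible. $u(x,z)$ is the fundamental solution of the Dirac system with $u(0,z)=I_m$. A Weyl function of the skew-self-adjoint Dirac system is an $m_2\times m_1$ matrix function $\varphi$ such that, for some $M>0$ and all $z\in\mathbb{C}_M$, $$\int_0^\infty\begin{bmatrix}I_{m_1}&\varphi(z)^*\end{bmatrix}u(x,z)^*u(x,z)\begin{bmatrix}I_{m_1}\\ \varphi(z)\end{bmatrix}dx<\infty.$$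 A GW-function (generalized Weyl function) is an $m_2\times m_1$ matrix function $\varphi$, analytic in some fixed $\mathbb{C}_M$, such that $\sup_{x\le l,\,z\in\mathbb{C}_M}\big\|\mathrm{e}^{-\mathrm{i}xz}u(x,z)\begin{bmatrix}I_{m_1}\\ \varphi(z)\end{bmatrix}\big\|<\infty$ on any finite interval $[0,l]$. *)

theory Defs
  imports "HOL-Complex_Analysis.Complex_Analysis"
begin

unbundle no fps_syntax

(* The sizes m1 and m2 are the cardinalities of the index types 'a and 'b; vectors and matrices
   of size m = m1 + m2 are indexed by the sum type 'a + 'b. A matrix of size p x q has type
   complex ^ 'q ^ 'p. *)

definition cscale :: "complex \<Rightarrow> complex^'n^'k \<Rightarrow> complex^'n^'k"  (infixr "*\<^sub>M" 75) where
  "c *\<^sub>M A = map_matrix (\<lambda>a. c * a) A"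

definition cadj :: "complex^'n^'k \<Rightarrow> complex^'k^'n" where
  "cadj A = transpose (map_matrix cnj A)"

definition block_matrix ::
  "complex^'a::finite^'a \<Rightarrow> complex^'b::finite^'a \<Rightarrow> complex^'a^'b \<Rightarrow> complex^'b^'b \<Rightarrow> complex^('a + 'b)^('a + 'b)" where
  "block_matrix A B C D = (\<chi> r c.
     case r of
       Inl i \<Rightarrow> (case c of Inl k \<Rightarrow> A $ i $ k | Inr l \<Rightarrow> B $ i $ l)
     | Inr i \<Rightarrow> (case c of Inl k \<Rightarrow> C $ i $ k | Inr l \<Rightarrow> D $ i $ l))"

definition block_col :: "complex^'n^'a::finite \<Rightarrow> complex^'n^'b::finite \<Rightarrow> complex^'n^('a + 'b)" where
  "block_col A B = (\<chi> r. case r of Inl i \<Rightarrow> A $ i | Inr i \<Rightarrow> B $ i)"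

definition upper_block :: "complex^'n^('a::finite + 'b::finite) \<Rightarrow> complex^'n^'a" where
  "upper_block A = (\<chi> i. A $ Inl i)"

definition lower_block :: "complex^'n^('a::finite + 'b::finite) \<Rightarrow> complex^'n^'b" where
  "lower_block A = (\<chi> i. A $ Inr i)"

definition J :: "complex^('a::finite + 'b::finite)^('a + 'b)" where
  "J = block_matrix (mat 1) 0 0 (- mat 1)"

(* e^{c j}; since j is diagonal, the matrix exponential is taken entry by entry on the diagonal. *)
definition exp_J :: "complex \<Rightarrow> complex^('a::finite + 'b::finite)^('a + 'b)" where
  "exp_J c = block_matrix (mat (exp c)) 0 0 (mat (exp (- c)))"

definition upper_half :: "real \<Rightarrow> complex set" where
  "upper_half M = {z. Im z > M}"

definition potential :: "complex^'b::finite^'a::finite \<Rightarrow> complex^('a + 'b)^('a + 'b)" where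
  "potential w = block_matrix 0 w (- cadj w) 0"

definition abs_continuous_on_interval :: "real \<Rightarrow> real \<Rightarrow> (real \<Rightarrow> 'e::real_normed_vector) \<Rightarrow> bool" where
  "abs_continuous_on_interval a b f \<longleftrightarrow>
     (\<forall>e>0. \<exists>d>0. \<forall>D. D division_of \<Union>D \<and> \<Union>D \<subseteq> {a..b} \<and> (\<Sum>K\<in>D. Sup K - Inf K) < d
        \<longrightarrow> (\<Sum>K\<in>D. norm (f (Sup K) - f (Inf K))) < e)"

(* The potential is only integrable, so the differential equation is understood as usual:
   locally absolutely continuous functions satisfying it almost everywhere. *)
definition dirac_solution ::
  "(real \<Rightarrow> complex^'b::finite^'a::finite) \<Rightarrow> complex \<Rightarrow> (real \<Rightarrow> complex^'n^('a + 'b)) \<Rightarrow> bool" where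
  "dirac_solution v z y \<longleftrightarrow>
     (\<forall>l>0. abs_continuous_on_interval 0 l y) \<and>
     (AE x in lebesgue. x \<ge> 0 \<longrightarrow>
        (y has_vector_derivative (\<i> *\<^sub>M (z *\<^sub>M J + J ** potential (v x))) ** y x) (at x within {0..}))"

definition fundamental_solution ::
  "(real \<Rightarrow> complex^'b::finite^'a::finite) \<Rightarrow> complex \<Rightarrow> (real \<Rightarrow> complex^('a + 'b)^('a + 'b)) \<Rightarrow> bool" where
  "fundamental_solution v z U \<longleftrightarrow> dirac_solution v z U \<and> (\<forall>x\<ge>0. invertible (U x))"

definition normalized_fundamental ::
  "(real \<Rightarrow> complex^'b::finite^'a::finite) \<Rightarrow> (real \<Rightarrow> complex \<Rightarrow> complex^('a + 'b)^('a + 'b)) \<Rightarrow> bool" where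
  "normalized_fundamental v u \<longleftrightarrow>
     (\<forall>z. fundamental_solution v z (\<lambda>x. u x z) \<and> u 0 z = mat 1)"

definition jost_solution ::
  "(real \<Rightarrow> complex^'b::finite^'a::finite) \<Rightarrow> (real \<Rightarrow> real \<Rightarrow> complex^('a + 'b)^('a + 'b)) \<Rightarrow> bool" where
  "jost_solution v F \<longleftrightarrow>
     (\<forall>z. fundamental_solution v (complex_of_real z) (\<lambda>x. F x z) \<and>
          (\<exists>E. (E \<longlongrightarrow> 0) at_top \<and>
               (\<forall>x\<ge>0. F x z = exp_J (\<i> * complex_of_real (x * z)) ** (mat 1 + E x))))"

(* Y is F_L [I; 0] on the real line, extended to the closed upper half-plane. *)
definition jost_extension ::
  "(real \<Rightarrow> complex^'b::finite^'a::finite) \<Rightarrow> (real \<Rightarrow> real \<Rightarrow> complex^('a + 'b)^('a + 'b))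
     \<Rightarrow> (real \<Rightarrow> complex \<Rightarrow> complex^'a^('a + 'b)) \<Rightarrow> bool" where
  "jost_extension v F Y \<longleftrightarrow>
     (\<forall>x\<ge>0. \<forall>z. Y x (complex_of_real z) = F x z ** block_col (mat 1) 0) \<and>
     (\<forall>z\<in>upper_half 0. dirac_solution v z (\<lambda>x. Y x z)) \<and>
     (\<forall>x\<ge>0. continuous_on {z. Im z \<ge> 0} (Y x)) \<and>
     (\<forall>x\<ge>0. \<forall>r c. (\<lambda>z. Y x z $ r $ c) holomorphic_on upper_half 0)"

definition refl_defined :: "(real \<Rightarrow> complex \<Rightarrow> complex^'a::finite^('a + 'b::finite)) \<Rightarrow> complex \<Rightarrow> bool" where
  "refl_defined Y z \<longleftrightarrow> invertible (upper_block (Y 0 z))"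

definition refl_coeff :: "(real \<Rightarrow> complex \<Rightarrow> complex^'a::finite^('a + 'b::finite)) \<Rightarrow> complex \<Rightarrow> complex^'a^'b" where
  "refl_coeff Y z = lower_block (Y 0 z) ** matrix_inv (upper_block (Y 0 z))"

definition poles :: "(complex \<Rightarrow> complex^'n^'k) \<Rightarrow> complex set" where
  "poles R = {z \<in> upper_half 0. \<exists>i k. is_pole (\<lambda>w. R w $ i $ k) z}"

(* meromorphic_on leaves the values at isolated points unconstrained; together with
   continuity off the poles it gives analyticity off the poles. Only the values of R at
   its poles remain arbitrary. *)
definition refl_extension ::
  "(real \<Rightarrow> complex \<Rightarrow> complex^'a::finite^('a + 'b::finite)) \<Rightarrow> real \<Rightarrow> (complex \<Rightarrow> complex^'a^'b) \<Rightarrow> bool" where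
  "refl_extension Y Mh R \<longleftrightarrow>
     (\<forall>t::real. refl_defined Y (complex_of_real t)
        \<longrightarrow> R (complex_of_real t) = refl_coeff Y (complex_of_real t)) \<and>
     (\<forall>i k. (\<lambda>z. R z $ i $ k) meromorphic_on upper_half 0) \<and>
     continuous_on (complex_of_real ` {t. \<bar>t\<bar> > Mh} \<union> (upper_half 0 - poles R)) R"

(* The half-plane Im z > M on which the defining condition is imposed is a parameter. *)
definition weyl_function_on ::
  "(real \<Rightarrow> complex \<Rightarrow> complex^('a::finite + 'b::finite)^('a + 'b)) \<Rightarrow> real \<Rightarrow> (complex \<Rightarrow> complex^'a^'b) \<Rightarrow> bool" where
  "weyl_function_on u M \<phi> \<longleftrightarrow> M > 0 \<and>
     (\<forall>z\<in>upper_half M.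
        (\<lambda>x. cadj (block_col (mat 1) (\<phi> z)) ** cadj (u x z) ** u x z ** block_col (mat 1) (\<phi> z))
          absolutely_integrable_on {0..})"

definition gw_bounded_on ::
  "(real \<Rightarrow> complex \<Rightarrow> complex^('a::finite + 'b::finite)^('a + 'b)) \<Rightarrow> real \<Rightarrow> (complex \<Rightarrow> complex^'a^'b) \<Rightarrow> bool" where
  "gw_bounded_on u M \<phi> \<longleftrightarrow>
     (\<forall>l>0. bdd_above
        {norm (exp (- \<i> * complex_of_real x * z) *\<^sub>M (u x z ** block_col (mat 1) (\<phi> z))) | x z.
           x \<in> {0..l} \<and> z \<in> upper_half M})"

definition gw_function_on ::
  "(real \<Rightarrow> complex \<Rightarrow> complex^('a::finite + 'b::finite)^('a + 'b)) \<Rightarrow> real \<Rightarrow> (complex \<Rightarrow> complex^'a^'b) \<Rightarrow> bool" where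
  "gw_function_on u M \<phi> \<longleftrightarrow> M > 0 \<and>
     (\<forall>i k. (\<lambda>z. \<phi> z $ i $ k) holomorphic_on upper_half M) \<and> gw_bounded_on u M \<phi>"

end

theory Submission
  imports Defs
begin

text \<open>
  Writing the system as \<open>y' = \<i> (z j + W) y\<close> with \<open>W\<close> Hermitian, one sees that for \<open>Im z \<ge> 0\<close> the norm
  of \<open>exp (- \<i> z x) y x\<close> is nondecreasing in \<open>x\<close> and that of \<open>exp (\<i> z x) y x\<close> is nonincreasing.
  Hence solutions can be transported back from \<open>X\<close> to \<open>0\<close> with norm control, and the solutions that
  agree with \<open>exp (\<i> z x) [I; 0]\<close> at \<open>x = X\<close> converge as \<open>X \<rightarrow> \<infinity>\<close>, uniformly in the closed half-plane. The
  limit agrees with \<open>Y\<close> on the real line, hence everywhere. Integration by parts, after an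
  approximation of \<open>v\<close> by smooth functions, shows that \<open>Y (0, z) \<rightarrow> [I; 0]\<close> as \<open>\<bar>z\<bar> \<rightarrow> \<infinity>\<close> and that solutions starting
  at \<open>[0; \<eta>]\<close> grow like \<open>exp (- \<i> z x)\<close> for large \<open>z\<close>. The first fact makes \<open>Y\<^sub>1 (0, z)\<close> invertible for
  large \<open>z\<close> and almost everywhere on the line, by boundary uniqueness for bounded holomorphic
  functions. The second gives the uniqueness of the Weyl function at once, and that of
  the GW-function because the difference of two candidates decays faster than every exponential.
\<close>

section \<open>Absolutely continuous functions\<close>

text \<open>\<open>J ** V\<close> is Hermitian although \<open>V\<close> is skew-adjoint. Multiplied
  by \<i> it drops out of the derivative of the squared norm, so transport from \<open>X\<close> to
  \<open>0\<close> is a contraction after a scalar phase, whatever the size of \<open>v\<close>.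
  Without this cancellation the bounds would carry a Gronwall factor depending on \<open>v\<close>.
  The difficulty at large \<open>z\<close> is that the functions integrated against \<open>v\<close>
  are themselves solutions depending on \<open>z\<close>, so the classical Riemann-Lebesgue lemma
  for a fixed integrand does not apply. What is used of them is an equation
  \<open>q' = 2 * \<i> * z * q + c\<close> with \<open>c\<close> dominated by an integrable weight;
  the estimate then holds with one threshold for all such \<open>q\<close>. The matrices
  \<open>u x z\<close> are given separately for each \<open>z\<close>. Continuity and holomorphy in
  \<open>z\<close> are therefore derived, from an exact formula for the difference of the inverse of
  \<open>u\<close> at two parameters. A quotient of holomorphic functions may lose poles by
  cancellation. The full column rank of \<open>Y (0, z)\<close> excludes this: every zero of the
  determinant of the upper block is a pole of the reflection coefficient, so the formula holds at
  each point that is not a pole.\<close>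

lemma abs_continuous_on_interval_subset:
  assumes "abs_continuous_on_interval a b f" "a \<le> c" "d \<le> b"
  shows "abs_continuous_on_interval c d f"
  unfolding abs_continuous_on_interval_def
proof (intro allI impI)
  fix e :: real assume "e > 0"
  then obtain r where "r > 0" and r: "\<And>D. D division_of \<Union>D \<and> \<Union>D \<subseteq> {a..b} \<and> (\<Sum>K\<in>D. Sup K - Inf K) < r
        \<Longrightarrow> (\<Sum>K\<in>D. norm (f (Sup K) - f (Inf K))) < e"
    using assms(1) unfolding abs_continuous_on_interval_def by meson
  have "{c..d} \<subseteq> {a..b}" using assms by auto
  then show "\<exists>r>0. \<forall>D. D division_of \<Union>D \<and> \<Union>D \<subseteq> {c..d} \<and> (\<Sum>K\<in>D. Sup K - Inf K) < r
        \<longrightarrow> (\<Sum>K\<in>D. norm (f (Sup K) - f (Inf K))) < e"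
    using r \<open>r > 0\<close> by (meson order_trans)
qed

lemma abs_continuous_imp_continuous_on:
  fixes f :: "real \<Rightarrow> 'e::real_normed_vector"
  assumes "abs_continuous_on_interval a b f"
  shows "continuous_on {a..b} f"
  unfolding continuous_on_iff
proof (intro ballI allI impI)
  fix x e :: real assume x: "x \<in> {a..b}" and "e > 0"
  then obtain r where "r > 0" and r: "\<And>D. D division_of \<Union>D \<and> \<Union>D \<subseteq> {a..b} \<and> (\<Sum>K\<in>D. Sup K - Inf K) < r
        \<Longrightarrow> (\<Sum>K\<in>D. norm (f (Sup K) - f (Inf K))) < e"
    using assms(1) unfolding abs_continuous_on_interval_def by meson
  have *: "norm (f q - f p) < e" if "p \<le> q" "p \<in> {a..b}" "q \<in> {a..b}" "q - p < r" for p q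
    using r[of "{{p..q}}"] that division_of_self[of p q]
    by auto
  show "\<exists>d>0. \<forall>x'\<in>{a..b}. dist x' x < d \<longrightarrow> dist (f x') (f x) < e"
  proof (intro exI conjI ballI impI)
    fix y assume y: "y \<in> {a..b}" "dist y x < r"
    show "dist (f y) (f x) < e"
      using *[of x y] *[of y x] x y
      by (cases "x \<le> y") (auto simp: dist_norm norm_minus_commute)
  qed (use \<open>r > 0\<close> in auto)
qed

text \<open>Closure under bounded linear maps, closure under products and the Lipschitz criterion
  all reduce to such a bound on increments; the product is what calls for two controlling
  functions.\<close>

lemma abs_continuous_on_interval_bound:
  assumes bd: "\<And>x y. x \<in> {a..b} \<Longrightarrow> y \<in> {a..b} \<Longrightarrow> x \<le> y \<Longrightarrow> norm (h y - h x) \<le> C * (norm (f y - f x) + norm (g y - g x))"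
    and f: "abs_continuous_on_interval a b f" and g: "abs_continuous_on_interval a b g"
  shows "abs_continuous_on_interval a b h"
  unfolding abs_continuous_on_interval_def
proof (intro allI impI)
  fix e :: real assume "e > 0"
  define C' where "C' = max C 1"
  have C': "C' > 0" "C \<le> C'" by (auto simp: C'_def)
  define e' where "e' = e / (2*C')"
  have e': "e' > 0" using \<open>e>0\<close> C' by (simp add: e'_def)
  obtain r where "r > 0" and r: "\<And>D. D division_of \<Union>D \<and> \<Union>D \<subseteq> {a..b} \<and> (\<Sum>K\<in>D. Sup K - Inf K) < r
        \<Longrightarrow> (\<Sum>K\<in>D. norm (f (Sup K) - f (Inf K))) < e'"
    using f e' unfolding abs_continuous_on_interval_def by meson
  obtain s where "s > 0" and s: "\<And>D. D division_of \<Union>D \<and> \<Union>D \<subseteq> {a..b} \<and> (\<Sum>K\<in>D. Sup K - Inf K) < s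
        \<Longrightarrow> (\<Sum>K\<in>D. norm (g (Sup K) - g (Inf K))) < e'"
    using g e' unfolding abs_continuous_on_interval_def by meson
  show "\<exists>d>0. \<forall>D. D division_of \<Union>D \<and> \<Union>D \<subseteq> {a..b} \<and> (\<Sum>K\<in>D. Sup K - Inf K) < d
        \<longrightarrow> (\<Sum>K\<in>D. norm (h (Sup K) - h (Inf K))) < e"
  proof (rule exI[of _ "min r s"], intro conjI allI impI)
    fix D :: "real set set" assume D: "D division_of \<Union> D \<and> \<Union> D \<subseteq> {a..b} \<and> (\<Sum>K\<in>D. Sup K - Inf K) < min r s"
    have "(\<Sum>K\<in>D. norm (h (Sup K) - h (Inf K))) \<le>
          (\<Sum>K\<in>D. C' * (norm (f (Sup K) - f (Inf K)) + norm (g (Sup K) - g (Inf K))))"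
    proof (rule sum_mono)
      fix K assume "K \<in> D"
      then obtain p q where K: "K = {p..q}" "K \<noteq> {}" "K \<subseteq> {a..b}"
        using D by (metis Sup_upper box_real(2) division_ofD(3) division_ofD(4) order_trans)
      then have pq: "p \<le> q" "p \<in> {a..b}" "q \<in> {a..b}" by auto
      have "norm (h q - h p) \<le> C * (norm (f q - f p) + norm (g q - g p))" using bd pq by auto
      also have "\<dots> \<le> C' * (norm (f q - f p) + norm (g q - g p))"
        using C' by (intro mult_right_mono) auto
      finally show "norm (h (Sup K) - h (Inf K)) \<le> C' * (norm (f (Sup K) - f (Inf K)) + norm (g (Sup K) - g (Inf K)))"
        using pq by (simp add: K)
    qed
    also have "\<dots> = C' * ((\<Sum>K\<in>D. norm (f (Sup K) - f (Inf K))) + (\<Sum>K\<in>D. norm (g (Sup K) - g (Inf K))))"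
      by (simp only: sum_distrib_left[symmetric] sum.distrib)
    also have "\<dots> < C' * (e' + e')"
      using r[of D] s[of D] D C' by (intro mult_strict_left_mono add_strict_mono) auto
    also have "\<dots> = e" using C' by (simp add: e'_def)
    finally show "(\<Sum>K\<in>D. norm (h (Sup K) - h (Inf K))) < e" .
  qed (use \<open>r>0\<close> \<open>s>0\<close> in auto)
qed

lemma abs_continuous_on_interval_id: "abs_continuous_on_interval a b (\<lambda>x. x)"
  unfolding abs_continuous_on_interval_def
proof (intro allI impI)
  fix e :: real assume "e > 0"
  show "\<exists>d>0. \<forall>D. D division_of \<Union> D \<and> \<Union> D \<subseteq> {a..b} \<and> (\<Sum>K\<in>D. Sup K - Inf K) < d \<longrightarrow>
               (\<Sum>K\<in>D. norm (Sup K - Inf K)) < e"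
  proof (intro exI[of _ e] conjI allI impI \<open>e>0\<close>)
    fix D :: "real set set" assume D: "D division_of \<Union> D \<and> \<Union> D \<subseteq> {a..b} \<and> (\<Sum>K\<in>D. Sup K - Inf K) < e"
    have "(\<Sum>K\<in>D. norm (Sup K - Inf K)) = (\<Sum>K\<in>D. Sup K - Inf K)"
    proof (rule sum.cong[OF refl])
      fix K assume "K \<in> D"
      then obtain p q where K: "K = {p..q}" "K \<noteq> {}"
        using D by (metis box_real(2) division_ofD(3) division_ofD(4))
      then show "norm (Sup K - Inf K) = Sup K - Inf K" by auto
    qed
    then show "(\<Sum>K\<in>D. norm (Sup K - Inf K)) < e" using D by simp
  qed
qed

lemma abs_continuous_on_interval_lipschitz:
  assumes "\<And>x y. x \<in> {a..b} \<Longrightarrow> y \<in> {a..b} \<Longrightarrow> x \<le> y \<Longrightarrow> norm (h y - h x) \<le> C * (y - x)"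
  shows "abs_continuous_on_interval a b h"
proof (rule abs_continuous_on_interval_bound[where C = "max C 0"])
  fix x y assume "x \<in> {a..b}" "y \<in> {a..b}" "x \<le> y"
  then have "norm (h y - h x) \<le> C * (y - x)" using assms by auto
  also have "\<dots> \<le> max C 0 * (y-x)" using \<open>x \<le> y\<close> by (intro mult_right_mono) auto
  also have "\<dots> \<le> max C 0 * (norm (y-x) + norm (y-x))" using \<open>x \<le> y\<close> by (intro mult_left_mono) auto
  finally show "norm (h y - h x) \<le> max C 0 * (norm (y-x) + norm (y-x))" .
qed (rule abs_continuous_on_interval_id)+

text \<open>The gauge treats tags in two ways. Off \<open>N\<close> the differentiability estimate
  is summed as for an everywhere differentiable function. At tags in \<open>N\<close> the gauge
  forces the intervals into an open set of measure less than \<open>r\<close>, and absolute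
  continuity makes the sum of their increments small.\<close>

lemma abs_continuous_has_integral:
  fixes f :: "real \<Rightarrow> 'e::banach"
  assumes ab: "a \<le> b" and ac: "abs_continuous_on_interval a b f" and N: "negligible N"
    and der: "\<And>x. x \<in> {a..b} - N \<Longrightarrow> (f has_vector_derivative g x) (at x within {a..b})"
  shows "(g has_integral (f b - f a)) {a..b}"
proof -
  \<comment> \<open>With this value on \<open>N\<close>, tags in \<open>N\<close> contribute nothing
    but increments of \<open>f\<close>; the change on a null set is undone at the end.\<close>
  define h where "h = (\<lambda>x. if x \<in> N then 0 else g x)"
  have "(h has_integral (f b - f a)) {a..b}"
    unfolding has_integral box_real[symmetric]
  proof safe
    fix e :: real
    assume "e > 0"
    \<comment> \<open>The summand 1 keeps the denominator positive when
      \<open>a = b\<close>.\<close>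
    define e' where "e' = e / (2 * (b - a + 1))"
    have e': "e' > 0" using \<open>e > 0\<close> ab by (simp add: e'_def)
    obtain r where "r > 0" and r: "\<And>D. D division_of \<Union>D \<and> \<Union>D \<subseteq> {a..b} \<and> (\<Sum>K\<in>D. Sup K - Inf K) < r
        \<Longrightarrow> (\<Sum>K\<in>D. norm (f (Sup K) - f (Inf K))) < e/2"
      using ac \<open>e > 0\<close> half_gt_zero unfolding abs_continuous_on_interval_def by meson
    obtain U where U: "open U" "N \<subseteq> U" "(U - N) \<in> lmeasurable" "emeasure lebesgue (U - N) < ennreal r"
      using sets_lebesgue_outer_open[of N r] N \<open>r > 0\<close> by (auto simp: negligible_iff_null_sets)
    have Nm: "N \<in> lmeasurable" "measure lebesgue N = 0"
      using N negligible_imp_measurable negligible_imp_measure0 by auto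
    have Ueq: "U = (U - N) \<union> N" using U by auto
    have Um: "U \<in> lmeasurable" by (subst Ueq) (intro fmeasurable.Un U Nm)
    have "measure lebesgue U \<le> measure lebesgue (U - N) + measure lebesgue N"
      by (subst Ueq) (rule measure_Un_le; use U(3) Nm(1) in blast)
    also have "\<dots> < r"
      using U(3,4) Nm(2) \<open>r > 0\<close> by (simp add: emeasure_eq_measure2 ennreal_less_iff)
    finally have Ur: "measure lebesgue U < r" .
    have "\<forall>x. \<exists>d>0. (x \<in> {a..b} - N \<longrightarrow>
         (\<forall>y\<in>{a..b}. norm (y-x) < d \<longrightarrow> norm (f y - f x - (y-x) *\<^sub>R g x) \<le> e' * norm (y-x)))
         \<and> (x \<in> N \<longrightarrow> ball x d \<subseteq> U)" (is "\<forall>x. \<exists>d>0. ?P x d")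
    proof
      fix x
      show "\<exists>d>0. ?P x d"
      proof (cases "x \<in> N")
        case True
        then obtain d where "d > 0" "ball x d \<subseteq> U" using U by (meson openE subsetD)
        then show ?thesis using True by (intro exI[of _ d]) simp
      next
        case False
        then show ?thesis
        proof (cases "x \<in> {a..b}")
          case True
          then obtain d where "d > 0"
            "\<forall>y\<in>{a..b}. norm (y-x) < d \<longrightarrow> norm (f y - f x - (y-x) *\<^sub>R g x) \<le> e' * norm (y-x)"
            using der[of x] False e' unfolding has_vector_derivative_def has_derivative_within_alt by (meson DiffI)
          then show ?thesis using False by (intro exI[of _ d]) simp
        next
          case False
          then show ?thesis using \<open>x \<notin> N\<close> by (intro exI[of _ 1] conjI impI zero_less_one) blast+
        qed
      qed
    qed
    from choice[OF this] obtain d where d: "\<forall>x. 0 < d x \<and> ?P x (d x)" by auto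
    then have d0: "\<And>x. 0 < d x"
      and d1: "\<And>x y. \<lbrakk>x \<in> {a..b} - N; y \<in> {a..b}; norm (y-x) < d x\<rbrakk>
                        \<Longrightarrow> norm (f y - f x - (y-x) *\<^sub>R g x) \<le> e' * norm (y-x)"
      and d2: "\<And>x. x \<in> N \<Longrightarrow> ball x (d x) \<subseteq> U"
      by simp_all
    show "\<exists>\<gamma>. gauge \<gamma> \<and> (\<forall>\<D>. \<D> tagged_division_of cbox a b \<and> \<gamma> fine \<D> \<longrightarrow>
            norm ((\<Sum>(x, k)\<in>\<D>. measure lborel k *\<^sub>R h x) - (f b - f a)) < e)"
    proof (intro exI conjI allI impI; (elim conjE)?)
      show "gauge (\<lambda>x. ball x (d x))"
        using d0 gauge_ball_dependent by blast
    next
      fix p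
      assume ptag: "p tagged_division_of cbox a b" and finep: "(\<lambda>x. ball x (d x)) fine p"
      have finp: "finite p" using ptag by blast
      have ba: "b - a = (\<Sum>(x,K)\<in>p. Sup K - Inf K)" "f b - f a = (\<Sum>(x,K)\<in>p. f(Sup K) - f(Inf K))"
        using additive_tagged_division_1[where f= "\<lambda>x. x"] additive_tagged_division_1[where f= f] ab ptag by auto
      define T where "T = (\<lambda>(x, K). measure lborel K *\<^sub>R h x - (f (Sup K) - f (Inf K)))"
      define p1 where "p1 = {q \<in> p. fst q \<notin> N}"
      define p2 where "p2 = {q \<in> p. fst q \<in> N}"
      have pint: "\<exists>u v. K = {u..v} \<and> u \<le> v \<and> x \<in> K \<and> {u..v} \<subseteq> {a..b} \<and> K \<subseteq> ball x (d x)" if xK: "(x,K) \<in> p" for x K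
      proof -
        obtain u v where "K = cbox u v" using tagged_division_ofD(4)[OF ptag xK] by blast
        moreover have "x \<in> K" "K \<subseteq> {a..b}" using tagged_division_ofD(2,3)[OF ptag xK] by auto
        moreover have "K \<subseteq> ball x (d x)" using fineD[OF finep xK] .
        ultimately show ?thesis by (intro exI[of _ u] exI[of _ v]) auto
      qed
      have split: "sum T p = sum T p1 + sum T p2"
        unfolding p1_def p2_def by (subst sum.union_disjoint[symmetric]) (use finp in \<open>auto intro: sum.cong\<close>)
      have "norm (sum T p1) \<le> (\<Sum>n\<in>p1. e' * (case n of (x, k) \<Rightarrow> Sup k - Inf k))"
      proof (rule sum_norm_le, safe)
        fix x K
        assume "(x, K) \<in> p1"
        then have xK: "(x, K) \<in> p" "x \<notin> N" by (auto simp: p1_def)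
        obtain u v where k: "K = {u..v}" "u \<le> v" "x \<in> K" "{u..v} \<subseteq> {a..b}" "K \<subseteq> ball x (d x)"
          using pint[OF xK(1)] by blast
        have x: "x \<in> {a..b} - N" using k xK by auto
        have "norm ((v - u) *\<^sub>R g x - (f v - f u)) = norm (f u - f x - (u - x) *\<^sub>R g x - (f v - f x - (v - x) *\<^sub>R g x))"
          by (auto simp: algebra_simps)
        also have "\<dots> \<le> norm (f u - f x - (u - x) *\<^sub>R g x) + norm (f v - f x - (v - x) *\<^sub>R g x)"
          by (rule norm_triangle_ineq4)
        also have "\<dots> \<le> e' * norm (u - x) + e' * norm (v - x)"
        proof (rule add_mono)
          have "u \<in> {u..v}" "v \<in> {u..v}" using k(2) by auto
          then have "u \<in> ball x (d x)" "v \<in> ball x (d x)" using k(1,5) by blast+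
          then have *: "norm (u - x) < d x" "norm (v - x) < d x" by (auto simp: dist_real_def)
          have "u \<in> {a..b}" "v \<in> {a..b}" using k(2,4) by auto
          then show "norm (f u - f x - (u - x) *\<^sub>R g x) \<le> e' * norm (u - x)"
               "norm (f v - f x - (v - x) *\<^sub>R g x) \<le> e' * norm (v - x)"
            using d1[OF x _ *(1)] d1[OF x _ *(2)] by blast+
        qed
        also have "\<dots> \<le> e' * (Sup K - Inf K)"
          using k by (auto simp: field_simps)
        finally show "norm (T (x,K)) \<le> e' * (Sup K - Inf K)"
          using k xK by (simp add: T_def h_def)
      qed
      also have "\<dots> = e' * (\<Sum>(x,K)\<in>p1. Sup K - Inf K)" by (simp add: sum_distrib_left)
      also have "\<dots> \<le> e' * (\<Sum>(x,K)\<in>p. Sup K - Inf K)"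
      proof (intro mult_left_mono sum_mono2 finp)
        fix q assume "q \<in> p - p1"
        then show "0 \<le> (case q of (x, K) \<Rightarrow> Sup K - Inf K)"
          using pint[of "fst q" "snd q"] by (auto simp: case_prod_unfold)
      qed (use e' in \<open>auto simp: p1_def\<close>)
      also have "\<dots> \<le> e/2" using ab \<open>e > 0\<close> by (simp add: ba(1)[symmetric] e'_def field_simps)
      finally have b1: "norm (sum T p1) \<le> e/2" .
      have p2t: "p2 tagged_division_of \<Union>(snd ` p2)"
        by (rule tagged_partial_division_of_Union_self)
          (rule tagged_partial_division_subset[of p "cbox a b"], use ptag in \<open>auto simp: p2_def tagged_division_of_def\<close>)
      define D where "D = snd ` p2"
      have D: "D division_of \<Union>D" unfolding D_def
        by (rule division_of_tagged_division[OF p2t])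
      have DU: "\<Union>D \<subseteq> U" "\<Union>D \<subseteq> {a..b}"
        proof -
        show "\<Union>D \<subseteq> U"
        proof
          fix y assume "y \<in> \<Union>D"
          then obtain x K where xK: "(x,K) \<in> p" "x \<in> N" "y \<in> K" by (auto simp: D_def p2_def)
          from pint[OF xK(1)] have "y \<in> ball x (d x)" using xK(3) by (elim exE conjE) (rule subsetD)
          then show "y \<in> U" using d2[OF xK(2)] by blast
        qed
        show "\<Union>D \<subseteq> {a..b}"
        proof
          fix y assume "y \<in> \<Union>D"
          then obtain x K where xK: "(x,K) \<in> p" "x \<in> N" "y \<in> K" by (auto simp: D_def p2_def)
          from tagged_division_ofD(3)[OF ptag xK(1)] show "y \<in> {a..b}" using xK(3) by auto
        qed
      qed
      have Dm: "(\<Sum>K\<in>D. Sup K - Inf K) = (\<Sum>K\<in>D. measure lebesgue K)"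
      proof (rule sum.cong[OF refl])
        fix K assume "K \<in> D"
        then obtain x where "(x, K) \<in> p" by (auto simp: D_def p2_def)
        from pint[OF this] obtain u v where "K = {u..v}" "u \<le> v" by (elim exE conjE)
        then show "Sup K - Inf K = measure lebesgue K" by simp
      qed
      also have "\<dots> = measure lebesgue (\<Union>D)" by (rule content_division[OF D])
      also have "\<dots> \<le> measure lebesgue U"
        using lmeasurable_division[OF D] by (intro measure_mono_fmeasurable DU Um) auto
      also have "\<dots> < r" by (rule Ur)
      finally have Dr: "(\<Sum>K\<in>D. norm (f (Sup K) - f (Inf K))) < e/2"
        using r D DU by blast
      \<comment> \<open>Passing from tagged intervals to the set \<open>D\<close> of intervals needs
        a summand that vanishes on every interval with empty interior. This includes the empty
        interval, where \<open>Sup\<close> and \<open>Inf\<close> are unspecified.\<close>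
      define w where "w = (\<lambda>K. if K = {} then 0 else norm (f (Sup K) - f (Inf K)))"
      have nonempty: "K \<noteq> {}" if "(x,K) \<in> p" for x K
        using tagged_division_ofD(2)[OF ptag that] by blast
      have "norm (sum T p2) \<le> (\<Sum>(x,K)\<in>p2. w K)"
        by (rule sum_norm_le) (auto simp: p2_def T_def h_def w_def norm_minus_commute dest: nonempty)
      also have "\<dots> = (\<Sum>K\<in>D. w K)"
        unfolding D_def
      proof (rule sum.over_tagged_division_lemma[OF p2t])
        fix u v :: real assume "box u v = {}"
        then have "u \<ge> v" by auto
        then show "w (cbox u v) = 0"
          by (cases "u = v") (auto simp: w_def)
      qed
      also have "\<dots> = (\<Sum>K\<in>D. norm (f (Sup K) - f (Inf K)))"
        by (rule sum.cong) (auto simp: w_def D_def p2_def dest: nonempty)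
      finally have b2: "norm (sum T p2) < e/2" using Dr by linarith
      have "(\<Sum>(x, k)\<in>p. measure lborel k *\<^sub>R h x) - (f b - f a) = sum T p"
        by (simp add: ba(2) T_def sum_subtractf case_prod_unfold)
      then show "norm ((\<Sum>(x, k)\<in>p. measure lborel k *\<^sub>R h x) - (f b - f a)) < e"
        using split b1 b2 norm_triangle_ineq[of "sum T p1" "sum T p2"] by simp
    qed
  qed
  then show ?thesis
    by (rule has_integral_spike[OF N, rotated]) (auto simp: h_def)
qed

section \<open>Calculus of locally absolutely continuous functions on the half-line\<close>

definition ac_deriv :: "(real \<Rightarrow> 'e::real_normed_vector) \<Rightarrow> (real \<Rightarrow> 'e) \<Rightarrow> bool" where
  "ac_deriv f g \<longleftrightarrow> (\<forall>l>0. abs_continuous_on_interval 0 l f) \<and>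
     (AE x in lebesgue. x \<ge> 0 \<longrightarrow> (f has_vector_derivative g x) (at x within {0..}))"

lemma ac_deriv_AC: "ac_deriv f g \<Longrightarrow> abs_continuous_on_interval 0 l f"
  unfolding ac_deriv_def
  by (meson abs_continuous_on_interval_subset order_refl max.cobounded1 max.cobounded2 less_max_iff_disj zero_less_one)

lemma ac_deriv_continuous_on:
  assumes "ac_deriv f g" "0 \<le> a"
  shows "continuous_on {a..b} f"
  by (rule continuous_on_subset[OF abs_continuous_imp_continuous_on[OF ac_deriv_AC[OF assms(1), of b]]])
     (use assms in auto)

lemma ac_deriv_has_integral:
  fixes f :: "real \<Rightarrow> 'e::banach"
  assumes fg: "ac_deriv f g" and "0 \<le> a" "a \<le> b"
  shows "(g has_integral (f b - f a)) {a..b}"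
proof -
  have "AE x in lebesgue. x \<ge> 0 \<longrightarrow> (f has_vector_derivative g x) (at x within {0..})"
    using fg by (simp add: ac_deriv_def)
  then obtain N where N: "negligible N"
    "{x. \<not> (x \<ge> 0 \<longrightarrow> (f has_vector_derivative g x) (at x within {0..}))} \<subseteq> N"
    unfolding eventually_ae_filter_negligible by blast
  show ?thesis
  proof (rule abs_continuous_has_integral[OF \<open>a \<le> b\<close> _ N(1)])
    show "abs_continuous_on_interval a b f"
      by (rule abs_continuous_on_interval_subset[OF ac_deriv_AC[OF fg, of b]]) (use assms in auto)
    fix x assume "x \<in> {a..b} - N"
    then have "x \<notin> N" "x \<ge> 0" using \<open>0 \<le> a\<close> by auto
    then have "(f has_vector_derivative g x) (at x within {0..})" using N(2) by blast
    then show "(f has_vector_derivative g x) (at x within {a..b})"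
      by (rule has_vector_derivative_within_subset) (use \<open>0 \<le> a\<close> in auto)
  qed
qed

lemma ac_deriv_cong:
  assumes "ac_deriv f g" "\<And>x. x \<ge> 0 \<Longrightarrow> g x = g' x"
  shows "ac_deriv f g'"
proof -
  have "AE x in lebesgue. x \<ge> 0 \<longrightarrow> (f has_vector_derivative g x) (at x within {0..})"
    using assms by (simp add: ac_deriv_def)
  then have "AE x in lebesgue. x \<ge> 0 \<longrightarrow> (f has_vector_derivative g' x) (at x within {0..})"
    by (rule AE_mp) (auto simp: assms)
  then show ?thesis using assms(1) by (simp add: ac_deriv_def)
qed

lemma ac_deriv_linear:
  assumes h: "bounded_linear h" and fg: "ac_deriv f g"
  shows "ac_deriv (\<lambda>x. h (f x)) (\<lambda>x. h (g x))"
  unfolding ac_deriv_def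
proof (intro conjI allI impI)
  interpret bounded_linear h by (rule h)
  obtain K where "K > 0" and K: "\<And>x. norm (h x) \<le> norm x * K" using pos_bounded by blast
  fix l :: real
  show "abs_continuous_on_interval 0 l (\<lambda>x. h (f x))"
  proof (rule abs_continuous_on_interval_bound)
    fix x y
    have "norm (h (f y) - h (f x)) \<le> norm (f y - f x) * K" using K by (metis diff)
    also have "\<dots> \<le> K * (norm (f y - f x) + norm (f y - f x))" using \<open>K > 0\<close> by simp
    finally show "norm (h (f y) - h (f x)) \<le> K * (norm (f y - f x) + norm (f y - f x))" .
  qed (rule ac_deriv_AC[OF fg])+
next
  have "AE x in lebesgue. x \<ge> 0 \<longrightarrow> (f has_vector_derivative g x) (at x within {0..})"
    using fg by (simp add: ac_deriv_def)
  then show "AE x in lebesgue. x \<ge> 0 \<longrightarrow> ((\<lambda>x. h (f x)) has_vector_derivative h (g x)) (at x within {0..})"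
    by (rule AE_mp) (auto intro!: AE_I2 bounded_linear.has_vector_derivative[OF h])
qed

text \<open>One product rule for scalar multiples, inner products and matrix products. Both factors
  are bounded on a compact interval, so increments of the product are controlled by increments of
  the factors.\<close>

lemma ac_deriv_bilinear:
  assumes mul: "bounded_bilinear mul" and f: "ac_deriv f f'" and g: "ac_deriv g g'"
  shows "ac_deriv (\<lambda>x. mul (f x) (g x)) (\<lambda>x. mul (f x) (g' x) + mul (f' x) (g x))"
  unfolding ac_deriv_def
proof (intro conjI allI impI)
  interpret bounded_bilinear mul by (rule mul)
  obtain K where "K > 0" and K: "\<And>x y. norm (mul x y) \<le> norm x * norm y * K" using pos_bounded by blast
  fix l :: real
  have "bounded (f ` {0..l})" "bounded (g ` {0..l})"
    by (intro compact_imp_bounded compact_continuous_image ac_deriv_continuous_on[OF f] ac_deriv_continuous_on[OF g]; simp)+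
  then obtain B C where "B > 0" "C > 0" and B: "\<And>x. x \<in> {0..l} \<Longrightarrow> norm (f x) \<le> B"
    and C: "\<And>x. x \<in> {0..l} \<Longrightarrow> norm (g x) \<le> C"
    unfolding bounded_pos by fastforce
  show "abs_continuous_on_interval 0 l (\<lambda>x. mul (f x) (g x))"
  proof (rule abs_continuous_on_interval_bound)
    fix x y assume xy: "x \<in> {0..l}" "y \<in> {0..l}"
    have "mul (f y) (g y) - mul (f x) (g x) = mul (f y) (g y - g x) + mul (f y - f x) (g x)"
      by (simp add: diff_left diff_right)
    then have "norm (mul (f y) (g y) - mul (f x) (g x)) \<le> norm (mul (f y) (g y - g x)) + norm (mul (f y - f x) (g x))"
      by (simp add: norm_triangle_ineq)
    also have "\<dots> \<le> norm (f y) * norm (g y - g x) * K + norm (f y - f x) * norm (g x) * K"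
      by (intro add_mono K)
    also have "\<dots> \<le> B * norm (g y - g x) * K + norm (f y - f x) * C * K"
      using B[OF xy(2)] C[OF xy(1)] \<open>K > 0\<close> \<open>B > 0\<close> \<open>C > 0\<close> by (intro add_mono mult_right_mono mult_mono) auto
    also have "\<dots> \<le> (B + C) * norm (g y - g x) * K + norm (f y - f x) * (B + C) * K"
      using \<open>B>0\<close> \<open>C>0\<close> \<open>K > 0\<close> by (intro add_mono mult_mono) auto
    also have "\<dots> = ((B + C) * K) * (norm (f y - f x) + norm (g y - g x))" by (simp add: algebra_simps)
    finally show "norm (mul (f y) (g y) - mul (f x) (g x)) \<le> ((B + C) * K) * (norm (f y - f x) + norm (g y - g x))" .
  qed (rule ac_deriv_AC[OF f], rule ac_deriv_AC[OF g])
next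
  have "AE x in lebesgue. x \<ge> 0 \<longrightarrow> (f has_vector_derivative f' x) (at x within {0..})"
       "AE x in lebesgue. x \<ge> 0 \<longrightarrow> (g has_vector_derivative g' x) (at x within {0..})"
    using f g by (simp_all add: ac_deriv_def)
  then show "AE x in lebesgue. x \<ge> 0 \<longrightarrow>
     ((\<lambda>x. mul (f x) (g x)) has_vector_derivative mul (f x) (g' x) + mul (f' x) (g x)) (at x within {0..})"
    by eventually_elim (auto intro!: bounded_bilinear.has_vector_derivative[OF mul])
qed

lemma ac_deriv_C1:
  fixes f :: "real \<Rightarrow> 'e::banach"
  assumes der: "\<And>x. (f has_vector_derivative f' x) (at x)" and cont: "continuous_on UNIV f'"
  shows "ac_deriv f f'"
  unfolding ac_deriv_def
proof (intro conjI allI impI)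
  fix l :: real
  have "bounded (f' ` {0..l})"
    by (intro compact_imp_bounded compact_continuous_image continuous_on_subset[OF cont]; simp)
  then obtain B where B: "B > 0" "\<And>x. x \<in> {0..l} \<Longrightarrow> norm (f' x) \<le> B"
    unfolding bounded_pos by fastforce
  show "abs_continuous_on_interval 0 l f"
  proof (rule abs_continuous_on_interval_lipschitz)
    fix x y assume xy: "x \<in> {0..l}" "y \<in> {0..l}" "x \<le> y"
    have "norm (f y - f x) \<le> B * norm (y - x)"
    proof (rule differentiable_bound[of "{0..l}" f "\<lambda>x h. h *\<^sub>R f' x" B])
      fix t assume t: "t \<in> {0..l}"
      show "(f has_derivative (\<lambda>h. h *\<^sub>R f' t)) (at t within {0..l})"
        by (rule has_derivative_at_withinI[OF der[unfolded has_vector_derivative_def]])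
      show "onorm (\<lambda>h. h *\<^sub>R f' t) \<le> B"
      proof (rule onorm_le)
        fix h :: real
        show "norm (h *\<^sub>R f' t) \<le> B * norm h"
          using mult_left_mono[OF B(2)[OF t] abs_ge_zero[of h]] by (simp add: mult.commute)
      qed
    qed (use xy in auto)
    then show "norm (f y - f x) \<le> B * (y - x)" using xy by simp
  qed
qed (rule AE_I2, rule impI, rule has_vector_derivative_at_within, rule der)

lemma ac_deriv_exp: "ac_deriv (\<lambda>x. exp (c * complex_of_real x)) (\<lambda>x. c * exp (c * complex_of_real x))"
proof (rule ac_deriv_C1)
  fix x
  have "((\<lambda>w. exp (c * w)) has_field_derivative c * exp (c * complex_of_real x)) (at (complex_of_real x))"
    by (auto intro!: derivative_eq_intros)
  then show "((\<lambda>x. exp (c * complex_of_real x)) has_vector_derivative c * exp (c * complex_of_real x)) (at x)"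
    by (rule has_vector_derivative_real_field)
qed (intro continuous_intros)

lemma ac_deriv_mono:
  fixes f :: "real \<Rightarrow> real"
  assumes "ac_deriv f g" "\<And>x. x \<ge> 0 \<Longrightarrow> g x \<ge> 0" "0 \<le> a" "a \<le> b"
  shows "f a \<le> f b"
  using has_integral_nonneg[OF ac_deriv_has_integral[OF assms(1,3,4)]] assms by simp

lemma ac_deriv_zero_imp_const:
  fixes f :: "real \<Rightarrow> 'e::banach"
  assumes "ac_deriv f g" "\<And>x. x \<ge> 0 \<Longrightarrow> g x = 0" "0 \<le> x"
  shows "f x = f 0"
proof -
  have "(g has_integral (f x - f 0)) {0..x}" by (rule ac_deriv_has_integral) (use assms in auto)
  moreover have "(g has_integral 0) {0..x}" using assms by (intro has_integral_is_0) auto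
  ultimately have "f x - f 0 = 0" by (rule has_integral_unique)
  then show ?thesis by simp
qed

section \<open>A Riemann--Lebesgue lemma\<close>

text \<open>Three approximations, each costing \<open>e/3\<close>: truncation of the values to a
  disc; approximation of the truncated function almost everywhere by continuous functions, which the
  same truncation keeps bounded so that dominated convergence applies; and polynomial approximation
  by Stone-Weierstrass.\<close>

lemma absolutely_integrable_approx_C1:
  fixes f :: "real \<Rightarrow> complex"
  assumes f: "f absolutely_integrable_on {0..X}" and e: "e > 0"
  obtains g g' where "\<And>x. (g has_vector_derivative g' x) (at x)" "continuous_on UNIV g'"
    "(\<lambda>x. norm (f x - g x)) integrable_on {0..X}"
    "integral {0..X} (\<lambda>x. norm (f x - g x)) < e"
proof -
  let ?S = "{0..X}"
  \<comment> \<open>Nearest-point projection onto a disc: continuous, the identity on values of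
    modulus at most \<open>k\<close>, and moving no value by more than its modulus, because
    \<open>0\<close> lies in the disc.\<close>
  define c where "c = (\<lambda>k::nat. closest_point (cball (0::complex) (real k)))"
  have c_cont: "continuous_on UNIV (c k)" for k
    unfolding c_def by (rule continuous_on_closest_point) auto
  have c_borel: "c k \<in> borel_measurable borel" for k
    by (rule borel_measurable_continuous_onI[OF c_cont])
  have c_id: "c k w = w" if "norm w \<le> real k" for k w
    unfolding c_def by (rule closest_point_self) (use that in auto)
  have c_dist: "norm (w - c k w) \<le> norm w" for k w
    using closest_point_le[of "cball (0::complex) (real k)" 0 w] by (auto simp: c_def dist_norm)
  have c_bound: "norm (c k w) \<le> real k" for k w
    using closest_point_in_set[of "cball (0::complex) (real k)" w] by (auto simp: c_def)
  have c_diff: "norm (c k w - c k w') \<le> 2 * real k" for k w w'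
    using norm_triangle_ineq4[of "c k w" "c k w'"] c_bound[of k w] c_bound[of k w'] by linarith
  have fm: "f \<in> borel_measurable (lebesgue_on ?S)"
    by (rule absolutely_integrable_imp_borel_measurable[OF f]) auto
  have cfm: "(\<lambda>x. c k (f x)) \<in> borel_measurable (lebesgue_on ?S)" for k
    by (rule measurable_compose[OF fm c_borel])
  have nf: "(\<lambda>x. norm (f x)) integrable_on ?S"
    using f by (simp add: absolutely_integrable_on_def)
  have i1: "(\<lambda>x. norm (f x - c k (f x))) integrable_on ?S" for k
  proof -
    have "(\<lambda>x. f x - c k (f x)) absolutely_integrable_on ?S"
      by (rule measurable_bounded_by_integrable_imp_absolutely_integrable[OF _ _ nf])
         (use fm cfm c_dist in \<open>auto intro!: borel_measurable_diff\<close>)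
    then show ?thesis by (simp add: absolutely_integrable_on_def)
  qed
  have "(\<lambda>k. integral ?S (\<lambda>x. norm (f x - c k (f x)))) \<longlonglongrightarrow> integral ?S (\<lambda>x. 0::real)"
  proof (rule dominated_convergence(2)[OF i1 nf])
    fix x
    obtain K :: nat where K: "norm (f x) \<le> real K" using real_arch_simple by blast
    have "\<forall>\<^sub>F k in sequentially. norm (f x - c k (f x)) = 0"
      using eventually_ge_at_top[of K]
    proof eventually_elim
      case (elim k)
      then have "norm (f x) \<le> real k" using K by linarith
      then show ?case using c_id by simp
    qed
    then show "(\<lambda>k. norm (f x - c k (f x))) \<longlonglongrightarrow> 0" by (rule tendsto_eventually)
  qed (use c_dist in auto)
  then have "\<forall>\<^sub>F k in sequentially. integral ?S (\<lambda>x. norm (f x - c k (f x))) < e/3"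
    using e by (intro order_tendstoD(2)[where y=0]) auto
  then obtain k where k: "integral ?S (\<lambda>x. norm (f x - c k (f x))) < e/3"
    using eventually_happens'[OF sequentially_bot] by blast
  have "f measurable_on ?S"
    using fm by (simp add: measurable_on_iff_borel_measurable)
  then obtain N g where N: "negligible N" and gc: "\<And>n. continuous_on UNIV (g n)"
    and gl: "\<And>x. x \<notin> N \<Longrightarrow> (\<lambda>n. g n x) \<longlonglongrightarrow> (if x \<in> ?S then f x else 0)"
    unfolding measurable_on_def by blast
  define h where "h = (\<lambda>n x. c k (g n x))"
  have hc: "continuous_on A (h n)" for n A
    unfolding h_def
    by (rule continuous_on_compose2[OF c_cont continuous_on_subset[OF gc]]) auto
  have i2: "(\<lambda>x. norm (c k (f x) - h n x)) integrable_on ?S" for n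
  proof -
    have "h n \<in> borel_measurable (lebesgue_on ?S)"
      by (rule continuous_imp_measurable_on_sets_lebesgue[OF hc]) auto
    then have "(\<lambda>x. c k (f x) - h n x) absolutely_integrable_on ?S"
      by (intro measurable_bounded_by_integrable_imp_absolutely_integrable[where g="\<lambda>_. 2 * real k"])
         (auto intro!: borel_measurable_diff cfm c_diff simp: h_def)
    then show ?thesis by (simp add: absolutely_integrable_on_def)
  qed
  \<comment> \<open>Dominated convergence is applied with convergence at every point, so the
    integrand is replaced by 0 on the exceptional null set.\<close>
  define r where "r = (\<lambda>n x. if x \<in> N then 0 else norm (c k (f x) - h n x))"
  have ri: "r n integrable_on ?S" for n
    by (rule integrable_spike[OF i2 N]) (auto simp: r_def)
  have req: "integral ?S (r n) = integral ?S (\<lambda>x. norm (c k (f x) - h n x))" for n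
    by (rule integral_spike[OF N]) (auto simp: r_def)
  have "(\<lambda>n. integral ?S (r n)) \<longlonglongrightarrow> integral ?S (\<lambda>x. 0::real)"
  proof (rule dominated_convergence(2)[OF ri, of "\<lambda>_. 2 * real k"])
    fix n x
    show "norm (r n x) \<le> 2 * real k" using c_diff by (simp add: r_def h_def)
  next
    fix x assume x: "x \<in> ?S"
    show "(\<lambda>n. r n x) \<longlonglongrightarrow> 0"
    proof (cases "x \<in> N")
      case False
      then have "(\<lambda>n. g n x) \<longlonglongrightarrow> f x" using gl[of x] x by simp
      moreover have "isCont (c k) (f x)" using c_cont by (simp add: continuous_on_eq_continuous_at)
      ultimately have "(\<lambda>n. h n x) \<longlonglongrightarrow> c k (f x)" unfolding h_def by (rule isCont_tendsto_compose[rotated])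
      then have "(\<lambda>n. norm (c k (f x) - h n x)) \<longlonglongrightarrow> norm (c k (f x) - c k (f x))"
        by (intro tendsto_intros)
      then show ?thesis using False by (simp add: r_def)
    qed (simp add: r_def)
  qed auto
  then have "\<forall>\<^sub>F n in sequentially. integral ?S (r n) < e/3"
    using e by (intro order_tendstoD(2)[where y=0]) auto
  then obtain n where n: "integral ?S (\<lambda>x. norm (c k (f x) - h n x)) < e/3"
    using eventually_happens'[OF sequentially_bot] req by (metis (mono_tags, lifting))
  \<comment> \<open>\<open>\<bar>X\<bar> + 1\<close> also covers \<open>X = 0\<close> and the empty
    interval of a negative \<open>X\<close>.\<close>
  define d where "d = e / (3 * (\<bar>X\<bar> + 1))"
  have d: "d > 0" using e by (simp add: d_def)
  obtain p where p: "polynomial_function p" "\<And>x. x \<in> ?S \<Longrightarrow> norm (h n x - p x) < d"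
    using Stone_Weierstrass_polynomial_function[of ?S "h n" d] hc d by auto
  obtain p' where p': "polynomial_function p'" "\<And>x. (p has_vector_derivative (p' x)) (at x)"
    using has_vector_derivative_polynomial_function[OF p(1)] by blast
  have pc: "continuous_on A p" "continuous_on A p'" for A
    using p(1) p'(1) by (auto intro: continuous_on_polymonial_function)
  have i3: "(\<lambda>x. norm (h n x - p x)) integrable_on ?S"
    by (intro integrable_continuous_real continuous_intros hc pc)
  have pint: "(\<lambda>x. norm (f x - p x)) integrable_on ?S"
    using set_integral_diff(1)[OF f absolutely_integrable_continuous_real[OF pc(1)]]
    by (simp add: absolutely_integrable_on_def)
  have "integral ?S (\<lambda>x. norm (f x - p x)) \<le>
      integral ?S (\<lambda>x. norm (f x - c k (f x)) + norm (c k (f x) - h n x) + norm (h n x - p x))"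
  proof (rule integral_le[OF pint])
    show "(\<lambda>x. norm (f x - c k (f x)) + norm (c k (f x) - h n x) + norm (h n x - p x)) integrable_on ?S"
      by (intro integrable_add i1 i2 i3)
    fix x
    have "f x - p x = (f x - c k (f x)) + (c k (f x) - h n x) + (h n x - p x)" by simp
    then show "norm (f x - p x) \<le> norm (f x - c k (f x)) + norm (c k (f x) - h n x) + norm (h n x - p x)"
      using norm_triangle_ineq[of "f x - c k (f x) + (c k (f x) - h n x)" "h n x - p x"]
        norm_triangle_ineq[of "f x - c k (f x)" "c k (f x) - h n x"] by (metis add_right_mono order_trans)
  qed
  also have "\<dots> = integral ?S (\<lambda>x. norm (f x - c k (f x))) + integral ?S (\<lambda>x. norm (c k (f x) - h n x))
       + integral ?S (\<lambda>x. norm (h n x - p x))"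
    by (simp add: integral_add i1 i2 i3 integrable_add)
  also have "integral ?S (\<lambda>x. norm (h n x - p x)) \<le> integral ?S (\<lambda>x. d)"
    by (rule integral_le[OF i3]) (use p(2) in \<open>auto intro: less_imp_le\<close>)
  also have "integral ?S (\<lambda>x. d) \<le> \<bar>X\<bar> * d"
    using d by (cases "X \<ge> 0") (auto simp: mult_nonpos_nonneg)
  also have "\<dots> \<le> e/3"
    using e unfolding d_def by (simp add: field_simps)
  finally have "integral ?S (\<lambda>x. norm (f x - p x)) < e" using k n by linarith
  then show ?thesis using that p'(2) pc(2) pint by blast
qed

lemma mult_bounded_continuous_absolutely_integrable:
  fixes f q :: "real \<Rightarrow> complex"
  assumes f: "f absolutely_integrable_on {a..b}" and q: "continuous_on {a..b} q"
  shows "(\<lambda>x. f x * q x) absolutely_integrable_on {a..b}"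
proof -
  have "(\<lambda>x. q x * f x) absolutely_integrable_on {a..b}"
  proof (rule absolutely_integrable_bounded_measurable_product[of "(*)"])
    show "bilinear ((*) :: complex \<Rightarrow> complex \<Rightarrow> complex)"
      using bounded_bilinear_mult by (simp add: bilinear_conv_bounded_bilinear)
    show "q \<in> borel_measurable (lebesgue_on {a..b})"
      by (rule continuous_imp_measurable_on_sets_lebesgue[OF q]) auto
    show "bounded (q ` {a..b})"
      by (rule compact_imp_bounded[OF compact_continuous_image[OF q]]) auto
  qed (use f in auto)
  then show ?thesis by (simp add: mult.commute)
qed

lemma integral_mult_bounded_le:
  fixes f q :: "real \<Rightarrow> complex"
  assumes f: "(\<lambda>x. f x * q x) integrable_on {a..b}" and n: "(\<lambda>x. norm (f x)) integrable_on {a..b}"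
    and B: "\<And>x. x \<in> {a..b} \<Longrightarrow> norm (q x) \<le> B"
  shows "norm (integral {a..b} (\<lambda>x. f x * q x)) \<le> B * integral {a..b} (\<lambda>x. norm (f x))"
proof -
  have "norm (integral {a..b} (\<lambda>x. f x * q x)) \<le> integral {a..b} (\<lambda>x. B * norm (f x))"
  proof (rule integral_norm_bound_integral[OF f])
    show "(\<lambda>x. B * norm (f x)) integrable_on {a..b}" using integrable_on_cmult_left[OF n, of B] by simp
    fix x assume "x \<in> {a..b}"
    from mult_right_mono[OF B[OF this], of "norm (f x)"]
    show "norm (f x * q x) \<le> B * norm (f x)" by (simp add: norm_mult mult.commute)
  qed
  then show ?thesis by simp
qed

text \<open>The bound is uniform in the right end point. Applied to the size of the potential, it is
  the source of all uniformity in \<open>z\<close> as \<open>X\<close> tends to infinity.\<close>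

lemma tail_integral_small:
  fixes n :: "real \<Rightarrow> real"
  assumes n: "n integrable_on {0..}" and nonneg: "\<And>x. n x \<ge> 0" and e: "e > 0"
  obtains X0 where "X0 \<ge> 0" "\<And>a b. X0 \<le> a \<Longrightarrow> integral {a..b} n < e"
proof -
  have I: "n integrable_on {a..b}" if "a \<ge> 0" for a b
    by (rule integrable_on_subinterval[OF n]) (use that in auto)
  define h where "h = (\<lambda>k x. if x \<in> {0..real k} then n x else 0)"
  have hr: "h k integrable_on {0..}" "integral {0..} (h k) = integral {0..real k} n" for k
    using I[of 0 "real k"] integral_restrict_Int[of "{0..}" "{0..real k}" n]
      integrable_restrict_Int[of "{0..real k}" n "{0..}"]
    by (auto simp: h_def Int_absorb2 Int_absorb1 Icc_subset_Ici_iff)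
  have "(\<lambda>k. integral {0..} (h k)) \<longlonglongrightarrow> integral {0..} n"
  proof (rule dominated_convergence(2)[OF hr(1) n])
    fix x :: real assume x: "x \<in> {0..}"
    obtain K :: nat where K: "x \<le> real K" using real_arch_simple by blast
    have "\<forall>\<^sub>F k in sequentially. h k x = n x"
      using eventually_ge_at_top[of K] by eventually_elim (use K x in \<open>auto simp: h_def\<close>)
    then show "(\<lambda>k. h k x) \<longlonglongrightarrow> n x" by (rule tendsto_eventually)
  qed (auto simp: h_def nonneg)
  then have "\<forall>\<^sub>F k in sequentially. integral {0..} n - e < integral {0..real k} n"
    unfolding hr using e by (intro order_tendstoD(1)) auto
  then obtain k :: nat where k: "integral {0..} n - e < integral {0..real k} n"
    using eventually_happens'[OF sequentially_bot] by blast
  show ?thesis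
  proof (rule that[of "real k"])
    fix a b assume a: "real k \<le> a"
    show "integral {a..b} n < e"
    proof (cases "a \<le> b")
      case True
      have "integral {0..b} n = integral {0..a} n + integral {a..b} n"
        using Henstock_Kurzweil_Integration.integral_combine[of 0 a b n] a True I[of 0 b] by simp
      moreover have "integral {0..b} n \<le> integral {0..} n"
        by (rule integral_subset_le) (use I[of 0 b] n nonneg in auto)
      moreover have "integral {0..real k} n \<le> integral {0..a} n"
        by (rule integral_subset_le) (use I a nonneg in auto)
      ultimately show ?thesis using k by linarith
    qed (use e in auto)
  qed auto
qed

text \<open>A quantitative Riemann--Lebesgue lemma: the oscillation is encoded in the differential
  equation for \<^term>\<open>q\<close>, so that the estimate is uniform in the unknown solution.\<close>

lemma riemann_lebesgue_solution:
  fixes f :: "real \<Rightarrow> complex" and n :: "real \<Rightarrow> real"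
  assumes f: "f absolutely_integrable_on {0..}" and n: "n integrable_on {0..}"
    and nonneg: "\<And>x. n x \<ge> 0" and e: "e > 0"
  obtains \<rho> where "\<rho> > 0"
    "\<And>z q c B X. \<lbrakk>cmod z > \<rho>; ac_deriv q (\<lambda>x. 2 * \<i> * z * q x + c x);
        \<And>x. x \<ge> 0 \<Longrightarrow> cmod (q x) \<le> B; \<And>x. x \<ge> 0 \<Longrightarrow> cmod (c x) \<le> B * n x; X \<ge> 0\<rbrakk>
      \<Longrightarrow> cmod (integral {0..X} (\<lambda>x. f x * q x)) \<le> e * B"
proof -
  have nf: "(\<lambda>x. norm (f x)) integrable_on {0..}"
    using f by (simp add: absolutely_integrable_on_def)
  obtain X0 where X0: "X0 \<ge> 0" "\<And>a b. X0 \<le> a \<Longrightarrow> integral {a..b} (\<lambda>x. norm (f x)) < e/3"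
    using tail_integral_small[OF nf, of "e/3"] e by auto
  have fi: "f absolutely_integrable_on {a..b}" if "a \<ge> 0" for a b
    by (rule set_integrable_subset[OF f]) (use that in auto)
  have fX: "f absolutely_integrable_on {0..X0}" by (rule fi) simp
  have e3: "e/3 > 0" using e by simp
  obtain g g' where g: "\<And>x. (g has_vector_derivative g' x) (at x)" "continuous_on UNIV g'"
    "(\<lambda>x. norm (f x - g x)) integrable_on {0..X0}"
    and gs: "integral {0..X0} (\<lambda>x. norm (f x - g x)) < e/3"
    by (rule absolutely_integrable_approx_C1[OF fX e3]) (rule that)
  have gc: "continuous_on A g" for A
    by (meson continuous_at_imp_continuous_on differentiableI_vector differentiable_imp_continuous_within g(1))
  have "bounded (g ` {0..X0})" "bounded (g' ` {0..X0})"
    by (intro compact_imp_bounded compact_continuous_image gc continuous_on_subset[OF g(2)]; simp)+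
  then obtain S S' where S: "S > 0" "\<forall>y\<in>g ` {0..X0}. norm y \<le> S" and S': "S' > 0" "\<forall>y\<in>g' ` {0..X0}. norm y \<le> S'"
    unfolding bounded_pos by blast
  have S: "S \<ge> 0" "\<And>x. x \<in> {0..X0} \<Longrightarrow> norm (g x) \<le> S"
    and S': "S' \<ge> 0" "\<And>x. x \<in> {0..X0} \<Longrightarrow> norm (g' x) \<le> S'"
    using S S' by auto
  \<comment> \<open>The terms left by integration by parts: two boundary values of \<open>g\<close>,
    the integral of \<open>g'\<close>, and the integral of \<open>g\<close> against the forcing term
    \<open>c\<close>.\<close>
  define K where "K = 2 * S + X0 * S' + S * integral {0..X0} n"
  have ni: "n integrable_on {a..b}" if "a \<ge> 0" for a b
    by (rule integrable_on_subinterval[OF n]) (use that in auto)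
  have K: "K \<ge> 0" unfolding K_def
    using S S' X0 by (intro add_nonneg_nonneg mult_nonneg_nonneg integral_nonneg ni nonneg) auto
  \<comment> \<open>Beyond this threshold \<open>K / (2 * cmod z)\<close> is at most
    \<open>e/3\<close>; the summand 1 makes it positive.\<close>
  define \<rho> where "\<rho> = 3 * K / (2 * e) + 1"
  have \<rho>: "\<rho> > 0" using K e by (simp add: \<rho>_def add_nonneg_pos)
  have "cmod (integral {0..X} (\<lambda>x. f x * q x)) \<le> e * B"
    if z: "cmod z > \<rho>" and q: "ac_deriv q (\<lambda>x. 2 * \<i> * z * q x + c x)"
      and B: "\<And>x. x \<ge> 0 \<Longrightarrow> cmod (q x) \<le> B" and c: "\<And>x. x \<ge> 0 \<Longrightarrow> cmod (c x) \<le> B * n x"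
      and X: "X \<ge> 0" for z q c B X
  proof -
    have B0: "B \<ge> 0" using B[of 0] by (smt (verit) norm_ge_zero)
    have z0: "z \<noteq> 0" using z \<rho> by auto
    have qc: "continuous_on {a..b} q" if "a \<ge> 0" for a b by (rule ac_deriv_continuous_on[OF q that])
    have fq: "(\<lambda>x. f x * q x) integrable_on {a..b}" if "a \<ge> 0" for a b
      using mult_bounded_continuous_absolutely_integrable[OF fi[OF that] qc[OF that]]
      by (simp add: absolutely_integrable_on_def)
    \<comment> \<open>Cutting at \<open>min X X0\<close> treats \<open>X\<close> on either side of
      \<open>X0\<close> at once; beyond \<open>X0\<close> the tail of \<open>f\<close> is
      small.\<close>
    define Y where "Y = min X X0"
    have Y: "0 \<le> Y" "Y \<le> X" "Y \<le> X0" using X X0 by (auto simp: Y_def)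
    have "integral {0..X} (\<lambda>x. f x * q x) = integral {0..Y} (\<lambda>x. f x * q x) + integral {Y..X} (\<lambda>x. f x * q x)"
      using Henstock_Kurzweil_Integration.integral_combine[of 0 Y X "\<lambda>x. f x * q x"] Y fq by auto
    also have "integral {0..Y} (\<lambda>x. f x * q x) =
        integral {0..Y} (\<lambda>x. (f x - g x) * q x) + integral {0..Y} (\<lambda>x. g x * q x)"
    proof -
      have gq: "(\<lambda>x. g x * q x) integrable_on {0..Y}"
        by (intro integrable_continuous_real continuous_intros gc qc) auto
      show ?thesis
        using Henstock_Kurzweil_Integration.integral_diff[OF fq gq] by (simp add: left_diff_distrib)
    qed
    finally have eq: "integral {0..X} (\<lambda>x. f x * q x) = integral {0..Y} (\<lambda>x. (f x - g x) * q x)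
        + integral {0..Y} (\<lambda>x. g x * q x) + integral {Y..X} (\<lambda>x. f x * q x)" .
    have split: "norm (integral {0..X} (\<lambda>x. f x * q x)) \<le>
       norm (integral {0..Y} (\<lambda>x. (f x - g x) * q x)) + norm (integral {0..Y} (\<lambda>x. g x * q x))
        + norm (integral {Y..X} (\<lambda>x. f x * q x))"
      unfolding eq by (rule order_trans[OF norm_triangle_ineq add_right_mono[OF norm_triangle_ineq]])
    have "norm (integral {Y..X} (\<lambda>x. f x * q x)) \<le> B * integral {Y..X} (\<lambda>x. norm (f x))"
      by (rule integral_mult_bounded_le)
         (use fq fi[of Y X] Y B in \<open>auto simp: absolutely_integrable_on_def\<close>)
    also have "\<dots> \<le> B * (e/3)"
    proof (rule mult_left_mono[OF _ B0])
      show "integral {Y..X} (\<lambda>x. norm (f x)) \<le> e/3"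
        using X0(2)[of Y X] e by (cases "X \<le> X0") (auto simp: Y_def)
    qed
    finally have b3: "norm (integral {Y..X} (\<lambda>x. f x * q x)) \<le> B * (e/3)" .
    have fgi: "(\<lambda>x. norm (f x - g x)) integrable_on {0..Y}"
      by (rule integrable_on_subinterval[OF g(3)]) (use Y in auto)
    have "norm (integral {0..Y} (\<lambda>x. (f x - g x) * q x)) \<le> B * integral {0..Y} (\<lambda>x. norm (f x - g x))"
    proof (rule integral_mult_bounded_le[OF _ fgi])
      show "(\<lambda>x. (f x - g x) * q x) integrable_on {0..Y}"
        unfolding left_diff_distrib
        by (intro integrable_diff fq integrable_continuous_real continuous_intros gc qc) auto
    qed (use B in auto)
    also have "\<dots> \<le> B * (e/3)"
    proof (rule mult_left_mono[OF _ B0])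
      have "integral {0..Y} (\<lambda>x. norm (f x - g x)) \<le> integral {0..X0} (\<lambda>x. norm (f x - g x))"
        by (rule integral_subset_le) (use Y fgi g(3) in auto)
      then show "integral {0..Y} (\<lambda>x. norm (f x - g x)) \<le> e/3" using gs by simp
    qed
    finally have b1: "norm (integral {0..Y} (\<lambda>x. (f x - g x) * q x)) \<le> B * (e/3)" .
    \<comment> \<open>The equation for \<open>q\<close> puts \<open>2 * \<i> * z * g * q\<close>
      into the derivative of \<open>g * q\<close>. Its integral is thus bounded independently of
      \<open>z\<close>, and division by \<open>2 * \<i> * z\<close> gives the decay.\<close>
    have "ac_deriv (\<lambda>x. g x * q x) (\<lambda>x. g x * (2 * \<i> * z * q x + c x) + g' x * q x)"
      by (rule ac_deriv_bilinear[OF bounded_bilinear_mult ac_deriv_C1[OF g(1,2)] q])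
    then have i0: "((\<lambda>x. g x * (2 * \<i> * z * q x + c x) + g' x * q x) has_integral g Y * q Y - g 0 * q 0) {0..Y}"
      by (rule ac_deriv_has_integral) (use Y in auto)
    have gq: "(\<lambda>x. g x * q x) integrable_on {0..Y}" and g'q: "(\<lambda>x. g' x * q x) integrable_on {0..Y}"
      by (intro integrable_continuous_real continuous_intros gc qc continuous_on_subset[OF g(2)]; simp)+
    have i1: "((\<lambda>x. 2 * \<i> * z * (g x * q x)) has_integral 2 * \<i> * z * integral {0..Y} (\<lambda>x. g x * q x)) {0..Y}"
      by (intro has_integral_mult_right integrable_integral gq)
    \<comment> \<open>Integrability of the term with \<open>c\<close> is obtained here, by
      subtracting two integrands with continuous factors from the derivative of
      \<open>g * q\<close>.\<close>
    have i2: "((\<lambda>x. g x * c x) has_integral (g Y * q Y - g 0 * q 0 - integral {0..Y} (\<lambda>x. g' x * q x)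
         - 2 * \<i> * z * integral {0..Y} (\<lambda>x. g x * q x))) {0..Y}"
      using has_integral_diff[OF has_integral_diff[OF i0 integrable_integral[OF g'q]] i1]
      by (simp add: algebra_simps)
    then have gcint: "(\<lambda>x. g x * c x) integrable_on {0..Y}" by blast
    have "2 * \<i> * z * integral {0..Y} (\<lambda>x. g x * q x) = g Y * q Y - g 0 * q 0 - integral {0..Y} (\<lambda>x. g' x * q x)
        - integral {0..Y} (\<lambda>x. g x * c x)"
      using integral_unique[OF i2] by simp
    then have *: "2 * \<i> * z * integral {0..Y} (\<lambda>x. g x * q x) = g Y * q Y - g 0 * q 0 - integral {0..Y} (\<lambda>x. g' x * q x)
        - integral {0..Y} (\<lambda>x. g x * c x)" .
    have "norm (2 * \<i> * z * integral {0..Y} (\<lambda>x. g x * q x)) \<le> norm (g Y * q Y) + norm (g 0 * q 0)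
       + norm (integral {0..Y} (\<lambda>x. g' x * q x)) + norm (integral {0..Y} (\<lambda>x. g x * c x))"
      unfolding *
      by (rule order_trans[OF norm_triangle_ineq4 add_right_mono[OF order_trans[OF norm_triangle_ineq4
           add_right_mono[OF norm_triangle_ineq4]]]])
    also have "\<dots> \<le> S * B + S * B + X0 * S' * B + S * B * integral {0..X0} n"
    proof (intro add_mono)
      show "norm (g Y * q Y) \<le> S * B" "norm (g 0 * q 0) \<le> S * B"
        unfolding norm_mult using S B Y X0 by (auto intro!: mult_mono)
      have "norm (integral {0..Y} (\<lambda>x. g' x * q x)) \<le> integral {0..Y} (\<lambda>x. S' * B)"
        by (rule integral_norm_bound_integral[OF g'q])
           (use S' B Y B0 in \<open>auto intro!: mult_mono simp: norm_mult\<close>)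
      also have "\<dots> = Y * (S' * B)" using Y by simp
      also have "\<dots> \<le> X0 * (S' * B)" using Y S' B0 by (intro mult_right_mono) auto
      finally show "norm (integral {0..Y} (\<lambda>x. g' x * q x)) \<le> X0 * S' * B" by (simp add: mult.assoc)
      have "norm (integral {0..Y} (\<lambda>x. g x * c x)) \<le> integral {0..Y} (\<lambda>x. S * B * n x)"
      proof (rule integral_norm_bound_integral[OF gcint])
        show "(\<lambda>x. S * B * n x) integrable_on {0..Y}"
          using integrable_on_cmult_left[OF ni[of 0 Y], of "S*B"] by simp
        fix x assume "x \<in> {0..Y}"
        then have "norm (g x) * norm (c x) \<le> S * (B * n x)"
          using S Y c by (intro mult_mono) auto
        then show "norm (g x * c x) \<le> S * B * n x" by (simp add: norm_mult mult.assoc)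
      qed
      also have "\<dots> = S * B * integral {0..Y} n" by simp
      also have "\<dots> \<le> S * B * integral {0..X0} n"
        by (intro mult_left_mono integral_subset_le ni) (use Y nonneg S B0 in auto)
      finally show "norm (integral {0..Y} (\<lambda>x. g x * c x)) \<le> S * B * integral {0..X0} n" .
    qed
    also have "\<dots> = K * B" by (simp add: K_def algebra_simps)
    finally have "2 * norm z * norm (integral {0..Y} (\<lambda>x. g x * q x)) \<le> K * B"
      by (simp add: norm_mult)
    moreover have "3 * K \<le> 2 * e * norm z"
    proof -
      have "3 * K / (2 * e) \<le> norm z" using z by (simp add: \<rho>_def)
      then show ?thesis using e by (simp add: field_simps)
    qed
    ultimately have "2 * norm z * norm (integral {0..Y} (\<lambda>x. g x * q x)) \<le> 2 * norm z * (e * B / 3)"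
      using mult_right_mono[of "3 * K" "2 * e * norm z" "B/3"] B0 by (simp add: algebra_simps)
    then have b2: "norm (integral {0..Y} (\<lambda>x. g x * q x)) \<le> e * B / 3"
      by (rule mult_left_le_imp_le) (use z0 in simp)
    show ?thesis using split b1 b2 b3 by (simp add: algebra_simps)
  qed
  then show ?thesis using that \<rho> by blast
qed

section \<open>Complex matrices\<close>

lemma sum_over_sum_type:
  fixes f :: "'a::finite + 'b::finite \<Rightarrow> 'c::comm_monoid_add"
  shows "(\<Sum>x\<in>UNIV. f x) = (\<Sum>i\<in>UNIV. f (Inl i)) + (\<Sum>i\<in>UNIV. f (Inr i))"
  using sum.Plus[of "UNIV :: 'a set" "UNIV :: 'b set" f] by simp

lemma cscale_nth [simp]: "(c *\<^sub>M A) $ i $ j = c * A $ i $ j"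
  by (simp add: cscale_def map_matrix_def)

lemma matrix_mult_nth: "(A ** B) $ i $ j = (\<Sum>k\<in>UNIV. A $ i $ k * B $ k $ j)"
  by (simp add: matrix_matrix_mult_def)

lemma cadj_nth [simp]: "cadj A $ i $ j = cnj (A $ j $ i)"
  by (simp add: cadj_def transpose_def map_matrix_def)

lemma block_col_nth [simp]:
  "block_col A B $ Inl i = A $ i" "block_col A B $ Inr k = B $ k"
  by (simp_all add: block_col_def)

lemma upper_lower_nth [simp]: "upper_block A $ i = A $ Inl i" "lower_block A $ k = A $ Inr k"
  by (simp_all add: upper_block_def lower_block_def)

lemma block_col_split: "block_col (upper_block A) (lower_block A) = A"
  by (simp add: vec_eq_iff block_col_def split: sum.split)

lemma J_mult_nth [simp]:
  "(J ** B) $ Inl i $ k = B $ Inl i $ k" "(J ** B) $ Inr l $ k = - B $ Inr l $ k"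
  by (simp_all add: J_def matrix_mult_nth block_matrix_def sum_over_sum_type mat_def if_distrib if_distribR cong: if_cong)

lemma mult_J_nth [simp]:
  "(B ** J) $ k $ Inl i = B $ k $ Inl i" "(B ** J) $ k $ Inr l = - B $ k $ Inr l"
  by (simp_all add: J_def matrix_mult_nth block_matrix_def sum_over_sum_type mat_def if_distrib if_distribR cong: if_cong)

lemma mult_block_col:
  "(A ** block_col B C) $ r $ k = (\<Sum>i\<in>UNIV. A $ r $ Inl i * B $ i $ k) + (\<Sum>i\<in>UNIV. A $ r $ Inr i * C $ i $ k)"
  by (simp add: matrix_mult_nth sum_over_sum_type)

lemma block_col_mult: "block_col A B ** C = block_col (A ** C) (B ** C)"
  by (simp add: vec_eq_iff block_col_def matrix_mult_nth split: sum.split)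

lemma cscale_simps:
  "c *\<^sub>M (A + B) = c *\<^sub>M A + c *\<^sub>M B" "c *\<^sub>M (A - B) = c *\<^sub>M A - c *\<^sub>M B"
  "(c + d) *\<^sub>M A = c *\<^sub>M A + d *\<^sub>M A" "c *\<^sub>M d *\<^sub>M A = (c * d) *\<^sub>M A" "1 *\<^sub>M A = A"
  "0 *\<^sub>M A = 0" "c *\<^sub>M 0 = 0" "(- c) *\<^sub>M A = - (c *\<^sub>M A)" "c *\<^sub>M (- A) = - (c *\<^sub>M A)"
  by (simp_all add: vec_eq_iff algebra_simps)

lemma cscale_mult_left: "(c *\<^sub>M A) ** B = c *\<^sub>M (A ** B)"
  and cscale_mult_right: "A ** (c *\<^sub>M B) = c *\<^sub>M (A ** B)"
  by (simp_all add: vec_eq_iff matrix_mult_nth sum_distrib_left mult_ac)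

lemma matrix_mult_distribs:
  fixes A A' :: "complex^'n^'k" and B B' :: "complex^'l^'n"
  shows "(A + A') ** B = A ** B + A' ** B" "A ** (B + B') = A ** B + A ** B'"
    "(A - A') ** B = A ** B - A' ** B" "A ** (B - B') = A ** B - A ** B'"
    "(- A) ** B = - (A ** B)" "A ** (- B) = - (A ** B)" "0 ** B = 0" "A ** 0 = 0"
  by (simp_all add: vec_eq_iff matrix_mult_nth algebra_simps sum.distrib sum_subtractf sum_negf)

lemma norm_cscale: "norm (c *\<^sub>M A) = cmod c * norm A"
proof -
  have "norm ((c *\<^sub>M A) $ i) = cmod c * norm (A $ i)" for i
    by (simp add: norm_vec_def norm_mult L2_set_right_distrib)
  then show ?thesis by (simp add: norm_vec_def[of "c *\<^sub>M A"] norm_vec_def[of A] L2_set_right_distrib)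
qed

lemma bounded_bilinear_cscale: "bounded_bilinear (\<lambda>c (A :: complex^'n^'k). c *\<^sub>M A)"
  by (rule bounded_bilinear.intro)
     (auto simp: cscale_simps norm_cscale vec_eq_iff algebra_simps intro: exI[of _ 1])

lemma bounded_bilinear_matrix_mult:
  "bounded_bilinear (\<lambda>(A :: complex^'n^'k) (B :: complex^'l^'n). A ** B)"
  unfolding bilinear_conv_bounded_bilinear[symmetric] bilinear_def
  by (auto intro!: linearI simp: matrix_mult_distribs vec_eq_iff matrix_mult_nth scaleR_sum_right)

lemma bounded_linear_cadj: "bounded_linear (cadj :: complex^'n^'k \<Rightarrow> complex^'k^'n)"
  by (rule linear_conv_bounded_linear[THEN iffD1, OF linearI])
     (auto simp: vec_eq_iff)

lemma bounded_linear_entry: "bounded_linear (\<lambda>A :: complex^'n^'k. A $ i $ j)"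
  by (intro bounded_linear_compose[OF bounded_linear_vec_nth bounded_linear_vec_nth])

lemma bounded_linear_upper_block: "bounded_linear (upper_block :: complex^'n^('a::finite+'b::finite) \<Rightarrow> _)"
  and bounded_linear_lower_block: "bounded_linear (lower_block :: complex^'n^('a::finite+'b::finite) \<Rightarrow> _)"
  by (rule linear_conv_bounded_linear[THEN iffD1, OF linearI]; simp add: vec_eq_iff)+

lemma cadj_mult: "cadj (A ** B) = cadj B ** cadj A"
  by (simp add: vec_eq_iff matrix_mult_nth mult_ac)

lemma cadj_mat1 [simp]: "cadj (mat 1) = mat 1"
  by (simp add: vec_eq_iff mat_def)

lemma norm_entry_le: "cmod (A $ i $ j) \<le> norm (A :: complex^'n^'k)"
  by (rule order_trans[OF Finite_Cartesian_Product.norm_nth_le Finite_Cartesian_Product.norm_nth_le])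

lemma norm_le_sum_entries: "norm (A :: complex^'n^'k) \<le> (\<Sum>i\<in>UNIV. \<Sum>j\<in>UNIV. cmod (A $ i $ j))"
proof -
  have "norm A \<le> (\<Sum>i\<in>UNIV. norm (A $ i))"
    unfolding norm_vec_def[of A] by (rule L2_set_le_sum) auto
  also have "\<dots> \<le> (\<Sum>i\<in>UNIV. \<Sum>j\<in>UNIV. cmod (A $ i $ j))"
    by (rule sum_mono, subst norm_vec_def, rule L2_set_le_sum) auto
  finally show ?thesis .
qed

lemma norm_le_of_entries:
  fixes A :: "complex^'n^'k"
  assumes "\<And>i j. cmod (A $ i $ j) \<le> d"
  shows "norm A \<le> real (CARD('k) * CARD('n)) * d"
proof -
  have "norm A \<le> (\<Sum>i\<in>(UNIV :: 'k set). \<Sum>j\<in>(UNIV :: 'n set). d)"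
    by (rule order_trans[OF norm_le_sum_entries]) (intro sum_mono assms)
  then show ?thesis by simp
qed

lemma norm_block_le: "norm (lower_block A) \<le> norm (A :: complex^'n^('a::finite+'b::finite))"
proof -
  have "(norm (lower_block A))\<^sup>2 \<le> (norm A)\<^sup>2"
    by (simp add: norm_vec_def[of A] norm_vec_def[of "lower_block A"] L2_set_def sum_over_sum_type sum_nonneg)
  then show ?thesis by (rule power2_le_imp_le) simp
qed

lemma norm_block_col_zero: "norm (block_col 0 B) = norm B"
  by (simp add: norm_vec_def[of "block_col 0 B"] norm_vec_def[of B] L2_set_def sum_over_sum_type)

lemma complex_inner_cnj: "inner a (m * c) = inner (cnj m * a) (c :: complex)"
  by (simp add: inner_complex_def algebra_simps)

lemma matrix_inner: "inner A B = (\<Sum>i\<in>UNIV. \<Sum>j\<in>UNIV. inner (A $ i $ j) (B $ i $ j))"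
  for A B :: "complex^'n^'k"
  by (simp add: inner_vec_def)

text \<open>\<open>inner\<close> on complex matrices is the real part of the trace form, for which
  \<open>cadj\<close> gives the adjoint of left multiplication.\<close>

lemma inner_matrix_mult_adjoint: "inner B (M ** C) = inner (cadj M ** B) C"
  for B :: "complex^'n^'k"
proof -
  have "inner B (M ** C) = (\<Sum>i\<in>UNIV. \<Sum>j\<in>UNIV. \<Sum>k\<in>UNIV. inner (cnj (M $ i $ k) * B $ i $ j) (C $ k $ j))"
    by (simp add: matrix_inner matrix_mult_nth inner_sum_right complex_inner_cnj)
  also have "\<dots> = (\<Sum>i\<in>UNIV. \<Sum>k\<in>UNIV. \<Sum>j\<in>UNIV. inner (cnj (M $ i $ k) * B $ i $ j) (C $ k $ j))"
    by (intro sum.cong refl sum.swap)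
  also have "\<dots> = (\<Sum>k\<in>UNIV. \<Sum>i\<in>UNIV. \<Sum>j\<in>UNIV. inner (cnj (M $ i $ k) * B $ i $ j) (C $ k $ j))"
    by (rule sum.swap)
  also have "\<dots> = (\<Sum>k\<in>UNIV. \<Sum>j\<in>UNIV. \<Sum>i\<in>UNIV. inner (cnj (M $ i $ k) * B $ i $ j) (C $ k $ j))"
    by (intro sum.cong refl sum.swap)
  also have "\<dots> = inner (cadj M ** B) C"
    by (simp add: matrix_inner matrix_mult_nth inner_sum_left)
  finally show ?thesis .
qed

text \<open>The Hermitian potential times \<i> has this form and therefore disappears from the
  energy identities below.\<close>

lemma inner_skew_zero:
  assumes "cadj M = - M"
  shows "inner B (M ** B) = 0"
proof -
  have "inner B (M ** B) = - inner B (M ** B)"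
    by (subst inner_matrix_mult_adjoint) (simp add: assms matrix_mult_distribs inner_commute)
  then show ?thesis by simp
qed

lemma complex_inner_mult_self: "inner a (c * a) = Re c * (cmod a)\<^sup>2"
  by (simp add: inner_complex_def cmod_power2) (simp add: power2_eq_square algebra_simps)

lemma inner_cscale_self: "inner B (c *\<^sub>M B) = Re c * ((norm (upper_block B))\<^sup>2 + (norm (lower_block B))\<^sup>2)"
  and inner_cscale_J_self: "inner B (c *\<^sub>M (J ** B)) = Re c * ((norm (upper_block B))\<^sup>2 - (norm (lower_block B))\<^sup>2)"
  for B :: "complex^'n^('a::finite+'b::finite)"
proof -
  have u: "(norm (upper_block B))\<^sup>2 = (\<Sum>i\<in>UNIV. \<Sum>j\<in>UNIV. (cmod (B $ Inl i $ j))\<^sup>2)"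
    and l: "(norm (lower_block B))\<^sup>2 = (\<Sum>i\<in>UNIV. \<Sum>j\<in>UNIV. (cmod (B $ Inr i $ j))\<^sup>2)"
    by (simp_all add: dot_square_norm[symmetric] matrix_inner)
  show "inner B (c *\<^sub>M B) = Re c * ((norm (upper_block B))\<^sup>2 + (norm (lower_block B))\<^sup>2)"
    unfolding u l matrix_inner sum_over_sum_type
    by (simp add: complex_inner_mult_self sum_distrib_left distrib_left)
  have *: "inner a (- (c * a)) = - (Re c * (cmod a)\<^sup>2)" for a
    using complex_inner_mult_self[of a c] by (metis inner_minus_right)
  show "inner B (c *\<^sub>M (J ** B)) = Re c * ((norm (upper_block B))\<^sup>2 - (norm (lower_block B))\<^sup>2)"
    unfolding u l matrix_inner sum_over_sum_type
    by (simp add: complex_inner_mult_self * sum_distrib_left right_diff_distrib sum_negf)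
qed

section \<open>The Dirac system and its Jost solution\<close>

text \<open>Multiplication by \<open>J\<close> turns the skew-adjoint \<open>potential w\<close>
  into a Hermitian matrix, with off-diagonal blocks \<open>w\<close> and
  \<open>cadj w\<close>.\<close>

definition dirac_potential :: "complex^'b::finite^'a::finite \<Rightarrow> complex^('a + 'b)^('a + 'b)" where
  "dirac_potential w = J ** potential w"

definition dirac_gen :: "(real \<Rightarrow> complex^'b::finite^'a::finite) \<Rightarrow> complex \<Rightarrow> real \<Rightarrow> complex^('a + 'b)^('a + 'b)" where
  "dirac_gen v z x = \<i> *\<^sub>M (z *\<^sub>M J + dirac_potential (v x))"

text \<open>The entrywise sum is integrable as soon as the entries are, and it dominates row sums,
  column sums and the norm.\<close>

definition potential_size :: "complex^'b::finite^'a::finite \<Rightarrow> real" where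
  "potential_size w = (\<Sum>r\<in>UNIV. \<Sum>c\<in>UNIV. cmod (dirac_potential w $ r $ c))"

lemma dirac_potential_nth [simp]:
  "dirac_potential w $ Inl i $ Inl k = 0" "dirac_potential w $ Inl i $ Inr l = w $ i $ l"
  "dirac_potential w $ Inr l $ Inl i = cnj (w $ i $ l)" "dirac_potential w $ Inr l $ Inr m = 0"
  by (simp_all add: dirac_potential_def potential_def block_matrix_def)

lemma cadj_dirac_potential: "cadj (dirac_potential w) = dirac_potential w"
proof -
  have "cadj (dirac_potential w) $ r $ c = dirac_potential w $ r $ c" for r c
    by (cases r; cases c; simp)
  then show ?thesis by (simp add: vec_eq_iff)
qed

lemma cadj_J: "cadj J = (J :: complex^('a::finite + 'b::finite)^('a + 'b))"
proof -
  have "(cadj J :: complex^('a + 'b)^('a + 'b)) $ r $ c = J $ r $ c" for r c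
    by (cases r; cases c; simp add: J_def block_matrix_def mat_def)
  then show ?thesis by (simp add: vec_eq_iff)
qed

lemma cadj_linear: "cadj (A + B) = cadj A + cadj B" "cadj (c *\<^sub>M A) = cnj c *\<^sub>M cadj A"
  by (simp_all add: vec_eq_iff)

text \<open>The symmetry behind the inverse of \<open>u\<close>: the adjoint of a solution at
  \<open>cnj z\<close> solves the adjoint equation at \<open>z\<close>.\<close>

lemma cadj_dirac_gen: "cadj (dirac_gen v (cnj z) x) = - dirac_gen v z x"
  by (simp add: dirac_gen_def cadj_linear cadj_dirac_potential cadj_J) (simp add: vec_eq_iff)

lemma dirac_gen_mult: "dirac_gen v z x ** B = (\<i> * z) *\<^sub>M (J ** B) + \<i> *\<^sub>M (dirac_potential (v x) ** B)"
  by (simp add: dirac_gen_def cscale_mult_left matrix_mult_distribs cscale_simps)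

lemma mult_dirac_gen: "B ** dirac_gen v z x = (\<i> * z) *\<^sub>M (B ** J) + \<i> *\<^sub>M (B ** dirac_potential (v x))"
  by (simp add: dirac_gen_def cscale_mult_left cscale_mult_right matrix_mult_distribs cscale_simps)

lemma inner_dirac_gen:
  "inner B (dirac_gen v z x ** B) = - Im z * ((norm (upper_block B))\<^sup>2 - (norm (lower_block B))\<^sup>2)"
proof -
  have "cadj (\<i> *\<^sub>M dirac_potential (v x)) = - (\<i> *\<^sub>M dirac_potential (v x))"
    by (simp add: cadj_linear cadj_dirac_potential cscale_simps)
  from inner_skew_zero[OF this, of B] show ?thesis
    by (simp add: dirac_gen_mult inner_add_right inner_cscale_J_self cscale_mult_left)
qed

lemma dirac_solution_iff: "dirac_solution v z y \<longleftrightarrow> ac_deriv y (\<lambda>x. dirac_gen v z x ** y x)"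
  by (simp add: dirac_solution_def ac_deriv_def dirac_gen_def dirac_potential_def)

lemma ac_deriv_mult_left:
  fixes y :: "real \<Rightarrow> complex^'n^'k"
  shows "ac_deriv y y' \<Longrightarrow> ac_deriv (\<lambda>x. C ** y x) (\<lambda>x. C ** y' x)"
  using ac_deriv_linear[OF bounded_bilinear.bounded_linear_right[OF bounded_bilinear_matrix_mult]] .

lemma ac_deriv_mult_right:
  fixes y :: "real \<Rightarrow> complex^'n^'k"
  shows "ac_deriv y y' \<Longrightarrow> ac_deriv (\<lambda>x. y x ** C) (\<lambda>x. y' x ** C)"
  using ac_deriv_linear[OF bounded_bilinear.bounded_linear_left[OF bounded_bilinear_matrix_mult]] .

lemma ac_deriv_matrix_mult:
  fixes y :: "real \<Rightarrow> complex^'n^'k" and w :: "real \<Rightarrow> complex^'l^'n"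
  shows "ac_deriv y y' \<Longrightarrow> ac_deriv w w' \<Longrightarrow> ac_deriv (\<lambda>x. y x ** w x) (\<lambda>x. y x ** w' x + y' x ** w x)"
  by (rule ac_deriv_bilinear[OF bounded_bilinear_matrix_mult])

lemma ac_deriv_cscale:
  fixes y :: "real \<Rightarrow> complex^'n^'k"
  shows "ac_deriv y y' \<Longrightarrow> ac_deriv (\<lambda>x. c *\<^sub>M y x) (\<lambda>x. c *\<^sub>M y' x)"
  using ac_deriv_linear[OF bounded_bilinear.bounded_linear_right[OF bounded_bilinear_cscale]] .

lemma ac_deriv_exp_cscale:
  fixes y :: "real \<Rightarrow> complex^'n^'k"
  assumes "ac_deriv y y'"
  shows "ac_deriv (\<lambda>x. exp (c * complex_of_real x) *\<^sub>M y x)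
     (\<lambda>x. exp (c * complex_of_real x) *\<^sub>M y' x + c *\<^sub>M (exp (c * complex_of_real x) *\<^sub>M y x))"
  using ac_deriv_bilinear[OF bounded_bilinear_cscale ac_deriv_exp assms] by (simp add: cscale_simps)

lemma ac_deriv_entry:
  fixes y :: "real \<Rightarrow> complex^'n^'k"
  shows "ac_deriv y y' \<Longrightarrow> ac_deriv (\<lambda>x. y x $ i $ j) (\<lambda>x. y' x $ i $ j)"
  by (rule ac_deriv_linear[OF bounded_linear_entry])

lemma ac_deriv_norm_mono:
  fixes y :: "real \<Rightarrow> complex^'n^'k"
  assumes y: "ac_deriv y y'" and pos: "\<And>x. x \<ge> 0 \<Longrightarrow> inner (y x) (y' x) \<ge> 0" and "0 \<le> a" "a \<le> b"
  shows "norm (y a) \<le> norm (y b)"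
proof -
  have "inner (y a) (y a) \<le> inner (y b) (y b)"
    by (rule ac_deriv_mono[OF ac_deriv_bilinear[OF bounded_bilinear_inner y y]])
       (use assms in \<open>auto simp: inner_commute\<close>)
  then show ?thesis by (simp add: norm_eq_sqrt_inner)
qed

lemma ac_deriv_norm_antimono:
  fixes y :: "real \<Rightarrow> complex^'n^'k"
  assumes y: "ac_deriv y y'" and neg: "\<And>x. x \<ge> 0 \<Longrightarrow> inner (y x) (y' x) \<le> 0" and "0 \<le> a" "a \<le> b"
  shows "norm (y b) \<le> norm (y a)"
proof -
  have "- inner (y a) (y a) \<le> - inner (y b) (y b)"
    by (rule ac_deriv_mono[OF ac_deriv_linear[OF bounded_linear_minus[OF bounded_linear_ident] ac_deriv_bilinear[OF bounded_bilinear_inner y y]]])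
       (use assms in \<open>auto simp: inner_commute intro: add_nonpos_nonpos\<close>)
  then show ?thesis by (simp add: norm_eq_sqrt_inner)
qed

abbreviation phase :: "complex \<Rightarrow> real \<Rightarrow> complex" where
  "phase z x \<equiv> exp (\<i> * z * complex_of_real x)"

abbreviation antiphase :: "complex \<Rightarrow> real \<Rightarrow> complex" where
  "antiphase z x \<equiv> exp (- \<i> * z * complex_of_real x)"

text \<open>The scalar factor contributes \<open>Im z\<close> times the whole squared norm, which
  cancels the upper block in \<open>inner_dirac_gen\<close> and doubles the lower one. With the
  opposite sign in \<open>dirac_solution_decay\<close> the upper block survives instead.\<close>

lemma dirac_solution_growth:
  fixes y :: "real \<Rightarrow> complex^'n^('a::finite + 'b::finite)"
  assumes y: "dirac_solution v z y" and z: "Im z \<ge> 0" and "0 \<le> a" "a \<le> b"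
  shows "norm (antiphase z a *\<^sub>M y a) \<le> norm (antiphase z b *\<^sub>M y b)"
proof (rule ac_deriv_norm_mono[OF ac_deriv_exp_cscale[OF y[unfolded dirac_solution_iff]] _ assms(3,4)])
  fix x :: real
  show "0 \<le> inner (antiphase z x *\<^sub>M y x) (antiphase z x *\<^sub>M (dirac_gen v z x ** y x) +
        (- \<i> * z) *\<^sub>M antiphase z x *\<^sub>M y x)" (is "0 \<le> inner ?B _")
  proof -
    have "inner ?B (antiphase z x *\<^sub>M (dirac_gen v z x ** y x) + (- \<i> * z) *\<^sub>M ?B)
       = 2 * Im z * (norm (lower_block ?B))\<^sup>2"
      unfolding cscale_mult_right[symmetric] inner_add_right inner_dirac_gen inner_cscale_self
      by (simp add: algebra_simps)
    then show ?thesis using z by simp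
  qed
qed

lemma dirac_solution_decay:
  fixes y :: "real \<Rightarrow> complex^'n^('a::finite + 'b::finite)"
  assumes y: "dirac_solution v z y" and z: "Im z \<ge> 0" and "0 \<le> a" "a \<le> b"
  shows "norm (phase z b *\<^sub>M y b) \<le> norm (phase z a *\<^sub>M y a)"
proof (rule ac_deriv_norm_antimono[OF ac_deriv_exp_cscale[OF y[unfolded dirac_solution_iff]] _ assms(3,4)])
  fix x :: real
  show "inner (phase z x *\<^sub>M y x) (phase z x *\<^sub>M (dirac_gen v z x ** y x) +
        (\<i> * z) *\<^sub>M phase z x *\<^sub>M y x) \<le> 0" (is "inner ?B _ \<le> 0")
  proof -
    have "inner ?B (phase z x *\<^sub>M (dirac_gen v z x ** y x) + (\<i> * z) *\<^sub>M ?B)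
       = - 2 * Im z * (norm (upper_block ?B))\<^sup>2"
      unfolding cscale_mult_right[symmetric] inner_add_right inner_dirac_gen inner_cscale_self
      by (simp add: algebra_simps)
    then show ?thesis using z by simp
  qed
qed

abbreviation first_columns :: "complex^'a^('a::finite + 'b::finite)" where
  "first_columns \<equiv> block_col (mat 1) 0"

section \<open>Transport of solutions and the value of the Jost columns at zero\<close>

locale dirac_system =
  fixes v :: "real \<Rightarrow> complex^'b::finite^'a::finite"
    and u :: "real \<Rightarrow> complex \<Rightarrow> complex^('a + 'b)^('a + 'b)"
  assumes V_L1: "\<And>r c. (\<lambda>x. potential (v x) $ r $ c) absolutely_integrable_on {0..}"
    and u: "normalized_fundamental v u"
begin

abbreviation W where "W x \<equiv> dirac_potential (v x)"
abbreviation nW where "nW x \<equiv> potential_size (v x)"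

text \<open>The inverse of \<^term>\<open>u x z\<close>, by the symmetry of the system under \<^term>\<open>cnj\<close>.\<close>

definition P where "P x z = cadj (u x (cnj z))"

lemma W_L1: "(\<lambda>x. W x $ r $ c) absolutely_integrable_on {0..}"
proof (cases r)
  case (Inl i)
  then show ?thesis using V_L1[of r c] by (simp add: dirac_potential_def)
next
  case (Inr l)
  have "(\<lambda>x. - (potential (v x) $ r $ c)) absolutely_integrable_on {0..}"
    using absolutely_integrable_scaleR_left[OF V_L1[of r c], of "-1"] by simp
  then show ?thesis using Inr by (simp add: dirac_potential_def)
qed

lemma nW_integrable: "nW integrable_on {0..}"
  unfolding potential_size_def
  by (intro integrable_sum finite) (use W_L1 in \<open>auto simp: absolutely_integrable_on_def\<close>)

lemma nW_nonneg: "nW x \<ge> 0"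
  by (simp add: potential_size_def sum_nonneg)

lemma nW_integrable_interval: "a \<ge> 0 \<Longrightarrow> nW integrable_on {a..b}"
  by (rule integrable_on_subinterval[OF nW_integrable]) auto

lemma norm_W_first_columns: "norm (W x ** first_columns) \<le> nW x"
proof -
  have *: "(W x ** first_columns) $ r $ c = W x $ r $ Inl c" for r c
    by (simp add: mult_block_col mat_def if_distrib cong: if_cong)
  have "norm (W x ** first_columns) \<le> (\<Sum>r\<in>UNIV. \<Sum>c\<in>UNIV. cmod (W x $ r $ Inl c))"
    using norm_le_sum_entries[of "W x ** first_columns"] unfolding * .
  also have "\<dots> \<le> nW x" unfolding potential_size_def
    by (intro sum_mono) (simp add: sum_over_sum_type sum_nonneg)
  finally show ?thesis .
qed

lemma u_deriv: "ac_deriv (\<lambda>x. u x z) (\<lambda>x. dirac_gen v z x ** u x z)"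
  using u unfolding normalized_fundamental_def fundamental_solution_def dirac_solution_iff by blast

lemma u_0 [simp]: "u 0 z = mat 1"
  using u by (simp add: normalized_fundamental_def)

lemma P_deriv: "ac_deriv (\<lambda>x. P x z) (\<lambda>x. - (P x z ** dirac_gen v z x))"
proof -
  have "cadj (dirac_gen v (cnj z) x ** u x (cnj z)) = - (P x z ** dirac_gen v z x)" for x
    by (simp add: cadj_mult cadj_dirac_gen P_def matrix_mult_distribs)
  then show ?thesis using ac_deriv_linear[OF bounded_linear_cadj u_deriv[of "cnj z"]] by (simp add: P_def)
qed

lemma P_0 [simp]: "P 0 z = mat 1"
  by (simp add: P_def)

text \<open>\<open>P\<close> solves the adjoint equation, so its product with any solution has
  derivative zero. Hence \<open>P\<close> recovers the value at \<open>0\<close> from the value at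
  \<open>x\<close>, and in particular inverts \<open>u\<close>.\<close>

lemma P_solution:
  fixes y :: "real \<Rightarrow> complex^'n^('a + 'b)"
  assumes y: "dirac_solution v z y" and x: "x \<ge> 0"
  shows "P x z ** y x = y 0"
proof -
  have "P x z ** y x = P 0 z ** y 0"
    by (rule ac_deriv_zero_imp_const[OF ac_deriv_matrix_mult[OF P_deriv y[unfolded dirac_solution_iff]] _ x])
       (simp add: matrix_mult_distribs matrix_mul_assoc)
  then show ?thesis by simp
qed

lemma P_u: "x \<ge> 0 \<Longrightarrow> P x z ** u x z = mat 1"
  using P_solution[of z "\<lambda>x. u x z" x] u_deriv by (simp add: dirac_solution_iff)

lemma u_P: "x \<ge> 0 \<Longrightarrow> u x z ** P x z = mat 1"
  using P_u matrix_left_right_inverse by blast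

lemma u_P_cancel: "x \<ge> 0 \<Longrightarrow> u x z ** (P x z ** B) = B"
  by (simp add: matrix_mul_assoc u_P)

lemma u_mult_solution: "dirac_solution v z (\<lambda>x. u x z ** C)"
  using ac_deriv_mult_right[OF u_deriv, of z C] by (simp add: dirac_solution_iff matrix_mul_assoc)

text \<open>\<open>u x z ** P s z\<close> carries the value of a solution at \<open>s\<close> back
  to \<open>x\<close>. Monotone growth between \<open>x\<close> and \<open>s\<close>, after division
  by the phase at \<open>s\<close>, is exactly this contraction.\<close>

lemma transport_contraction:
  fixes B :: "complex^'n^('a + 'b)"
  assumes z: "Im z \<ge> 0" and x: "0 \<le> x" "x \<le> s"
  shows "norm (phase z (s - x) *\<^sub>M (u x z ** (P s z ** B))) \<le> norm B"
proof -
  have "norm (antiphase z x *\<^sub>M (u x z ** (phase z s *\<^sub>M (P s z ** B))))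
      \<le> norm (antiphase z s *\<^sub>M (u s z ** (phase z s *\<^sub>M (P s z ** B))))"
    by (rule dirac_solution_growth[OF u_mult_solution z x])
  then show ?thesis using x
    by (simp add: cscale_mult_right cscale_simps u_P_cancel mult_exp_exp algebra_simps)
qed

lemma P_contraction:
  fixes B :: "complex^'n^('a + 'b)"
  assumes "Im z \<ge> 0" "0 \<le> s"
  shows "norm (phase z s *\<^sub>M (P s z ** B)) \<le> norm B"
  using transport_contraction[of z 0 s B] assms by simp

lemma u_decay:
  fixes B :: "complex^'n^('a + 'b)"
  assumes "Im z \<ge> 0" "0 \<le> x"
  shows "norm (phase z x *\<^sub>M (u x z ** B)) \<le> norm B"
  using dirac_solution_decay[OF u_mult_solution assms(1) _ assms(2), of B] by (simp add: cscale_simps)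

end

text \<open>Reduces one entry of an integrated matrix product to scalar integrals, to which the
  Riemann-Lebesgue estimate applies; the factor \<open>c\<close> will be \<i> or its
  negative.\<close>

lemma norm_has_integral_sum_le:
  fixes f q :: "'l::finite \<Rightarrow> real \<Rightarrow> complex"
  assumes D: "((\<lambda>s. c * (\<Sum>l\<in>UNIV. f l s * q l s)) has_integral D) {0..X}" and c: "cmod c = 1"
    and f: "\<And>l. f l absolutely_integrable_on {0..}" and q: "\<And>l. continuous_on {0..X} (q l)"
    and le: "\<And>l. cmod (integral {0..X} (\<lambda>s. f l s * q l s)) \<le> d"
  shows "cmod D \<le> real CARD('l) * d"
proof -
  have int: "(\<lambda>s. f l s * q l s) integrable_on {0..X}" for l
    using mult_bounded_continuous_absolutely_integrable[OF set_integrable_subset[OF f] q, of l]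
    by (auto simp: absolutely_integrable_on_def)
  have "((\<lambda>s. c * (\<Sum>l\<in>UNIV. f l s * q l s)) has_integral c * (\<Sum>l\<in>UNIV. integral {0..X} (\<lambda>s. f l s * q l s))) {0..X}"
    by (intro has_integral_mult_right has_integral_sum integrable_integral int) auto
  then have "D = c * (\<Sum>l\<in>UNIV. integral {0..X} (\<lambda>s. f l s * q l s))"
    using D has_integral_unique by blast
  then have "cmod D = cmod (\<Sum>l\<in>UNIV. integral {0..X} (\<lambda>s. f l s * q l s))"
    using c by (simp add: norm_mult)
  also have "\<dots> \<le> of_nat (card (UNIV :: 'l set)) * d"
    by (rule sum_norm_bound) (rule le)
  finally show ?thesis by simp
qed

lemma tendsto_of_local_lipschitz:
  fixes f :: "complex \<Rightarrow> 'e::real_normed_vector"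
  assumes "\<And>z. z \<in> S \<Longrightarrow> dist z z0 \<le> 1 \<Longrightarrow> norm (f z - f z0) \<le> C * cmod (z - z0)"
  shows "(f \<longlongrightarrow> f z0) (at z0 within S)"
proof -
  have "((\<lambda>z. f z - f z0) \<longlongrightarrow> 0) (at z0 within S)"
  proof (rule Lim_null_comparison)
    have "\<forall>\<^sub>F z in at z0 within S. z \<in> S \<and> dist z z0 < 1"
      unfolding eventually_at by (intro exI[of _ 1]) auto
    then show "\<forall>\<^sub>F z in at z0 within S. norm (f z - f z0) \<le> C * cmod (z - z0)"
      by eventually_elim (use assms in auto)
    have "((\<lambda>z. C * cmod (z - z0)) \<longlongrightarrow> C * cmod (z0 - z0)) (at z0 within S)"
      by (intro tendsto_intros)
    then show "((\<lambda>z. C * cmod (z - z0)) \<longlongrightarrow> 0) (at z0 within S)" by simp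
  qed
  then show ?thesis by (simp add: LIM_zero_iff)
qed

lemma matrix_mult_norm_bound:
  obtains C where "C > 0" "\<And>(A :: complex^'n^'k) (B :: complex^'l^'n). norm (A ** B) \<le> norm A * norm B * C"
proof -
  obtain C where C: "C > 0" "\<forall>(A :: complex^'n^'k) (B :: complex^'l^'n). norm (A ** B) \<le> norm A * norm B * C"
    using bounded_bilinear.pos_bounded[OF bounded_bilinear_matrix_mult] by (elim exE conjE)
  show ?thesis by (rule that[OF C(1)]) (use C(2) in simp)
qed

lemma J_first_columns: "J ** first_columns = first_columns"
proof -
  have "(J ** first_columns) $ r $ c = first_columns $ r $ c" for r :: "'a + 'b" and c
    by (cases r) simp_all
  then show ?thesis by (simp add: vec_eq_iff)
qed

context dirac_system
begin

text \<open>\<open>g X z\<close> is the value at \<open>0\<close> of the solution that equals \<open>exp (\<i> * z * X)\<close> times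
  \<open>first_columns\<close> at \<open>X\<close>; the Jost solution is obtained in the limit \<open>X \<rightarrow> \<infinity>\<close>.\<close>

definition g where "g X z = phase z X *\<^sub>M (P X z ** first_columns)"

text \<open>\<open>J\<close> fixes \<open>first_columns\<close>, so the free evolution cancels
  against the phase and only the integrable term with \<open>W\<close> remains. This cancellation is
  why \<open>g\<close> converges.\<close>

lemma g_deriv:
  "ac_deriv (\<lambda>X. g X z) (\<lambda>X. (- \<i>) *\<^sub>M (phase z X *\<^sub>M (P X z ** (W X ** first_columns))))"
  unfolding g_def
  by (rule ac_deriv_cong[OF ac_deriv_exp_cscale[OF ac_deriv_mult_right[OF P_deriv]]])
     (simp add: matrix_mul_assoc[symmetric] dirac_gen_mult J_first_columns matrix_mult_distribs cscale_mult_right cscale_simps algebra_simps)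

lemma g_0 [simp]: "g 0 z = first_columns"
  by (simp add: g_def cscale_simps)

text \<open>\<open>g_deriv\<close> is integrated after transport to \<open>x\<close>, and each value
  at \<open>s\<close> is carried from \<open>s\<close> to \<open>x\<close> by a contraction. The
  case \<open>x = 0\<close> gives convergence of \<open>g\<close>; the case \<open>x = X\<close>
  gives the asymptotics at infinity.\<close>

lemma transport_g_diff:
  assumes z: "Im z \<ge> 0" and x: "0 \<le> x" "x \<le> X" "X \<le> X'"
  shows "norm (antiphase z x *\<^sub>M (u x z ** g X' z)
    - antiphase z x *\<^sub>M (u x z ** g X z)) \<le> integral {X..X'} nW"
proof -
  let ?h' = "\<lambda>X. antiphase z x *\<^sub>M (u x z ** ((- \<i>) *\<^sub>M (phase z X *\<^sub>M (P X z ** (W X ** first_columns)))))"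
  have i: "(?h' has_integral (antiphase z x *\<^sub>M (u x z ** g X' z)
    - antiphase z x *\<^sub>M (u x z ** g X z))) {X..X'}"
    by (rule ac_deriv_has_integral[OF ac_deriv_cscale[OF ac_deriv_mult_left[OF g_deriv]]]) (use x in auto)
  have "norm (integral {X..X'} ?h') \<le> integral {X..X'} nW"
  proof (rule integral_norm_bound_integral)
    fix s assume s: "s \<in> {X..X'}"
    have "?h' s = (- \<i>) *\<^sub>M (phase z (s - x) *\<^sub>M (u x z ** (P s z ** (W s ** first_columns))))"
      by (simp only: cscale_mult_right cscale_simps(4) mult_exp_exp mult.left_commute[of _ "- \<i>"])
         (simp add: algebra_simps)
    then have "norm (?h' s) \<le> norm (W s ** first_columns)"
      using transport_contraction[OF z x(1), of s] s x by (simp add: norm_cscale)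
    then show "norm (?h' s) \<le> nW s" using norm_W_first_columns order_trans by blast
  qed (use i nW_integrable_interval x in auto)
  then show ?thesis using integral_unique[OF i] by simp
qed

lemma g_diff:
  assumes "Im z \<ge> 0" "0 \<le> X" "X \<le> X'"
  shows "norm (g X' z - g X z) \<le> integral {X..X'} nW"
  using transport_g_diff[of z 0 X X'] assms by (simp add: cscale_simps)

lemma nW_tail:
  assumes "e > 0"
  obtains X0 where "X0 \<ge> 0" "\<And>a b. X0 \<le> a \<Longrightarrow> integral {a..b} nW < e"
  by (rule tail_integral_small[OF nW_integrable nW_nonneg assms]) (rule that)

text \<open>This will be \<open>Y (0, z)\<close> on the closed upper half-plane. A limit along the
  integers is enough, because \<open>g_diff\<close> controls \<open>g\<close> between them.\<close>

definition jost_value where "jost_value z = lim (\<lambda>n. g (real n) z)"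

lemma jost_value_sequence:
  assumes z: "Im z \<ge> 0"
  shows "(\<lambda>n. g (real n) z) \<longlonglongrightarrow> jost_value z"
proof -
  have "Cauchy (\<lambda>n. g (real n) z)"
  proof (rule CauchyI')
    fix e :: real assume "e > 0"
    then obtain X0 where X0: "X0 \<ge> 0" "\<And>a b. X0 \<le> a \<Longrightarrow> integral {a..b} nW < e"
      by (rule nW_tail) (rule that)
    obtain N :: nat where N: "X0 \<le> real N" using real_arch_simple by blast
    have "dist (g (real m) z) (g (real n) z) < e" if "N \<le> m" "m < n" for m n
    proof -
      have "norm (g (real n) z - g (real m) z) \<le> integral {real m..real n} nW"
        using g_diff[OF z, of "real m" "real n"] that by simp
      also have "\<dots> < e" using X0(2) N that by simp
      finally show ?thesis by (simp add: dist_norm norm_minus_commute)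
    qed
    then show "\<exists>M. \<forall>m\<ge>M. \<forall>n>m. dist (g (real m) z) (g (real n) z) < e" by blast
  qed
  then show ?thesis unfolding jost_value_def
    by (simp add: Cauchy_convergent_iff convergent_LIMSEQ_iff)
qed

lemma transport_jost_value:
  assumes z: "Im z \<ge> 0" and x: "0 \<le> x"
  shows "(\<lambda>n. antiphase z x *\<^sub>M (u x z ** g (real n) z))
     \<longlonglongrightarrow> antiphase z x *\<^sub>M (u x z ** jost_value z)"
  by (intro bounded_bilinear.tendsto[OF bounded_bilinear_cscale] bounded_bilinear.tendsto[OF bounded_bilinear_matrix_mult]
      tendsto_const jost_value_sequence z)

lemma transport_jost_value_diff:
  assumes z: "Im z \<ge> 0" and x: "0 \<le> x" "x \<le> X" and e: "\<And>X'. integral {X..X'} nW \<le> e"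
  shows "norm (antiphase z x *\<^sub>M (u x z ** jost_value z)
    - antiphase z x *\<^sub>M (u x z ** g X z)) \<le> e"
proof (rule tendsto_upperbound[OF tendsto_norm[OF tendsto_diff[OF transport_jost_value[OF z x(1)] tendsto_const]]])
  obtain N :: nat where N: "X \<le> real N" using real_arch_simple by blast
  show "\<forall>\<^sub>F n in sequentially. norm (antiphase z x *\<^sub>M (u x z ** g (real n) z)
    - antiphase z x *\<^sub>M (u x z ** g X z)) \<le> e"
    using eventually_ge_at_top[of N]
  proof eventually_elim
    case (elim n)
    then have "X \<le> real n" using N by linarith
    from order_trans[OF transport_g_diff[OF z x this] e] show ?case .
  qed
qed auto

lemma jost_value_uniform:
  assumes "e > 0"
  obtains X0 where "X0 \<ge> 0" "\<And>X z. X \<ge> X0 \<Longrightarrow> Im z \<ge> 0 \<Longrightarrow> norm (jost_value z - g X z) \<le> e"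
proof -
  obtain X0 where X0: "X0 \<ge> 0" "\<And>a b. X0 \<le> a \<Longrightarrow> integral {a..b} nW < e"
    using assms by (rule nW_tail) (rule that)
  show ?thesis
  proof (rule that[OF X0(1)])
    fix X z assume "X0 \<le> X" "0 \<le> Im z"
    then show "norm (jost_value z - g X z) \<le> e"
      using transport_jost_value_diff[of z 0 X e] X0 by (force simp: cscale_simps intro: less_imp_le)
  qed
qed

lemma jost_value_asymptotics:
  assumes "e > 0"
  obtains X0 where "X0 \<ge> 0" "\<And>x z. x \<ge> X0 \<Longrightarrow> Im z \<ge> 0 \<Longrightarrow>
     norm (antiphase z x *\<^sub>M (u x z ** jost_value z) - first_columns) \<le> e"
proof -
  obtain X0 where X0: "X0 \<ge> 0" "\<And>a b. X0 \<le> a \<Longrightarrow> integral {a..b} nW < e"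
    using assms by (rule nW_tail) (rule that)
  show ?thesis
  proof (rule that[OF X0(1)])
    fix x z assume x: "X0 \<le> x" and z: "0 \<le> Im z"
    then have "x \<ge> 0" using X0 by simp
    \<comment> \<open>\<open>u x z\<close> undoes \<open>P x z\<close> and the two phases cancel, so
      the term compared with is exactly the expected leading term.\<close>
    then have *: "antiphase z x *\<^sub>M (u x z ** g x z) = first_columns"
      by (simp add: g_def cscale_mult_right cscale_simps u_P_cancel mult_exp_exp)
    show "norm (antiphase z x *\<^sub>M (u x z ** jost_value z) - first_columns) \<le> e"
      unfolding *[symmetric]
      by (rule transport_jost_value_diff[OF z \<open>x \<ge> 0\<close> order_refl less_imp_le[OF X0(2)[OF x]]])
  qed
qed

text \<open>The contraction holds before the limit and passes to it. At \<open>x = 0\<close> this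
  bounds the determinant of the upper block; at general \<open>x\<close> it yields both the Weyl
  condition and the GW bound.\<close>

lemma jost_value_bound:
  assumes z: "Im z \<ge> 0" and x: "0 \<le> x"
  shows "norm (antiphase z x *\<^sub>M (u x z ** jost_value z)) \<le> norm (first_columns :: complex^'a^('a + 'b))"
proof (rule tendsto_upperbound[OF tendsto_norm[OF transport_jost_value[OF assms]]])
  obtain N :: nat where N: "x \<le> real N" using real_arch_simple by blast
  show "\<forall>\<^sub>F n in sequentially. norm (antiphase z x *\<^sub>M (u x z ** g (real n) z)) \<le> norm (first_columns :: complex^'a^('a + 'b))"
    using eventually_ge_at_top[of N]
  proof eventually_elim
    case (elim n)
    then have n: "x \<le> real n" using N by linarith
    have "antiphase z x *\<^sub>M (u x z ** g (real n) z)
      = phase z (real n - x) *\<^sub>M (u x z ** (P (real n) z ** first_columns))"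
      by (simp add: g_def cscale_mult_right cscale_simps mult_exp_exp algebra_simps)
    then show ?case using transport_contraction[OF z x n, of first_columns] by metis
  qed
qed auto

lemma norm_jost_value_le: "Im z \<ge> 0 \<Longrightarrow> norm (jost_value z) \<le> norm (first_columns :: complex^'a^('a + 'b))"
  using jost_value_bound[of z 0] by (simp add: cscale_simps)

section \<open>Dependence on the spectral parameter\<close>

definition Q where "Q x z z0 = integral {0..x} (\<lambda>s. P s z ** (J ** u s z0))"

text \<open>In the derivative of \<open>P x z ** u x z0\<close> the potential cancels and
  \<open>z0 - z\<close> factors out; multiplication by \<open>P x z0\<close> on the right then
  isolates \<open>P x z\<close>. The formula is an exact difference quotient, from which continuity
  and holomorphy in \<open>z\<close> follow.\<close>

lemma P_diff:
  assumes x: "x \<ge> 0"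
  shows "P x z - P x z0 = (z - z0) *\<^sub>M ((- \<i>) *\<^sub>M (Q x z z0 ** P x z0))"
proof -
  have "ac_deriv (\<lambda>x. P x z ** u x z0) (\<lambda>x. (\<i> * (z0 - z)) *\<^sub>M (P x z ** (J ** u x z0)))"
  proof (rule ac_deriv_cong[OF ac_deriv_matrix_mult[OF P_deriv u_deriv]])
    fix x
    have "P x z ** (dirac_gen v z0 x ** u x z0) + - (P x z ** dirac_gen v z x) ** u x z0
      = P x z ** (dirac_gen v z0 x ** u x z0) - P x z ** (dirac_gen v z x ** u x z0)"
      by (simp add: matrix_mul_assoc matrix_mult_distribs)
    also have "\<dots> = (\<i> * z0) *\<^sub>M (P x z ** (J ** u x z0)) - (\<i> * z) *\<^sub>M (P x z ** (J ** u x z0))"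
      by (simp add: dirac_gen_mult matrix_mult_distribs cscale_mult_right)
    also have "\<dots> = (\<i> * (z0 - z)) *\<^sub>M (P x z ** (J ** u x z0))"
      by (simp add: vec_eq_iff algebra_simps)
    finally show "P x z ** (dirac_gen v z0 x ** u x z0) + - (P x z ** dirac_gen v z x) ** u x z0
      = (\<i> * (z0 - z)) *\<^sub>M (P x z ** (J ** u x z0))" .
  qed
  from ac_deriv_has_integral[OF this order_refl x]
  have "((\<lambda>x. (\<i> * (z0 - z)) *\<^sub>M (P x z ** (J ** u x z0))) has_integral (P x z ** u x z0 - mat 1)) {0..x}"
    by simp
  moreover have "((\<lambda>x. (\<i> * (z0 - z)) *\<^sub>M (P x z ** (J ** u x z0))) has_integral (\<i> * (z0 - z)) *\<^sub>M Q x z z0) {0..x}"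
    unfolding Q_def
    by (intro has_integral_linear[OF _ bounded_bilinear.bounded_linear_right[OF bounded_bilinear_cscale], unfolded o_def]
        integrable_integral integrable_continuous_real
        bounded_bilinear.continuous_on[OF bounded_bilinear_matrix_mult] continuous_on_const
        ac_deriv_continuous_on[OF P_deriv] ac_deriv_continuous_on[OF u_deriv]) auto
  ultimately have "P x z ** u x z0 - mat 1 = (\<i> * (z0 - z)) *\<^sub>M Q x z z0"
    by (rule has_integral_unique)
  then have "(P x z ** u x z0 - mat 1) ** P x z0 = (\<i> * (z0 - z)) *\<^sub>M Q x z z0 ** P x z0" by simp
  then have "P x z - P x z0 = (\<i> * (z0 - z)) *\<^sub>M (Q x z z0 ** P x z0)"
    using u_P[OF x, of z0] by (simp add: matrix_mult_distribs matrix_mul_assoc[symmetric] cscale_mult_left)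
  then show ?thesis by (simp add: vec_eq_iff algebra_simps)
qed

lemma norm_P_le:
  assumes z: "Im z \<ge> 0" and x: "x \<ge> 0"
  shows "norm (P x z) \<le> norm (mat 1 :: complex^('a + 'b)^('a + 'b)) * exp (Im z * x)"
proof -
  have "norm (phase z x *\<^sub>M P x z) \<le> norm (mat 1 :: complex^('a + 'b)^('a + 'b))"
    using P_contraction[OF z x, of "mat 1"] by simp
  then have "exp (- (Im z * x)) * norm (P x z) \<le> norm (mat 1 :: complex^('a + 'b)^('a + 'b))"
    by (simp add: norm_cscale)
  then show ?thesis by (simp add: exp_minus field_simps)
qed

text \<open>The left factor \<open>D\<close> is left free for two uses: as \<open>P s z\<close> it
  bounds \<open>Q\<close>, and as the difference of \<open>P\<close> at two parameters it bounds
  increments of \<open>Q\<close>.\<close>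

lemma Q_bound:
  assumes X: "X \<ge> 0"
  obtains K where "K \<ge> 0"
    "\<And>D x d. \<lbrakk>0 \<le> x; x \<le> X; continuous_on {0..x} D; \<forall>s\<in>{0..x}. norm (D s) \<le> d\<rbrakk>
      \<Longrightarrow> norm (integral {0..x} (\<lambda>s. D s ** (J ** u s z0) :: complex^('a + 'b)^('a + 'b))) \<le> K * d"
proof -
  obtain C where C: "C > 0" "\<And>(A :: complex^('a+'b)^('a+'b)) (B :: complex^('a+'b)^('a+'b)). norm (A ** B) \<le> norm A * norm B * C"
    by (rule matrix_mult_norm_bound) (rule that)
  have Jc: "continuous_on {0..x} (\<lambda>s. J ** u s z0)" for x
    by (intro bounded_bilinear.continuous_on[OF bounded_bilinear_matrix_mult] continuous_on_const ac_deriv_continuous_on[OF u_deriv]) auto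
  have "bounded ((\<lambda>s. J ** u s z0) ` {0..X})"
    by (intro compact_imp_bounded compact_continuous_image Jc) auto
  then obtain S where S: "S > 0" "\<And>s. s \<in> {0..X} \<Longrightarrow> norm (J ** u s z0) \<le> S"
    unfolding bounded_pos by auto
  show ?thesis
  proof (rule that[of "X * (S * C)"])
    show "0 \<le> X * (S * C)" using X S C by simp
    fix D :: "real \<Rightarrow> complex^('a+'b)^('a+'b)" and x d
    assume x: "0 \<le> x" "x \<le> X" and Dc: "continuous_on {0..x} D" and "\<forall>s\<in>{0..x}. norm (D s) \<le> d"
    then have d: "\<And>s. s \<in> {0..x} \<Longrightarrow> norm (D s) \<le> d" by blast
    have d0: "d \<ge> 0" by (rule order_trans[OF norm_ge_zero d[of 0]]) (use x in simp)
    have "norm (integral {0..x} (\<lambda>s. D s ** (J ** u s z0))) \<le> integral {0..x} (\<lambda>s. d * S * C)"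
    proof (rule integral_norm_bound_integral)
      show "(\<lambda>s. D s ** (J ** u s z0)) integrable_on {0..x}"
        by (intro integrable_continuous_real bounded_bilinear.continuous_on[OF bounded_bilinear_matrix_mult] Dc Jc)
      fix s assume s: "s \<in> {0..x}"
      have "norm (D s ** (J ** u s z0)) \<le> norm (D s) * norm (J ** u s z0) * C" by (rule C)
      also have "\<dots> \<le> d * S * C"
        using d[OF s] S(2)[of s] s x C(1) d0 by (intro mult_right_mono mult_mono) auto
      finally show "norm (D s ** (J ** u s z0)) \<le> d * S * C" .
    qed auto
    also have "\<dots> = x * (d * S * C)" using x by simp
    also have "\<dots> \<le> X * (d * S * C)" using x d0 S C by (intro mult_right_mono) auto
    finally show "norm (integral {0..x} (\<lambda>s. D s ** (J ** u s z0))) \<le> X * (S * C) * d"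
      by (simp add: mult_ac)
  qed
qed

lemma P_local_lipschitz:
  assumes z0: "Im z0 \<ge> 0" and X: "X \<ge> 0"
  obtains C where "C \<ge> 0" "\<And>z x. \<lbrakk>Im z \<ge> 0; dist z z0 \<le> 1; 0 \<le> x; x \<le> X\<rbrakk> \<Longrightarrow>
     norm (P x z - P x z0) \<le> C * cmod (z - z0)"
proof -
  obtain K where K: "K \<ge> 0"
    "\<And>D x d. \<lbrakk>0 \<le> x; x \<le> X; continuous_on {0..x} D; \<forall>s\<in>{0..x}. norm (D s) \<le> d\<rbrakk>
      \<Longrightarrow> norm (integral {0..x} (\<lambda>s. D s ** (J ** u s z0) :: complex^('a + 'b)^('a + 'b))) \<le> K * d"
    by (rule Q_bound[where ?z0.0 = z0, OF X]) (rule that)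
  obtain C where C: "C > 0" "\<And>(A :: complex^('a+'b)^('a+'b)) (B :: complex^('a+'b)^('a+'b)). norm (A ** B) \<le> norm A * norm B * C"
    by (rule matrix_mult_norm_bound) (rule that)
  \<comment> \<open>For \<open>dist z z0 \<le> 1\<close> the exponent \<open>Im z * x\<close> of
    \<open>norm_P_le\<close> is at most \<open>(Im z0 + 1) * X\<close>.\<close>
  define E where "E = norm (mat 1 :: complex^('a + 'b)^('a + 'b)) * exp ((Im z0 + 1) * X)"
  have E: "E \<ge> 0" by (simp add: E_def)
  have PE: "norm (P x z) \<le> E" if "Im z \<ge> 0" "dist z z0 \<le> 1" "0 \<le> x" "x \<le> X" for x z
  proof -
    have "\<bar>Im z - Im z0\<bar> \<le> 1" using that abs_Im_le_cmod[of "z - z0"] by (simp add: dist_norm)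
    then have "Im z * x \<le> (Im z0 + 1) * X" using that z0 by (intro mult_mono) auto
    then show ?thesis unfolding E_def
      by (intro order_trans[OF norm_P_le[OF that(1,3)]] mult_left_mono) auto
  qed
  show ?thesis
  proof (rule that[of "K * E * E * C"])
    show "0 \<le> K * E * E * C" using K C E by simp
    fix z x assume z: "Im z \<ge> 0" "dist z z0 \<le> 1" and x: "0 \<le> x" "x \<le> X"
    have "norm (Q x z z0) \<le> K * E" unfolding Q_def
      by (rule K(2)[OF x]) (use PE z x ac_deriv_continuous_on[OF P_deriv] in auto)
    then have "norm (Q x z z0 ** P x z0) \<le> K * E * E * C"
      using PE[OF z0 _ x] C K(1) E
      by (intro order_trans[OF C(2)] mult_right_mono mult_mono) auto
    then have "cmod (z - z0) * norm (Q x z z0 ** P x z0) \<le> K * E * E * C * cmod (z - z0)"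
      by (metis mult.commute mult_left_mono norm_ge_zero)
    then show "norm (P x z - P x z0) \<le> K * E * E * C * cmod (z - z0)"
      by (simp add: P_diff[OF x(1), of z z0] norm_cscale)
  qed
qed

lemma P_continuous_on:
  assumes X: "X \<ge> 0"
  shows "continuous_on {z. Im z \<ge> 0} (P X)"
  unfolding continuous_on_def
proof
  fix z0 :: complex assume "z0 \<in> {z. Im z \<ge> 0}"
  then have "Im z0 \<ge> 0" by simp
  obtain C where C: "C \<ge> 0" "\<And>z x. \<lbrakk>Im z \<ge> 0; dist z z0 \<le> 1; 0 \<le> x; x \<le> X\<rbrakk> \<Longrightarrow>
     norm (P x z - P x z0) \<le> C * cmod (z - z0)"
    by (rule P_local_lipschitz[OF \<open>Im z0 \<ge> 0\<close> X]) (rule that)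
  show "(P X \<longlongrightarrow> P X z0) (at z0 within {z. Im z \<ge> 0})"
    by (rule tendsto_of_local_lipschitz[of _ _ _ C]) (use C X in auto)
qed

text \<open>Caratheodory's form of the derivative: \<open>P_diff\<close> exhibits the slope as a
  function of \<open>z\<close>, and its continuity at \<open>z0\<close> is the local Lipschitz bound
  inserted into \<open>Q\<close>.\<close>

lemma P_holomorphic:
  assumes X: "X \<ge> 0"
  shows "(\<lambda>z. P X z $ r $ c) holomorphic_on upper_half 0"
  unfolding holomorphic_on_def field_differentiable_def DERIV_caratheodory_within
proof
  fix z0 assume "z0 \<in> upper_half 0"
  then have z0: "Im z0 \<ge> 0" by (simp add: upper_half_def)
  obtain C where C: "C \<ge> 0" "\<And>z x. \<lbrakk>Im z \<ge> 0; dist z z0 \<le> 1; 0 \<le> x; x \<le> X\<rbrakk> \<Longrightarrow>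
     norm (P x z - P x z0) \<le> C * cmod (z - z0)"
    by (rule P_local_lipschitz[OF z0 X]) (rule that)
  obtain K where K: "K \<ge> 0"
    "\<And>D x d. \<lbrakk>0 \<le> x; x \<le> X; continuous_on {0..x} D; \<forall>s\<in>{0..x}. norm (D s) \<le> d\<rbrakk>
      \<Longrightarrow> norm (integral {0..x} (\<lambda>s. D s ** (J ** u s z0) :: complex^('a + 'b)^('a + 'b))) \<le> K * d"
    by (rule Q_bound[where ?z0.0 = z0, OF X]) (rule that)
  let ?h = "\<lambda>z. ((- \<i>) *\<^sub>M (Q X z z0 ** P X z0)) $ r $ c"
  have Qt: "((\<lambda>z. Q X z z0) \<longlongrightarrow> Q X z0 z0) (at z0 within upper_half 0)"
  proof (rule tendsto_of_local_lipschitz[of _ _ _ "K * C"])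
    fix z assume z: "z \<in> upper_half 0" "dist z z0 \<le> 1"
    have Pc: "continuous_on {0..X} (\<lambda>s. P s z)" for z
      by (rule ac_deriv_continuous_on[OF P_deriv]) simp
    have int: "(\<lambda>s. P s z ** (J ** u s z0)) integrable_on {0..X}" for z
      by (intro integrable_continuous_real bounded_bilinear.continuous_on[OF bounded_bilinear_matrix_mult]
          continuous_on_const Pc ac_deriv_continuous_on[OF u_deriv]) auto
    have "Q X z z0 - Q X z0 z0 = integral {0..X} (\<lambda>s. (P s z - P s z0) ** (J ** u s z0))"
      unfolding Q_def by (simp add: Henstock_Kurzweil_Integration.integral_diff[OF int int] matrix_mult_distribs)
    also have "norm \<dots> \<le> K * (C * cmod (z - z0))"
      by (rule K(2)) (use C z X Pc in \<open>auto simp: upper_half_def intro!: continuous_on_diff\<close>)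
    finally show "norm (Q X z z0 - Q X z0 z0) \<le> K * C * cmod (z - z0)" by (simp add: mult.assoc)
  qed
  have "(?h \<longlongrightarrow> ?h z0) (at z0 within upper_half 0)"
    by (intro bounded_linear.tendsto[OF bounded_linear_entry] bounded_bilinear.tendsto[OF bounded_bilinear_cscale]
        bounded_bilinear.tendsto[OF bounded_bilinear_matrix_mult] tendsto_const Qt)
  then have c: "continuous (at z0 within upper_half 0) ?h"
    by (simp add: continuous_within)
  have e: "P X z $ r $ c - P X z0 $ r $ c = ?h z * (z - z0)" for z
    using P_diff[OF X, of z z0] by (simp add: vec_eq_iff mult.commute)
  show "\<exists>f' h. (\<forall>z. P X z $ r $ c - P X z0 $ r $ c = h z * (z - z0)) \<and>
       continuous (at z0 within upper_half 0) h \<and> h z0 = f'"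
    by (rule exI[of _ "?h z0"], rule exI[of _ ?h]) (use c e in simp)
qed

lemma g_continuous_on: "X \<ge> 0 \<Longrightarrow> continuous_on {z. Im z \<ge> 0} (g X)"
  unfolding g_def
  by (intro bounded_bilinear.continuous_on[OF bounded_bilinear_cscale]
      bounded_bilinear.continuous_on[OF bounded_bilinear_matrix_mult] continuous_intros P_continuous_on)

lemma g_holomorphic: "X \<ge> 0 \<Longrightarrow> (\<lambda>z. g X z $ r $ c) holomorphic_on upper_half 0"
  unfolding g_def by (auto simp: matrix_mult_nth intro!: holomorphic_intros P_holomorphic)

lemma jost_value_uniform_limit:
  "uniform_limit {z. Im z \<ge> 0} (\<lambda>n. g (real n)) jost_value sequentially"
proof (rule uniform_limitI)
  fix e :: real assume "e > 0"
  then have "e/2 > 0" by simp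
  then obtain X0 where X0: "X0 \<ge> 0" "\<And>X z. X \<ge> X0 \<Longrightarrow> Im z \<ge> 0 \<Longrightarrow> norm (jost_value z - g X z) \<le> e/2"
    by (rule jost_value_uniform) (rule that)
  obtain N :: nat where N: "X0 \<le> real N" using real_arch_simple by blast
  show "\<forall>\<^sub>F n in sequentially. \<forall>z\<in>{z. Im z \<ge> 0}. dist (g (real n) z) (jost_value z) < e"
    using eventually_ge_at_top[of N]
  proof eventually_elim
    case (elim n)
    have "dist (g (real n) z) (jost_value z) \<le> e/2" if "Im z \<ge> 0" for z
      using X0(2)[of "real n" z] that elim N by (simp add: dist_norm norm_minus_commute)
    then show ?case using \<open>e > 0\<close> by fastforce
  qed
qed

lemma jost_value_continuous_on: "continuous_on {z. Im z \<ge> 0} jost_value"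
  by (rule uniform_limit_theorem[OF _ jost_value_uniform_limit]) (auto intro!: always_eventually g_continuous_on)

lemma open_upper_half: "open (upper_half M)"
  unfolding upper_half_def by (rule open_halfspace_Im_gt)

lemma jost_value_holomorphic: "(\<lambda>z. jost_value z $ r $ c) holomorphic_on upper_half 0"
proof (rule holomorphic_uniform_sequence[OF open_upper_half])
  fix n show "(\<lambda>z. g (real n) z $ r $ c) holomorphic_on upper_half 0" by (rule g_holomorphic) simp
next
  fix z assume "z \<in> upper_half 0"
  then obtain d where d: "d > 0" "cball z d \<subseteq> upper_half 0"
    using open_upper_half open_contains_cball by blast
  then have "cball z d \<subseteq> {z. Im z \<ge> 0}" by (auto simp: upper_half_def)
  then have "uniform_limit (cball z d) (\<lambda>n z. g (real n) z $ r $ c) (\<lambda>z. jost_value z $ r $ c) sequentially"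
    by (intro bounded_linear.uniform_limit[OF bounded_linear_entry] uniform_limit_on_subset[OF jost_value_uniform_limit])
  then show "\<exists>d>0. cball z d \<subseteq> upper_half 0 \<and>
      uniform_limit (cball z d) (\<lambda>n z. g (real n) z $ r $ c) (\<lambda>z. jost_value z $ r $ c) sequentially"
    using d by blast
qed

section \<open>Asymptotics for large spectral parameters\<close>

definition oscillating where
  "oscillating z B q \<longleftrightarrow> (\<exists>d. ac_deriv q (\<lambda>x. 2 * \<i> * z * q x + d x) \<and>
     (\<forall>x\<ge>0. cmod (q x) \<le> B) \<and> (\<forall>x\<ge>0. cmod (d x) \<le> B * nW x))"

lemma riemann_lebesgue_W:
  assumes e: "e > 0"
  obtains \<rho> where "\<rho> > 0"
    "\<And>r c z q B X. \<lbrakk>cmod z > \<rho>; oscillating z B q; X \<ge> 0\<rbrakk>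
      \<Longrightarrow> cmod (integral {0..X} (\<lambda>x. W x $ r $ c * q x)) \<le> e * B"
proof -
  have "\<exists>\<rho>>0. \<forall>z q B X. cmod z > \<rho> \<longrightarrow> oscillating z B q \<longrightarrow> X \<ge> 0
      \<longrightarrow> cmod (integral {0..X} (\<lambda>x. W x $ r $ c * q x)) \<le> e * B" for r c
  proof (rule riemann_lebesgue_solution[OF W_L1[of r c] nW_integrable nW_nonneg e])
    fix \<rho> :: real
    assume "\<rho> > 0" and *: "\<And>z q d B X. \<lbrakk>cmod z > \<rho>; ac_deriv q (\<lambda>x. 2 * \<i> * z * q x + d x);
        \<And>x. x \<ge> 0 \<Longrightarrow> cmod (q x) \<le> B; \<And>x. x \<ge> 0 \<Longrightarrow> cmod (d x) \<le> B * nW x; X \<ge> 0\<rbrakk>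
      \<Longrightarrow> cmod (integral {0..X} (\<lambda>x. W x $ r $ c * q x)) \<le> e * B"
    show ?thesis
      unfolding oscillating_def
      by (intro exI[of _ \<rho>] conjI allI impI \<open>\<rho> > 0\<close>, elim exE conjE, rule *) auto
  qed
  then have "\<forall>p. \<exists>\<rho>>0. \<forall>z q B X. cmod z > \<rho> \<longrightarrow> oscillating z B q \<longrightarrow> X \<ge> 0
      \<longrightarrow> cmod (integral {0..X} (\<lambda>x. W x $ fst p $ snd p * q x)) \<le> e * B"
    by blast
  from choice[OF this] obtain \<rho> where \<rho>: "\<forall>p. \<rho> p > 0 \<and> (\<forall>z q B X. cmod z > \<rho> p \<longrightarrow> oscillating z B q \<longrightarrow> X \<ge> 0
      \<longrightarrow> cmod (integral {0..X} (\<lambda>x. W x $ fst p $ snd p * q x)) \<le> e * B)"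
    by blast
  \<comment> \<open>The sum of the finitely many positive thresholds exceeds each of them, so one
    threshold serves every entry of \<open>W\<close>.\<close>
  define R where "R = sum \<rho> UNIV"
  have R: "\<rho> p \<le> R" for p
    unfolding R_def by (rule member_le_sum) (use \<rho> in \<open>auto intro: less_imp_le\<close>)
  have "R > 0" unfolding R_def by (rule sum_pos) (use \<rho> in auto)
  show ?thesis
  proof (rule that[OF \<open>R > 0\<close>])
    fix r c z q B and X :: real
    assume *: "cmod z > R" "oscillating z B q" "X \<ge> 0"
    have "cmod z > \<rho> (r, c)" using *(1) R[of "(r, c)"] by linarith
    then show "cmod (integral {0..X} (\<lambda>x. W x $ r $ c * q x)) \<le> e * B"
      using \<rho>[rule_format, of "(r, c)", THEN conjunct2, rule_format, of z B q X] * by simp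
  qed
qed

lemma W_column_sum_le: "(\<Sum>k\<in>UNIV. cmod (W x $ k $ c)) \<le> nW x"
  unfolding potential_size_def by (rule sum_mono) (rule member_le_sum, auto)

lemma W_row_sum_le: "(\<Sum>k\<in>UNIV. cmod (W x $ r $ k)) \<le> nW x"
  unfolding potential_size_def
  by (rule member_le_sum[of r UNIV "\<lambda>r. \<Sum>c\<in>UNIV. cmod (W x $ r $ c)"]) (auto intro: sum_nonneg)

lemma cmod_mult_W_entry_le: "cmod ((A ** W x) $ r $ c) \<le> norm A * nW x"
proof -
  have "cmod ((A ** W x) $ r $ c) \<le> (\<Sum>k\<in>UNIV. norm A * cmod (W x $ k $ c))"
    unfolding matrix_mult_nth
    by (rule order_trans[OF norm_sum], rule sum_mono) (simp add: norm_mult mult_right_mono norm_entry_le)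
  also have "\<dots> \<le> norm A * nW x"
    unfolding sum_distrib_left[symmetric] by (intro mult_left_mono W_column_sum_le) simp
  finally show ?thesis .
qed

lemma cmod_W_mult_entry_le: "cmod ((W x ** A) $ r $ c) \<le> norm A * nW x"
proof -
  have "cmod ((W x ** A) $ r $ c) \<le> (\<Sum>k\<in>UNIV. norm A * cmod (W x $ r $ k))"
    unfolding matrix_mult_nth
    by (rule order_trans[OF norm_sum], rule sum_mono) (simp add: norm_mult mult.commute mult_right_mono norm_entry_le)
  also have "\<dots> \<le> norm A * nW x"
    unfolding sum_distrib_left[symmetric] by (intro mult_left_mono W_row_sum_le) simp
  finally show ?thesis .
qed

text \<open>By \<open>g_deriv\<close> the difference is an integral of the lower left block of
  \<open>W\<close> against the last columns of phase times \<open>P\<close>. In these columns the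
  phase and the diagonal part of the generator add up to \<open>2 * \<i> * z\<close> instead of
  cancelling, so they oscillate; the contraction bounds them uniformly.\<close>

lemma g_near:
  assumes e: "e > 0"
  obtains \<rho> where "\<rho> > 0" "\<And>z X. \<lbrakk>cmod z > \<rho>; Im z \<ge> 0; X \<ge> 0\<rbrakk> \<Longrightarrow> norm (g X z - first_columns) \<le> e"
proof -
  define B where "B = norm (mat 1 :: complex^('a + 'b)^('a + 'b))"
  \<comment> \<open>The number of entries of the difference times the number of summands in each, so
    that the entrywise estimates add up to \<open>e\<close>.\<close>
  define N where "N = real (CARD('a + 'b) * CARD('a) * CARD('b))"
  have B: "B \<ge> 0" and N: "N \<ge> 0" by (simp_all add: B_def N_def)
  define e' where "e' = e / (N * B + 1)"
  have NB: "N * B + 1 > 0" using N B by (simp add: add_nonneg_pos)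
  then have e': "e' > 0" using e by (simp add: e'_def)
  obtain \<rho> where \<rho>: "\<rho> > 0"
    "\<And>r c z q B X. \<lbrakk>cmod z > \<rho>; oscillating z B q; X \<ge> 0\<rbrakk>
      \<Longrightarrow> cmod (integral {0..X} (\<lambda>x. W x $ r $ c * q x)) \<le> e' * B"
    by (rule riemann_lebesgue_W[OF e']) (rule that)
  show ?thesis
  proof (rule that[OF \<rho>(1)])
    fix z X assume z: "cmod z > \<rho>" "Im z \<ge> 0" and X: "(X::real) \<ge> 0"
    define T where "T = (\<lambda>s. phase z s *\<^sub>M P s z)"
    have TB: "norm (T s) \<le> B" if "s \<ge> 0" for s
      using P_contraction[OF z(2) that, of "mat 1"] by (simp add: T_def B_def)
    have T_deriv: "ac_deriv T (\<lambda>s. (\<i> * z) *\<^sub>M T s - (\<i> * z) *\<^sub>M (T s ** J) - \<i> *\<^sub>M (T s ** W s))"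
      unfolding T_def
      by (rule ac_deriv_cong[OF ac_deriv_exp_cscale[OF P_deriv]])
         (simp add: mult_dirac_gen cscale_mult_left cscale_simps algebra_simps)
    have q_deriv: "ac_deriv (\<lambda>s. T s $ r $ Inr l) (\<lambda>s. 2 * \<i> * z * T s $ r $ Inr l + (- \<i> * (T s ** W s) $ r $ Inr l))" for r l
      by (rule ac_deriv_cong[OF ac_deriv_entry[OF T_deriv]]) (simp add: algebra_simps)
    have small: "cmod (integral {0..X} (\<lambda>x. W x $ r' $ c' * T x $ r $ Inr l)) \<le> e' * B" for r l r' c'
    proof (rule \<rho>(2)[OF z(1) _ X], unfold oscillating_def, intro exI conjI, rule q_deriv)
      show "\<forall>x\<ge>0. cmod (T x $ r $ Inr l) \<le> B" using TB norm_entry_le order_trans by blast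
      show "\<forall>x\<ge>0. cmod (- \<i> * (T x ** W x) $ r $ Inr l) \<le> B * nW x"
      proof (intro allI impI)
        fix x :: real assume "x \<ge> 0"
        have "cmod ((T x ** W x) $ r $ Inr l) \<le> norm (T x) * nW x" by (rule cmod_mult_W_entry_le)
        also have "\<dots> \<le> B * nW x" by (intro mult_right_mono TB nW_nonneg \<open>x \<ge> 0\<close>)
        finally show "cmod (- \<i> * (T x ** W x) $ r $ Inr l) \<le> B * nW x" by (simp add: norm_mult)
      qed
    qed
    have entry: "cmod ((g X z - first_columns) $ r $ k) \<le> real CARD('b) * (e' * B)" for r k
    proof -
      have *: "(W s ** first_columns) $ i $ k = W s $ i $ Inl k" for s i
        by (simp add: mult_block_col mat_def if_distrib cong: if_cong)
      have "((\<lambda>s. ((- \<i>) *\<^sub>M (phase z s *\<^sub>M (P s z ** (W s ** first_columns)))) $ r $ k)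
         has_integral (g X z $ r $ k - g 0 z $ r $ k)) {0..X}"
        by (rule ac_deriv_has_integral[OF ac_deriv_entry[OF g_deriv]]) (use X in auto)
      moreover have "((- \<i>) *\<^sub>M (phase z s *\<^sub>M (P s z ** (W s ** first_columns)))) $ r $ k
        = (- \<i>) * (\<Sum>l\<in>UNIV. W s $ Inr l $ Inl k * T s $ r $ Inr l)" for s
        by (simp add: matrix_mult_nth[of "P s z"] * sum_over_sum_type T_def sum_distrib_left mult_ac)
      ultimately have "((\<lambda>s. (- \<i>) * (\<Sum>l\<in>UNIV. W s $ Inr l $ Inl k * T s $ r $ Inr l))
         has_integral ((g X z - first_columns) $ r $ k)) {0..X}"
        by simp
      from norm_has_integral_sum_le[OF this, OF _ W_L1 ac_deriv_continuous_on[OF q_deriv order_refl] small]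
      show ?thesis by simp
    qed
    have "norm (g X z - first_columns) \<le> real (CARD('a + 'b) * CARD('a)) * (real CARD('b) * (e' * B))"
      by (rule norm_le_of_entries) (rule entry)
    also have "\<dots> = e' * (N * B)" by (simp add: N_def)
    also have "\<dots> \<le> e' * (N * B + 1)" using e' by simp
    also have "\<dots> = e" using NB by (simp add: e'_def)
    finally show "norm (g X z - first_columns) \<le> e" .
  qed
qed

lemma jost_value_near:
  assumes e: "e > 0"
  obtains \<rho> where "\<rho> > 0" "\<And>z. \<lbrakk>cmod z > \<rho>; Im z \<ge> 0\<rbrakk> \<Longrightarrow> norm (jost_value z - first_columns) \<le> e"
proof (rule g_near[OF e])
  fix \<rho> :: real
  assume \<rho>: "\<rho> > 0" "\<And>z X. \<lbrakk>cmod z > \<rho>; Im z \<ge> 0; X \<ge> 0\<rbrakk> \<Longrightarrow> norm (g X z - first_columns) \<le> e"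
  show ?thesis
  proof (rule that[OF \<rho>(1)])
    fix z assume z: "cmod z > \<rho>" "Im z \<ge> 0"
    show "norm (jost_value z - first_columns) \<le> e"
      by (rule tendsto_upperbound[OF tendsto_norm[OF tendsto_diff[OF jost_value_sequence[OF z(2)] tendsto_const]]])
         (use \<rho>(2)[OF z] in auto)
  qed
qed

text \<open>The resulting growth like \<open>exp (- \<i> * z * x)\<close> excludes all but one Weyl function and GW-function.\<close>

lemma u_lower_near:
  assumes e: "e > 0"
  obtains \<rho> where "\<rho> > 0" "\<And>z X (\<eta> :: complex^'a^'b). \<lbrakk>cmod z > \<rho>; Im z \<ge> 0; X \<ge> 0\<rbrakk> \<Longrightarrow>
    norm (lower_block (phase z X *\<^sub>M (u X z ** block_col 0 \<eta>)) - \<eta>) \<le> e * norm \<eta>"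
proof -
  define N where "N = real (CARD('b) * CARD('a) * CARD('a))"
  have N: "N \<ge> 0" by (simp add: N_def)
  define e' where "e' = e / (N + 1)"
  have NB: "N + 1 > 0" using N by simp
  then have e': "e' > 0" using e by (simp add: e'_def)
  obtain \<rho> where \<rho>: "\<rho> > 0"
    "\<And>r c z q B X. \<lbrakk>cmod z > \<rho>; oscillating z B q; X \<ge> 0\<rbrakk>
      \<Longrightarrow> cmod (integral {0..X} (\<lambda>x. W x $ r $ c * q x)) \<le> e' * B"
    by (rule riemann_lebesgue_W[OF e']) (rule that)
  show ?thesis
  proof (rule that[OF \<rho>(1)])
    fix z X and \<eta> :: "complex^'a^'b" assume z: "cmod z > \<rho>" "Im z \<ge> 0" and X: "(X::real) \<ge> 0"
    define B where "B = norm \<eta>"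
    have B: "B \<ge> 0" by (simp add: B_def)
    \<comment> \<open>For \<open>u\<close> the roles of the blocks are exchanged: the phase cancels
      the diagonal part in the lower rows and doubles it in the upper rows. The lower rows change
      only by an integral of \<open>W\<close> against the oscillating upper rows, and
      \<open>u_decay\<close> makes the error proportional to \<open>norm \<eta>\<close>.\<close>
    define T where "T = (\<lambda>s. phase z s *\<^sub>M (u s z ** block_col 0 \<eta>))"
    have TB: "norm (T s) \<le> B" if "s \<ge> 0" for s
      using u_decay[OF z(2) that, of "block_col 0 \<eta>"] by (simp add: T_def B_def norm_block_col_zero)
    have T0: "T 0 = block_col 0 \<eta>" by (simp add: T_def cscale_simps)
    have T_deriv: "ac_deriv T (\<lambda>s. (\<i> * z) *\<^sub>M T s + (\<i> * z) *\<^sub>M (J ** T s) + \<i> *\<^sub>M (W s ** T s))"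
      unfolding T_def
      by (rule ac_deriv_cong[OF ac_deriv_exp_cscale[OF ac_deriv_mult_right[OF u_deriv]]])
         (simp add: matrix_mul_assoc[symmetric] dirac_gen_mult matrix_mult_distribs cscale_mult_left cscale_mult_right cscale_simps algebra_simps)
    have q_deriv: "ac_deriv (\<lambda>s. T s $ Inl i $ c) (\<lambda>s. 2 * \<i> * z * T s $ Inl i $ c + \<i> * (W s ** T s) $ Inl i $ c)" for i c
      by (rule ac_deriv_cong[OF ac_deriv_entry[OF T_deriv]]) (simp add: algebra_simps)
    have p_deriv: "ac_deriv (\<lambda>s. T s $ Inr l $ c) (\<lambda>s. \<i> * (\<Sum>i\<in>UNIV. W s $ Inr l $ Inl i * T s $ Inl i $ c))" for l c
      by (rule ac_deriv_cong[OF ac_deriv_entry[OF T_deriv]])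
         (simp add: matrix_mult_nth[of "W _"] sum_over_sum_type)
    have small: "cmod (integral {0..X} (\<lambda>x. W x $ r' $ c' * T x $ Inl i $ c)) \<le> e' * B" for i c r' c'
    proof (rule \<rho>(2)[OF z(1) _ X], unfold oscillating_def, intro exI conjI, rule q_deriv)
      show "\<forall>x\<ge>0. cmod (T x $ Inl i $ c) \<le> B" using TB norm_entry_le order_trans by blast
      show "\<forall>x\<ge>0. cmod (\<i> * (W x ** T x) $ Inl i $ c) \<le> B * nW x"
      proof (intro allI impI)
        fix x :: real assume "x \<ge> 0"
        have "cmod ((W x ** T x) $ Inl i $ c) \<le> norm (T x) * nW x" by (rule cmod_W_mult_entry_le)
        also have "\<dots> \<le> B * nW x" by (intro mult_right_mono TB nW_nonneg \<open>x \<ge> 0\<close>)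
        finally show "cmod (\<i> * (W x ** T x) $ Inl i $ c) \<le> B * nW x" by (simp add: norm_mult)
      qed
    qed
    have entry: "cmod ((lower_block (T X) - \<eta>) $ l $ c) \<le> real CARD('a) * (e' * B)" for l c
    proof -
      have "((\<lambda>s. \<i> * (\<Sum>i\<in>UNIV. W s $ Inr l $ Inl i * T s $ Inl i $ c))
         has_integral (T X $ Inr l $ c - T 0 $ Inr l $ c)) {0..X}"
        by (rule ac_deriv_has_integral[OF p_deriv]) (use X in auto)
      then have "((\<lambda>s. \<i> * (\<Sum>i\<in>UNIV. W s $ Inr l $ Inl i * T s $ Inl i $ c))
         has_integral ((lower_block (T X) - \<eta>) $ l $ c)) {0..X}"
        by (simp add: T0)
      from norm_has_integral_sum_le[OF this, OF _ W_L1 ac_deriv_continuous_on[OF q_deriv order_refl] small]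
      show ?thesis by simp
    qed
    have "norm (lower_block (T X) - \<eta>) \<le> real (CARD('b) * CARD('a)) * (real CARD('a) * (e' * B))"
      by (rule norm_le_of_entries) (rule entry)
    also have "\<dots> = e' * B * N" by (simp add: N_def)
    also have "\<dots> \<le> e' * B * (N + 1)" using e' B by (intro mult_left_mono) auto
    also have "\<dots> = e * B" using NB by (simp add: e'_def)
    finally show "norm (lower_block (phase z X *\<^sub>M (u X z ** block_col 0 \<eta>)) - \<eta>) \<le> e * norm \<eta>"
      by (simp add: T_def B_def)
  qed
qed

end

section \<open>Identification with the given Jost solution on the real line\<close>

lemma exp_J_mult_nth [simp]:
  "(exp_J c ** B) $ Inl i $ k = exp c * B $ Inl i $ k" "(exp_J c ** B) $ Inr l $ k = exp (- c) * B $ Inr l $ k"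
  by (simp_all add: exp_J_def matrix_mult_nth block_matrix_def sum_over_sum_type mat_def if_distrib if_distribR cong: if_cong)

lemma exp_J_first_columns:
  "exp_J c ** first_columns = exp c *\<^sub>M (first_columns :: complex^'a^('a::finite + 'b::finite))"
proof -
  have "(exp_J c ** first_columns) $ r $ k = (exp c *\<^sub>M first_columns) $ r $ k" for r :: "'a + 'b" and k
    by (cases r) simp_all
  then show ?thesis by (simp add: vec_eq_iff)
qed

context dirac_system
begin

text \<open>Pulling the first columns of \<open>F X t\<close> back to \<open>0\<close> by
  \<open>P\<close> gives \<open>g X\<close> plus the pulled-back remainder \<open>E X\<close>. For
  real parameters neither the transport nor \<open>exp_J\<close> amplifies the remainder beyond a
  fixed constant.\<close>

lemma jost_solution_value:
  assumes F: "jost_solution v F"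
  shows "F 0 t ** first_columns = jost_value (complex_of_real t)"
proof -
  let ?z = "complex_of_real t"
  have z: "Im ?z \<ge> 0" by simp
  obtain E where E: "(E \<longlongrightarrow> 0) at_top"
    and FE: "\<And>x. x \<ge> 0 \<Longrightarrow> F x t = exp_J (\<i> * complex_of_real (x * t)) ** (mat 1 + E x)"
    using F unfolding jost_solution_def by blast
  have sol: "dirac_solution v ?z (\<lambda>x. F x t)"
    using F by (auto simp: jost_solution_def fundamental_solution_def)
  obtain C where C: "C > 0" "\<And>(A :: complex^('a + 'b)^('a + 'b)) (B :: complex^'a^('a + 'b)). norm (A ** B) \<le> norm A * norm B * C"
    by (rule matrix_mult_norm_bound) (rule that)
  define K where "K = real (CARD('a + 'b) * CARD('a + 'b)) * C"
  have exp_J_le: "norm (exp_J (\<i> * complex_of_real s) ** B) \<le> K * norm B" for s and B :: "complex^'a^('a + 'b)"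
  proof -
    have le1: "cmod ((exp_J (\<i> * complex_of_real s) :: complex^('a + 'b)^('a + 'b)) $ r $ c) \<le> 1" for r c
      by (cases r; cases c; simp add: exp_J_def block_matrix_def mat_def)
    have "norm (exp_J (\<i> * complex_of_real s) :: complex^('a + 'b)^('a + 'b)) \<le> real (CARD('a + 'b) * CARD('a + 'b)) * 1"
      by (rule norm_le_of_entries) (rule le1)
    then have "norm (exp_J (\<i> * complex_of_real s) :: complex^('a + 'b)^('a + 'b)) * norm B * C
      \<le> real (CARD('a + 'b) * CARD('a + 'b)) * norm B * C"
      using C(1) by (intro mult_right_mono) auto
    then show ?thesis using C(2)[of "exp_J (\<i> * complex_of_real s)" B] by (simp add: K_def mult_ac)
  qed
  have diff: "norm (F 0 t ** first_columns - g X ?z) \<le> K * norm (E X ** (first_columns :: complex^'a^('a+'b)))" if X: "X \<ge> 0" for X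
  proof -
    let ?D = "exp_J (\<i> * complex_of_real (X * t)) ** (E X ** first_columns)"
    have "F 0 t ** first_columns = P X ?z ** (F X t ** first_columns)"
      using P_solution[OF sol X] by (simp add: matrix_mul_assoc)
    also have "F X t ** first_columns = exp (\<i> * complex_of_real (X * t)) *\<^sub>M first_columns + ?D"
      unfolding FE[OF X] by (simp add: matrix_mul_assoc[symmetric] matrix_mult_distribs exp_J_first_columns)
    also have "P X ?z ** \<dots> = g X ?z + P X ?z ** ?D"
      by (simp add: g_def matrix_mult_distribs cscale_mult_right mult_ac)
    finally have "norm (F 0 t ** first_columns - g X ?z) = norm (P X ?z ** ?D)" by simp
    \<comment> \<open>The phase has modulus one for a real parameter.\<close>
    also have "\<dots> = norm (phase ?z X *\<^sub>M (P X ?z ** ?D))"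
      by (simp add: norm_cscale)
    also have "\<dots> \<le> norm ?D" by (rule P_contraction[OF z X])
    also have "\<dots> \<le> K * norm (E X ** (first_columns :: complex^'a^('a+'b)))" by (rule exp_J_le)
    finally show ?thesis .
  qed
  have EX: "((\<lambda>X. K * norm (E X ** (first_columns :: complex^'a^('a+'b)))) \<longlongrightarrow> K * norm (0 ** (first_columns :: complex^'a^('a+'b)) :: complex^'a^('a+'b))) at_top"
    by (intro tendsto_intros bounded_bilinear.tendsto[OF bounded_bilinear_matrix_mult] E)
  have "((\<lambda>X. K * norm (E X ** (first_columns :: complex^'a^('a+'b)))) \<longlongrightarrow> 0) at_top"
    using EX by (simp add: matrix_mult_distribs)
  then have lim: "(\<lambda>n. K * norm (E (real n) ** (first_columns :: complex^'a^('a+'b)))) \<longlonglongrightarrow> 0"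
    by (rule filterlim_compose[OF _ filterlim_real_sequentially])
  have "(\<lambda>n. F 0 t ** first_columns - g (real n) ?z) \<longlonglongrightarrow> 0"
    by (rule Lim_null_comparison[OF _ lim]) (auto intro!: always_eventually diff)
  moreover have "(\<lambda>n. F 0 t ** first_columns - g (real n) ?z) \<longlonglongrightarrow> F 0 t ** first_columns - jost_value ?z"
    by (intro tendsto_diff tendsto_const jost_value_sequence z)
  ultimately show ?thesis using LIMSEQ_unique by fastforce
qed

end

section \<open>Functions holomorphic in the upper half-plane\<close>

text \<open>Extended by zero below the real line, \<open>f\<close> remains continuous on the disc
  and hence is holomorphic across the segment. It vanishes on the lower half-disc, so it vanishes
  identically.\<close>

lemma holomorphic_zero_on_real_segment:
  assumes cont: "continuous_on ({z. Im z \<ge> 0} \<inter> ball (complex_of_real t) r) f"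
    and hol: "f holomorphic_on (upper_half 0 \<inter> ball (complex_of_real t) r)"
    and zero: "\<And>x. complex_of_real x \<in> ball (complex_of_real t) r \<Longrightarrow> f (complex_of_real x) = 0"
    and z: "Im z \<ge> 0" "z \<in> ball (complex_of_real t) r"
  shows "f z = 0"
proof -
  let ?B = "ball (complex_of_real t) r"
  define h where "h = (\<lambda>z. if Im z \<le> 0 then 0 else f z)"
  have hc: "continuous_on ?B h"
    unfolding h_def
  proof (rule continuous_on_cases_le)
    show "continuous_on {z \<in> ?B. 0 \<le> Im z} f"
      by (rule continuous_on_subset[OF cont]) auto
    fix z assume "z \<in> ?B" "Im z = 0"
    then show "0 = f z" using zero[of "Re z"] by (simp add: complex_is_Real_iff)
  qed (auto intro!: continuous_intros)
  have hh: "h holomorphic_on ?B"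
  proof (rule holomorphic_on_paste_across_line[where d = \<i> and k = 0])
    show "h holomorphic_on ?B \<inter> {z. \<i> \<bullet> z < 0}"
      by (rule holomorphic_transform[of "\<lambda>_. 0"]) (auto simp: h_def)
    show "h holomorphic_on ?B \<inter> {z. 0 < \<i> \<bullet> z}"
      by (rule holomorphic_transform[of f]) (auto simp: h_def upper_half_def Int_commute intro: holomorphic_on_subset[OF hol])
  qed (use hc in auto)
  have r: "r > 0" using z(2) by (metis ball_eq_empty empty_iff not_less)
  have "complex_of_real t - \<i> * complex_of_real (r/2) \<in> ?B \<inter> {z. Im z < 0}"
    using r by (simp add: dist_norm norm_mult)
  then have ne: "?B \<inter> {z. Im z < 0} \<noteq> {}" by blast
  have "h z = 0"
  proof (rule analytic_continuation_open[of "?B \<inter> {z. Im z < 0}" ?B h "\<lambda>_. 0"])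
    show "open (?B \<inter> {z. Im z < 0})" by (intro open_Int open_ball open_halfspace_Im_lt)
  qed (use hh ne z in \<open>auto simp: h_def\<close>)
  then show ?thesis using z zero[of "Re z"] by (cases "Im z = 0") (auto simp: h_def complex_is_Real_iff)
qed

lemma maximum_modulus_half_disc:
  fixes f :: "complex \<Rightarrow> complex"
  assumes cont: "continuous_on {z. Im z \<ge> m} f" and hol: "f holomorphic_on {z. Im z > m}"
    and line: "\<And>z. Im z = m \<Longrightarrow> cmod z \<le> r \<Longrightarrow> cmod (f z) \<le> B"
    and arc: "\<And>z. Im z \<ge> m \<Longrightarrow> cmod z = r \<Longrightarrow> cmod (f z) \<le> B"
    and z: "Im z \<ge> m" "cmod z \<le> r"
  shows "cmod (f z) \<le> B"
proof (rule maximum_modulus_frontier[of f "cball 0 r \<inter> {z. Im z \<ge> m}"])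
  let ?S = "cball 0 r \<inter> {z. Im z \<ge> m}"
  have cl: "closed ?S" by (intro closed_Int closed_cball closed_halfspace_Im_ge)
  have int: "interior ?S = ball 0 r \<inter> {z. Im z > m}"
    using interior_halfspace_ge[of \<i> m] by simp
  show "f holomorphic_on interior ?S" unfolding int by (rule holomorphic_on_subset[OF hol]) auto
  show "continuous_on (closure ?S) f" using cl
    by (simp add: closure_closed) (rule continuous_on_subset[OF cont], auto)
  show "bounded ?S" by (simp add: bounded_Int)
  fix w assume "w \<in> frontier ?S"
  then have "w \<in> ?S" "w \<notin> ball 0 r \<inter> {z. Im z > m}"
    using cl unfolding frontier_def int by (auto simp: closure_closed)
  then show "cmod (f w) \<le> B" using line[of w] arc[of w] by (auto simp: not_less)
qed (use z in auto)

text \<open>Division by \<open>q\<close> makes the maximum principle available on large half-discs: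
  the real part of \<open>q\<close> is at least 1 in the half-plane, and its modulus grows linearly.
  The auxiliary parameter then tends to 0.\<close>

lemma phragmen_lindelof_half_plane:
  fixes f :: "complex \<Rightarrow> complex"
  assumes cont: "continuous_on {z. Im z \<ge> m} f" and hol: "f holomorphic_on {z. Im z > m}"
    and bound: "\<And>z. Im z \<ge> m \<Longrightarrow> cmod (f z) \<le> B"
    and line: "\<And>z. Im z = m \<Longrightarrow> cmod (f z) \<le> A"
    and z: "Im z \<ge> m"
  shows "cmod (f z) \<le> A"
proof -
  define q where "q = (\<lambda>d w. 1 - \<i> * complex_of_real d * (w - \<i> * complex_of_real m))"
  have q1: "cmod (q d w) \<ge> 1" if "d > 0" "Im w \<ge> m" for d w
  proof -
    have "1 \<le> Re (q d w)" using that by (simp add: q_def)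
    then show ?thesis using complex_Re_le_cmod order_trans by blast
  qed
  have q2: "cmod (q d w) \<ge> d * (cmod w - \<bar>m\<bar>) - 1" if "d > 0" for d w
  proof -
    have "d * (cmod w - \<bar>m\<bar>) \<le> d * cmod (w - \<i> * complex_of_real m)"
      using norm_triangle_ineq2[of w "\<i> * complex_of_real m"] that by (intro mult_left_mono) (auto simp: norm_mult)
    also have "\<dots> = cmod (\<i> * complex_of_real d * (w - \<i> * complex_of_real m))"
      using that by (simp add: norm_mult)
    also have "\<dots> \<le> cmod (q d w) + 1"
      using norm_triangle_ineq4[of 1 "q d w"] by (simp add: q_def)
    finally show ?thesis by simp
  qed
  have B: "B \<ge> 0" using bound[OF z] norm_ge_zero order_trans by blast
  have main: "cmod (f z) \<le> (A + e) * cmod (q d z)" if e: "e > 0" and d: "d > 0" for e d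
  proof -
    have A: "A \<ge> 0" by (rule order_trans[OF norm_ge_zero line[of "\<i> * complex_of_real m"]]) simp
    \<comment> \<open>Large enough to contain \<open>z\<close> and, by \<open>q2\<close>, to have
      \<open>cmod (q d w) \<ge> B / (A + e)\<close> on the arc. The positive \<open>e\<close>
      permits the division when \<open>A = 0\<close>.\<close>
    define r where "r = max (cmod z) (\<bar>m\<bar> + (B / (A + e) + 1) / d)"
    have nz: "q d w \<noteq> 0" if "Im w \<ge> m" for w using q1[OF d that] by auto
    have "cmod (f z / q d z) \<le> A + e"
    proof (rule maximum_modulus_half_disc[where f = "\<lambda>w. f w / q d w" and r = r and m = m])
      show "continuous_on {z. m \<le> Im z} (\<lambda>w. f w / q d w)"
        using nz by (intro continuous_on_divide cont) (auto simp: q_def intro!: continuous_intros)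
      show "(\<lambda>w. f w / q d w) holomorphic_on {z. m < Im z}"
        using nz by (intro holomorphic_on_divide hol) (auto simp: q_def intro!: holomorphic_intros)
      fix w
      { assume w: "Im w = m"
        have "cmod (f w) / cmod (q d w) \<le> cmod (f w) / 1"
          using q1[OF d, of w] w by (intro divide_left_mono) auto
        then show "cmod (f w / q d w) \<le> A + e" using line[OF w] e by (simp add: norm_divide) }
      { assume w: "m \<le> Im w" "cmod w = r"
        have "(B / (A + e) + 1) / d \<le> r - \<bar>m\<bar>" by (simp add: r_def)
        then have "B / (A + e) + 1 \<le> d * (r - \<bar>m\<bar>)" using d by (simp add: field_simps)
        then have "B / (A + e) \<le> cmod (q d w)" using q2[OF d, of w] w by simp
        then have "B \<le> (A + e) * cmod (q d w)" using A e by (simp add: field_simps)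
        then have "cmod (f w) \<le> (A + e) * cmod (q d w)" using bound[OF w(1)] by linarith
        then show "cmod (f w / q d w) \<le> A + e" using nz[OF w(1)] by (simp add: norm_divide field_simps) }
    qed (use z in \<open>auto simp: r_def\<close>)
    then show ?thesis using nz[OF z] by (simp add: norm_divide field_simps)
  qed
  \<comment> \<open>The two parameters of \<open>main\<close> are taken equal, so that a single
    limit removes both.\<close>
  have "((\<lambda>d. (A + d) * cmod (q d z)) \<longlongrightarrow> (A + 0) * cmod (q 0 z)) (at_right 0)"
    unfolding q_def by (intro tendsto_intros)
  then have lim: "((\<lambda>d. (A + d) * cmod (q d z)) \<longlongrightarrow> A) (at_right 0)" by (simp add: q_def)
  show ?thesis
    by (rule tendsto_lowerbound[OF lim]) (auto simp: eventually_at_filter intro!: always_eventually main)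
qed

section \<open>Poisson integrals and zeros on the boundary\<close>

lemma poisson_kernel_le_pi:
  assumes "\<eta> > 0" "a \<le> b"
  shows "integral {a..b} (\<lambda>t. \<eta> / ((t - x)\<^sup>2 + \<eta>\<^sup>2)) \<le> pi"
proof -
  have nz: "(t - x)\<^sup>2 + \<eta>\<^sup>2 > 0" for t using assms by (simp add: add_nonneg_pos)
  have "((\<lambda>t. \<eta> / ((t - x)\<^sup>2 + \<eta>\<^sup>2)) has_integral (arctan ((b - x) / \<eta>) - arctan ((a - x) / \<eta>))) {a..b}"
  proof (rule fundamental_theorem_of_calculus[OF assms(2)])
    fix t assume "t \<in> {a..b}"
    have eq: "1 / (1 + ((t - x) / \<eta>)\<^sup>2) * (1 / \<eta>) = \<eta> / ((t - x)\<^sup>2 + \<eta>\<^sup>2)"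
    proof -
      have "1 + ((t - x) / \<eta>)\<^sup>2 = ((t - x)\<^sup>2 + \<eta>\<^sup>2) / \<eta>\<^sup>2"
        using assms by (simp add: power_divide add_divide_distrib)
      then show ?thesis using assms nz[of t] by (simp add: power2_eq_square)
    qed
    have "((\<lambda>t. arctan ((t - x) / \<eta>)) has_real_derivative 1 / (1 + ((t - x) / \<eta>)\<^sup>2) * (1 / \<eta>)) (at t within {a..b})"
      using assms by (auto intro!: derivative_eq_intros simp: inverse_eq_divide)
    then show "((\<lambda>t. arctan ((t - x) / \<eta>)) has_vector_derivative \<eta> / ((t - x)\<^sup>2 + \<eta>\<^sup>2)) (at t within {a..b})"
      unfolding eq has_real_derivative_iff_has_vector_derivative .
  qed
  then have "integral {a..b} (\<lambda>t. \<eta> / ((t - x)\<^sup>2 + \<eta>\<^sup>2)) = arctan ((b - x) / \<eta>) - arctan ((a - x) / \<eta>)"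
    by (rule integral_unique)
  also have "\<dots> \<le> pi" using arctan_bounded[of "(b - x) / \<eta>"] arctan_bounded[of "(a - x) / \<eta>"] by linarith
  finally show ?thesis .
qed

text \<open>The factor in the denominator makes the real part the Poisson integral of \<phi>. For a
  cutoff \<phi> of a compact set this is a holomorphic function whose real part approximates the
  harmonic measure of that set.\<close>

definition cauchy_poisson :: "(real \<Rightarrow> real) \<Rightarrow> real \<Rightarrow> real \<Rightarrow> complex \<Rightarrow> complex" where
  "cauchy_poisson \<phi> a b z =
     integral {a..b} (\<lambda>t. complex_of_real (\<phi> t) / (complex_of_real t - z)) / (\<i> * complex_of_real pi)"

lemma upper_half_ne_real: "z \<in> upper_half 0 \<Longrightarrow> complex_of_real t - z \<noteq> 0"
  by (auto simp: upper_half_def complex_eq_iff)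

lemma cauchy_poisson_holomorphic:
  assumes \<phi>: "continuous_on {a..b} \<phi>"
  shows "cauchy_poisson \<phi> a b holomorphic_on upper_half 0"
proof -
  have "(\<lambda>z. integral (cbox a b) (\<lambda>t. complex_of_real (\<phi> t) / (complex_of_real t - z))) holomorphic_on upper_half 0"
  proof (rule leibniz_rule_holomorphic[where fx = "\<lambda>z t. complex_of_real (\<phi> t) / (complex_of_real t - z)\<^sup>2"])
    fix z t assume "z \<in> upper_half 0" "t \<in> cbox a b"
    then show "((\<lambda>z. complex_of_real (\<phi> t) / (complex_of_real t - z)) has_field_derivative
        complex_of_real (\<phi> t) / (complex_of_real t - z)\<^sup>2) (at z within upper_half 0)"
      using upper_half_ne_real[of z t] by (auto intro!: derivative_eq_intros simp: power2_eq_square)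
  next
    fix z assume "z \<in> upper_half 0"
    then show "(\<lambda>t. complex_of_real (\<phi> t) / (complex_of_real t - z)) integrable_on cbox a b"
      using upper_half_ne_real[of z] \<phi> by (intro integrable_continuous continuous_intros) auto
  next
    have "continuous_on (upper_half 0 \<times> cbox a b) (\<lambda>p. complex_of_real (\<phi> (snd p)) / (complex_of_real (snd p) - fst p)\<^sup>2)"
      using upper_half_ne_real \<phi> by (intro continuous_intros continuous_on_compose2[OF \<phi>]) auto
    then show "continuous_on (upper_half 0 \<times> cbox a b) (\<lambda>(z, t). complex_of_real (\<phi> t) / (complex_of_real t - z)\<^sup>2)"
      by (simp add: case_prod_unfold)
    show "convex (upper_half 0)" unfolding upper_half_def by (rule convex_halfspace_Im_gt)
  qed
  then show ?thesis unfolding cauchy_poisson_def by (auto intro!: holomorphic_intros)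
qed

lemma Re_cauchy_poisson:
  assumes \<phi>: "continuous_on {a..b} \<phi>" and z: "z \<in> upper_half 0"
  shows "Re (cauchy_poisson \<phi> a b z) = integral {a..b} (\<lambda>t. \<phi> t * (Im z / (cmod (complex_of_real t - z))\<^sup>2)) / pi"
proof -
  let ?I = "\<lambda>t. complex_of_real (\<phi> t) / (complex_of_real t - z)"
  have int: "?I integrable_on {a..b}"
    using upper_half_ne_real[OF z] \<phi> by (intro integrable_continuous_real continuous_intros) auto
  have "Im (integral {a..b} ?I) = integral {a..b} (\<lambda>t. Im (?I t))"
    using integral_linear[OF int bounded_linear_Im] by (simp add: o_def)
  also have "(\<lambda>t. Im (?I t)) = (\<lambda>t. \<phi> t * (Im z / (cmod (complex_of_real t - z))\<^sup>2))"
    by (simp add: fun_eq_iff Im_divide cmod_power2)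
  finally show ?thesis
    by (simp add: cauchy_poisson_def Re_divide power2_eq_square)
qed

lemma cauchy_poisson_kernel_continuous:
  assumes \<phi>: "continuous_on {a..b} \<phi>" and z: "z \<in> upper_half 0"
  shows "continuous_on {a..b} (\<lambda>t. \<phi> t * (Im z / (cmod (complex_of_real t - z))\<^sup>2))"
  using upper_half_ne_real[OF z] \<phi> by (intro continuous_intros) auto

lemma Re_cauchy_poisson_le:
  assumes \<phi>: "continuous_on {a..b} \<phi>" and z: "z \<in> upper_half 0" and ab: "a \<le> b"
    and C: "\<And>t. t \<in> {a..b} \<Longrightarrow> \<phi> t * (Im z / (cmod (complex_of_real t - z))\<^sup>2) \<le> C"
  shows "Re (cauchy_poisson \<phi> a b z) \<le> (b - a) * C / pi"
proof -
  have "integral {a..b} (\<lambda>t. \<phi> t * (Im z / (cmod (complex_of_real t - z))\<^sup>2)) \<le> integral {a..b} (\<lambda>t. C)"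
    by (intro integral_le integrable_continuous_real cauchy_poisson_kernel_continuous \<phi> z C) auto
  also have "\<dots> = (b - a) * C" using ab by simp
  finally show ?thesis unfolding Re_cauchy_poisson[OF \<phi> z] by (intro divide_right_mono) auto
qed

lemma Re_cauchy_poisson_le_1:
  assumes \<phi>: "continuous_on {a..b} \<phi>" and z: "z \<in> upper_half 0" and ab: "a \<le> b"
    and one: "\<And>t. \<phi> t \<le> 1"
  shows "Re (cauchy_poisson \<phi> a b z) \<le> 1"
proof -
  have Imz: "Im z > 0" using z by (simp add: upper_half_def)
  have "integral {a..b} (\<lambda>t. \<phi> t * (Im z / (cmod (complex_of_real t - z))\<^sup>2)) \<le> integral {a..b} (\<lambda>t. 1 * (Im z / (cmod (complex_of_real t - z))\<^sup>2))"
  proof (intro integral_le integrable_continuous_real cauchy_poisson_kernel_continuous \<phi> z)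
    fix t
    show "\<phi> t * (Im z / (cmod (complex_of_real t - z))\<^sup>2) \<le> 1 * (Im z / (cmod (complex_of_real t - z))\<^sup>2)"
      using Imz by (intro mult_right_mono one) auto
  qed auto
  also have "\<dots> = integral {a..b} (\<lambda>t. Im z / ((t - Re z)\<^sup>2 + (Im z)\<^sup>2))"
    by (simp add: cmod_power2)
  also have "\<dots> \<le> pi" by (rule poisson_kernel_le_pi[OF Imz ab])
  finally show ?thesis unfolding Re_cauchy_poisson[OF \<phi> z] by (simp add: divide_le_eq)
qed

text \<open>Only the part of the Poisson integral over \<open>K\<close> is kept, so the bound is the
  same for every cutoff equal to 1 on \<open>K\<close>. Below the cutoff varies with
  \<open>n\<close> while this bound stays fixed.\<close>

lemma Re_cauchy_poisson_ge:
  assumes \<phi>: "continuous_on {a..b} \<phi>" and z: "z \<in> upper_half 0"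
    and K: "compact K" "K \<subseteq> {a..b}" and \<phi>K: "\<And>t. t \<in> K \<Longrightarrow> \<phi> t = 1" and \<phi>0: "\<And>t. \<phi> t \<ge> 0"
    and r: "\<And>t. t \<in> K \<Longrightarrow> cmod (complex_of_real t - z) \<le> r" and "r > 0"
  shows "Re (cauchy_poisson \<phi> a b z) \<ge> Im z / r\<^sup>2 * measure lebesgue K / pi"
proof -
  let ?k = "\<lambda>t. \<phi> t * (Im z / (cmod (complex_of_real t - z))\<^sup>2)"
  have Imz: "Im z > 0" using z by (simp add: upper_half_def)
  have Km: "K \<in> lmeasurable" using K by (simp add: lmeasurable_compact)
  have i: "?k absolutely_integrable_on {a..b}"
    by (rule absolutely_integrable_continuous_real[OF cauchy_poisson_kernel_continuous[OF \<phi> z]])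
  then have iK: "?k integrable_on K"
    using set_integrable_subset[OF i _ K(2)] Km by (auto simp: absolutely_integrable_on_def)
  have "Im z / r\<^sup>2 * measure lebesgue K = Im z / r\<^sup>2 * integral K (\<lambda>t. 1)"
    using lmeasure_integral[OF Km] by simp
  also have "\<dots> = integral K (\<lambda>t. Im z / r\<^sup>2 * 1)" by (rule integral_mult_right[symmetric])
  also have "\<dots> \<le> integral K ?k"
  proof (rule integral_le[OF _ iK])
    show "(\<lambda>t. Im z / r\<^sup>2 * 1) integrable_on K"
      using integrable_on_const[OF Km] by simp
    fix t assume t: "t \<in> K"
    have "cmod (complex_of_real t - z) > 0" using upper_half_ne_real[OF z, of t] by simp
    then show "Im z / r\<^sup>2 * 1 \<le> ?k t"
      using r[OF t] Imz \<open>r > 0\<close> by (simp add: \<phi>K[OF t] divide_left_mono power_mono)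
  qed
  also have "\<dots> \<le> integral {a..b} ?k"
    using i Imz \<phi>0 by (intro integral_subset_le K iK) (auto simp: absolutely_integrable_on_def)
  finally show ?thesis unfolding Re_cauchy_poisson[OF \<phi> z] by (rule divide_right_mono) simp
qed

text \<open>If the zero set \<open>K\<close> on the real line had positive measure, then multiplying \<open>f\<close> by
  \<open>exp (n * G)\<close>, where \<open>Re G\<close> is close to the harmonic measure of \<open>K\<close>, would not increase its
  supremum but would increase its value at an interior point without bound.\<close>

lemma boundary_zeros_negligible:
  fixes f :: "complex \<Rightarrow> complex"
  assumes cont: "continuous_on {z. Im z \<ge> 0} f" and hol: "f holomorphic_on upper_half 0"
    and bound: "\<And>z. Im z \<ge> 0 \<Longrightarrow> cmod (f z) \<le> B"
    and nonzero: "\<And>z. Im z \<ge> 0 \<Longrightarrow> cmod z > \<rho> \<Longrightarrow> f z \<noteq> 0" and \<rho>: "\<rho> > 0"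
  shows "negligible {t. f (complex_of_real t) = 0}"
proof (rule ccontr)
  define K where "K = {t. f (complex_of_real t) = 0}"
  assume "\<not> negligible {t. f (complex_of_real t) = 0}"
  then have neg: "\<not> negligible K" by (simp add: K_def)
  have cr: "continuous_on UNIV (\<lambda>t. f (complex_of_real t))"
    by (rule continuous_on_compose2[OF cont]) (auto intro!: continuous_intros)
  have "closed K" unfolding K_def by (rule closed_Collect_eq[OF cr]) simp
  have Kb: "\<bar>t\<bar> \<le> \<rho>" if "t \<in> K" for t
    using nonzero[of "complex_of_real t"] that by (auto simp: K_def not_less[symmetric])
  then have "bounded K" by (auto simp: bounded_iff)
  with \<open>closed K\<close> have Kc: "compact K" by (simp add: compact_eq_bounded_closed)
  have Kn: "K \<noteq> {}" using neg by auto
  have Km: "K \<in> lmeasurable" using Kc by (rule lmeasurable_compact)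
  define \<mu> where "\<mu> = measure lebesgue K"
  have \<mu>: "\<mu> > 0" using neg Km unfolding \<mu>_def
    by (metis negligible_iff_measure zero_less_measure_iff)
  define z0 where "z0 = \<i> * complex_of_real (\<rho> + 1)"
  have z0: "z0 \<in> upper_half 0" "cmod z0 = \<rho> + 1" "Im z0 = \<rho> + 1"
    using \<rho> by (auto simp: z0_def upper_half_def norm_mult)
  have fz0: "f z0 \<noteq> 0" using nonzero[of z0] z0 \<rho> by auto
  define b where "b = \<rho> + 1"
  \<comment> \<open>\<open>r\<close> bounds the distance from \<open>z0\<close> to points of
    \<open>K\<close>, and \<open>c\<close> is then the lower bound for the Poisson integral at
    \<open>z0\<close>; both are independent of \<open>n\<close>.\<close>
  define r where "r = 2 * \<rho> + 1"
  define c where "c = (\<rho> + 1) / r\<^sup>2 * \<mu> / pi"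
  have c: "c > 0" using \<rho> \<mu> by (simp add: c_def r_def)
  have B: "B \<ge> 0" by (rule order_trans[OF norm_ge_zero bound[of 0]]) simp
  \<comment> \<open>The two entries come from the two kinds of boundary points: near
    \<open>K\<close> the bound is \<open>exp (- real n) * exp (real n) = 1\<close>, elsewhere the
    exponent is at most 1.\<close>
  define B' where "B' = max 1 (B * exp 1)"
  have main: "cmod (f z0) * exp (real n * c) \<le> B'" for n :: nat
  proof -
    \<comment> \<open>A compact set containing \<open>K\<close> and the points considered near it.
      Uniform continuity there gives \<open>cmod (f z) < exp (- real n)\<close> within distance
      \<open>d\<close> of \<open>K\<close>, which offsets a factor
      \<open>exp (real n)\<close>.\<close>
    define S where "S = {z. Im z \<ge> 0} \<inter> cball 0 (\<rho> + 3)"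
    have "compact S" unfolding S_def by (intro closed_Int_compact closed_halfspace_Im_ge compact_cball)
    then have "uniformly_continuous_on S f"
      by (intro compact_uniformly_continuous continuous_on_subset[OF cont]) (auto simp: S_def)
    then obtain d where d: "d > 0" "\<And>x y. x \<in> S \<Longrightarrow> y \<in> S \<Longrightarrow> dist y x < d \<Longrightarrow> dist (f y) (f x) < exp (- real n)"
      unfolding uniformly_continuous_on_def by (metis exp_gt_zero)
    \<comment> \<open>The cutoff is supported within \<delta> of \<open>K\<close>, so a point at
      distance at least \<open>2 * \<delta>\<close> from \<open>K\<close> keeps distance at least
      \<delta> from the support, while points closer to \<open>K\<close> are within
      \<open>d\<close>.\<close>
    define \<delta> where "\<delta> = min (d/2) (1/2)"
    have \<delta>: "\<delta> > 0" "2 * \<delta> \<le> d" "\<delta> \<le> 1/2" using d by (auto simp: \<delta>_def)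
    define \<phi> where "\<phi> = (\<lambda>t. max 0 (1 - infdist t K / \<delta>))"
    have \<phi>c: "continuous_on A \<phi>" for A
      unfolding \<phi>_def using \<delta> by (intro continuous_intros) auto
    have \<phi>01: "\<phi> t \<ge> 0" "\<phi> t \<le> 1" for t
      using \<delta> infdist_nonneg[of t K] by (auto simp: \<phi>_def)
    have \<phi>K: "\<phi> t = 1" if "t \<in> K" for t using that by (simp add: \<phi>_def)
    define G where "G = cauchy_poisson \<phi> (- b) b"
    have b: "- b \<le> b" "b > 0" using \<rho> by (auto simp: b_def)
    have Ghol: "G holomorphic_on upper_half 0"
      unfolding G_def by (rule cauchy_poisson_holomorphic[OF \<phi>c])
    \<comment> \<open>A positive substitute for \<open>n\<close>, so that one can divide by it when
      \<open>n = 0\<close>.\<close>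
    define N where "N = real n + 1"
    have N: "N > 0" "real n \<le> N" by (auto simp: N_def)
    \<comment> \<open>\<open>G\<close> is considered inside the half-plane only, so the maximum
      principle is applied above the line \<open>Im z = \<eta>\<close>. On that line, away from
      \<open>K\<close>, the kernel is at most \<open>\<eta> / \<delta>\<^sup>2\<close> over the
      support, and this \<eta> makes \<open>Re (G z) \<le> 1 / N\<close>.\<close>
    define \<eta> where "\<eta> = min (\<rho> + 1) (pi * \<delta>\<^sup>2 / (N * (2 * b)))"
    have \<eta>: "\<eta> > 0" "\<eta> \<le> \<rho> + 1" using \<delta> b N \<rho> by (auto simp: \<eta>_def)
    \<comment> \<open>The first term keeps \<open>z0\<close> in the disc. The others put the arc at
      distance at least \<open>N * (2 * b)\<close> from the interval of integration, where the
      kernel is at most the reciprocal distance, so again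
      \<open>Re (G z) \<le> 1 / N\<close>.\<close>
    define R where "R = cmod z0 + b + N * (2 * b)"
    define H where "H = (\<lambda>z. f z * exp (of_nat n * G z))"
    have cH: "cmod (H z) = cmod (f z) * exp (real n * Re (G z))" for z
      by (simp add: H_def norm_mult)
    have small: "cmod (H z) \<le> B'" if "Im z \<ge> 0" "real n * Re (G z) \<le> 1" for z
    proof -
      have "cmod (H z) \<le> B * exp 1" unfolding cH using that bound[OF that(1)] B by (intro mult_mono) auto
      then show ?thesis by (simp add: B'_def)
    qed
    have n1: "real n * x \<le> 1" if "x \<le> 1 / N" for x
    proof (cases "x \<ge> 0")
      case True
      then have "real n * x \<le> N * x" using N by (intro mult_right_mono) auto
      also have "\<dots> \<le> 1" using that N by (simp add: field_simps)
      finally show ?thesis .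
    qed (simp add: mult_nonneg_nonpos order_trans[of _ 0 1])
    have "cmod (H z0) \<le> B'"
    proof (rule maximum_modulus_half_disc[where f = H and z = z0 and m = \<eta> and r = R])
      show "H holomorphic_on {z. \<eta> < Im z}"
        unfolding H_def using \<eta>
        by (intro holomorphic_intros holomorphic_on_subset[OF hol] holomorphic_on_subset[OF Ghol]) (auto simp: upper_half_def)
      show "continuous_on {z. \<eta> \<le> Im z} H"
        unfolding H_def using \<eta>
        by (intro continuous_intros continuous_on_subset[OF cont]
            continuous_on_subset[OF holomorphic_on_imp_continuous_on[OF Ghol]]) (auto simp: upper_half_def)
      show "\<eta> \<le> Im z0" "cmod z0 \<le> R" using z0 \<eta> b N by (auto simp: R_def)
    next
      fix z assume z: "\<eta> \<le> Im z" "cmod z = R"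
      then have zu: "z \<in> upper_half 0" "Im z > 0" using \<eta> by (auto simp: upper_half_def)
      have "Re (G z) \<le> (b - (- b)) * (1 / (N * (2 * b))) / pi"
        unfolding G_def
      proof (rule Re_cauchy_poisson_le[OF \<phi>c zu(1) b(1)])
        fix t assume t: "t \<in> {-b..b}"
        let ?c = "cmod (complex_of_real t - z)"
        have "\<bar>t\<bar> \<le> b" using t by auto
        then have c1: "N * (2 * b) \<le> ?c"
          using norm_triangle_ineq2[of z "complex_of_real t"] z(2) z0(2) \<rho> by (simp add: R_def norm_minus_commute)
        have c2: "N * (2 * b) > 0" using N b by simp
        have "Im z \<le> ?c" using abs_Im_le_cmod[of "complex_of_real t - z"] by simp
        then have "Im z / ?c\<^sup>2 \<le> ?c / ?c\<^sup>2" by (rule divide_right_mono) simp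
        also have "\<dots> = 1 / ?c" by (simp add: power2_eq_square)
        also have "\<dots> \<le> 1 / (N * (2 * b))" using c1 c2 by (intro frac_le) auto
        finally have *: "Im z / ?c\<^sup>2 \<le> 1 / (N * (2 * b))" .
        have "\<phi> t * (Im z / ?c\<^sup>2) \<le> 1 * (Im z / ?c\<^sup>2)" using \<phi>01 zu by (intro mult_right_mono) auto
        then show "\<phi> t * (Im z / ?c\<^sup>2) \<le> 1 / (N * (2 * b))" using * by simp
      qed
      also have "\<dots> = 1 / N / pi" using b by simp
      also have "\<dots> \<le> 1 / N" using pi_ge_two N by (simp add: divide_le_eq)
      finally show "cmod (H z) \<le> B'" using small n1 zu(2) by simp
    next
      fix z assume z: "Im z = \<eta>" "cmod z \<le> R"
      then have zu: "z \<in> upper_half 0" "Im z > 0" using \<eta> by (auto simp: upper_half_def)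
      show "cmod (H z) \<le> B'"
      proof (cases "\<exists>k\<in>K. cmod (complex_of_real k - z) < 2 * \<delta>")
        case True
        then obtain k where k: "k \<in> K" "cmod (complex_of_real k - z) < 2 * \<delta>" by blast
        have "cmod z \<le> cmod (complex_of_real k) + cmod (complex_of_real k - z)"
          using norm_triangle_ineq4[of "complex_of_real k" "complex_of_real k - z"] by simp
        then have "cmod z \<le> \<rho> + 1" using Kb[OF k(1)] k(2) \<delta> by simp
        then have "dist (f z) (f (complex_of_real k)) < exp (- real n)"
          using Kb[OF k(1)] k \<delta> zu by (intro d(2)) (auto simp: S_def dist_norm norm_minus_commute)
        then have "cmod (f z) \<le> exp (- real n)" using k(1) by (simp add: K_def)
        moreover have "Re (G z) \<le> 1"
          unfolding G_def by (rule Re_cauchy_poisson_le_1[OF \<phi>c zu(1) b(1) \<phi>01(2)])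
        then have "exp (real n * Re (G z)) \<le> exp (real n)" by (simp add: mult_left_le)
        ultimately have "cmod (H z) \<le> exp (- real n) * exp (real n)"
          unfolding cH by (intro mult_mono) auto
        then show ?thesis by (simp add: B'_def mult_exp_exp)
      next
        case False
        have "Re (G z) \<le> (b - (- b)) * (\<eta> / \<delta>\<^sup>2) / pi"
          unfolding G_def
        proof (rule Re_cauchy_poisson_le[OF \<phi>c zu(1) b(1)])
          fix t
          let ?c = "cmod (complex_of_real t - z)"
          show "\<phi> t * (Im z / ?c\<^sup>2) \<le> \<eta> / \<delta>\<^sup>2"
          proof (cases "infdist t K < \<delta>")
            case True
            obtain k where k: "k \<in> K" "infdist t K = dist t k"
              using infdist_attains_inf[OF \<open>closed K\<close> Kn] by blast
            have "2 * \<delta> \<le> cmod (complex_of_real k - z)" using False k(1) by (auto simp: not_less)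
            also have "\<dots> \<le> cmod (complex_of_real k - complex_of_real t) + ?c"
              using norm_triangle_ineq[of "complex_of_real k - complex_of_real t" "complex_of_real t - z"] by simp
            also have "cmod (complex_of_real k - complex_of_real t) = \<bar>k - t\<bar>"
              by (metis norm_of_real of_real_diff)
            finally have "\<delta> \<le> ?c" using True k(2) by (simp add: dist_real_def abs_minus_commute)
            then have "\<delta>\<^sup>2 \<le> ?c\<^sup>2" using \<delta> by (intro power_mono) auto
            then have "\<eta> / ?c\<^sup>2 \<le> \<eta> / \<delta>\<^sup>2" using \<eta> \<delta> by (intro frac_le) auto
            moreover have "\<phi> t * (\<eta> / ?c\<^sup>2) \<le> 1 * (\<eta> / ?c\<^sup>2)" using \<phi>01 \<eta> by (intro mult_right_mono) auto
            ultimately show ?thesis by (simp add: z(1))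
          next
            case False
            then have "\<phi> t = 0" using \<delta> by (simp add: \<phi>_def field_simps)
            then show ?thesis using \<eta> by simp
          qed
        qed
        also have "\<dots> \<le> 1 / N"
        proof -
          have "\<eta> \<le> pi * \<delta>\<^sup>2 / (N * (2 * b))" by (simp add: \<eta>_def)
          then show ?thesis using N b \<delta> by (simp add: field_simps)
        qed
        finally show ?thesis using small n1 zu(2) by simp
      qed
    qed
    moreover have "c \<le> Re (G z0)"
    proof -
      have "Im z0 / r\<^sup>2 * measure lebesgue K / pi \<le> Re (G z0)"
        unfolding G_def
      proof (rule Re_cauchy_poisson_ge[OF \<phi>c z0(1) Kc _ \<phi>K \<phi>01(1)])
        show "K \<subseteq> {-b..b}" using Kb by (force simp: b_def)
        show "r > 0" using \<rho> by (simp add: r_def)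
        fix t assume "t \<in> K"
        then show "cmod (complex_of_real t - z0) \<le> r"
          using norm_triangle_ineq4[of "complex_of_real t" z0] Kb[of t] z0(2) by (simp add: r_def)
      qed
      then show ?thesis by (simp add: c_def \<mu>_def z0)
    qed
    then have "cmod (f z0) * exp (real n * c) \<le> cmod (H z0)"
      unfolding cH by (intro mult_left_mono) (auto intro: mult_left_mono)
    ultimately show ?thesis by linarith
  qed
  obtain n :: nat where n: "B' / (cmod (f z0) * c) < real n" using reals_Archimedean2 by blast
  have "real n * c \<le> exp (real n * c)" using exp_ge_add_one_self[of "real n * c"] by linarith
  then have "cmod (f z0) * (real n * c) \<le> B'"
    using main[of n] mult_left_mono[of "real n * c" "exp (real n * c)" "cmod (f z0)"] by simp
  then show False using n fz0 c by (simp add: field_simps)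
qed

section \<open>Inverse matrices depending on a parameter\<close>

lemma matrix_inv_works:
  fixes A :: "'k::field^'n^'n"
  assumes "invertible A"
  shows "A ** matrix_inv A = mat 1" "matrix_inv A ** A = mat 1"
  using someI_ex[OF assms[unfolded invertible_def]] by (simp_all add: matrix_inv_def)

text \<open>Cramer's rule for column \<open>j\<close>. As quotients of determinants the entries of
  the inverse inherit continuity, holomorphy and meromorphy.\<close>

lemma matrix_inv_entry:
  fixes A :: "complex^'n^'n"
  assumes "det A \<noteq> 0"
  shows "matrix_inv A $ k $ j = det (\<chi> i l. if l = k then axis j 1 $ i else A $ i $ l) / det A"
proof -
  have inv: "A ** matrix_inv A = mat 1"
    using assms by (intro matrix_inv_works) (simp add: invertible_det_nz)
  have "A *v (\<chi> i. matrix_inv A $ i $ j) = axis j 1"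
  proof -
    have "(A *v (\<chi> i. matrix_inv A $ i $ j)) $ i = (A ** matrix_inv A) $ i $ j" for i
      by (simp add: matrix_vector_mult_def matrix_mult_nth)
    then show ?thesis by (simp add: inv vec_eq_iff mat_def axis_def)
  qed
  from this[unfolded cramer[OF assms]] show ?thesis by (simp add: vec_eq_iff)
qed

lemma det_holomorphic:
  fixes A :: "complex \<Rightarrow> complex^'n^'n"
  assumes "\<And>i j. (\<lambda>z. A z $ i $ j) holomorphic_on S"
  shows "(\<lambda>z. det (A z)) holomorphic_on S"
  unfolding det_def by (intro holomorphic_intros assms)

lemma det_continuous_on:
  fixes A :: "'t::topological_space \<Rightarrow> complex^'n^'n"
  assumes "\<And>i j. continuous_on S (\<lambda>z. A z $ i $ j)"
  shows "continuous_on S (\<lambda>z. det (A z))"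
  unfolding det_def by (intro continuous_intros assms)

lemma continuous_on_entry:
  fixes f :: "'t::topological_space \<Rightarrow> complex^'n^'k"
  shows "continuous_on S f \<Longrightarrow> continuous_on S (\<lambda>z. f z $ i $ j)"
  by (rule bounded_linear.continuous_on[OF bounded_linear_entry])

lemma continuous_on_matrixI:
  fixes f :: "'t::topological_space \<Rightarrow> complex^'n^'k"
  assumes "\<And>i j. continuous_on S (\<lambda>z. f z $ i $ j)"
  shows "continuous_on S f"
proof -
  have "continuous_on S (\<lambda>z. \<chi> i j. f z $ i $ j)" by (intro continuous_on_vec_lambda assms)
  then show ?thesis by simp
qed

lemma matrix_inv_continuous_on:
  fixes A :: "'t::topological_space \<Rightarrow> complex^'n^'n"
  assumes A: "continuous_on S A" and nz: "\<And>z. z \<in> S \<Longrightarrow> det (A z) \<noteq> 0"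
  shows "continuous_on S (\<lambda>z. matrix_inv (A z))"
proof (rule continuous_on_matrixI)
  fix k j
  have "continuous_on S (\<lambda>z. det (\<chi> i l. if l = k then axis j 1 $ i else A z $ i $ l) / det (A z))"
  proof (intro continuous_on_divide det_continuous_on)
    fix i l
    show "continuous_on S (\<lambda>z. (\<chi> i l. if l = k then axis j 1 $ i else A z $ i $ l) $ i $ l)"
      by (cases "l = k") (simp_all add: continuous_on_entry[OF A])
  qed (use nz continuous_on_entry[OF A] in auto)
  then show "continuous_on S (\<lambda>z. matrix_inv (A z) $ k $ j)"
    by (rule continuous_on_eq) (simp add: matrix_inv_entry nz)
qed

text \<open>The determinant stays within distance 1 of its value 1. The inverse equals the identity
  minus \<open>(A - mat 1) ** matrix_inv A\<close>, and for small \<open>e\<close> the norm of the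
  last term is at most half that of the inverse and is absorbed.\<close>

lemma matrix_inv_near_identity:
  obtains e K where "e > 0" "K > 0"
    "\<And>A :: complex^'n^'n. norm (A - mat 1) \<le> e \<Longrightarrow> det A \<noteq> 0 \<and> norm (matrix_inv A) \<le> K"
proof -
  let ?I = "mat 1 :: complex^'n^'n"
  obtain C where C: "C > 0" "\<And>(A :: complex^'n^'n) (B :: complex^'n^'n). norm (A ** B) \<le> norm A * norm B * C"
    by (rule matrix_mult_norm_bound) (rule that)
  have "continuous_on UNIV (\<lambda>A :: complex^'n^'n. det A)"
    by (intro det_continuous_on continuous_on_entry continuous_on_id)
  then have "isCont (\<lambda>A :: complex^'n^'n. det A) ?I"
    by (simp add: continuous_on_eq_continuous_at)
  then obtain d where d: "d > 0" "\<And>A :: complex^'n^'n. dist A ?I < d \<Longrightarrow> dist (det A) (det ?I) < 1"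
    unfolding continuous_at by (metis zero_less_one LIM_def dist_self dist_pos_lt)
  define e where "e = min (d / 2) (1 / (2 * C))"
  have e: "e > 0" "e < d" "e * C \<le> 1/2" using d C by (auto simp: e_def min_def field_simps)
  show ?thesis
  proof (rule that[OF e(1), of "2 * norm ?I + 1"])
    show "0 < 2 * norm ?I + 1" by (simp add: add_nonneg_pos)
    fix A :: "complex^'n^'n" assume A: "norm (A - ?I) \<le> e"
    then have "dist A ?I < d" using e by (simp add: dist_norm)
    from d(2)[OF this] have det: "det A \<noteq> 0" by (auto simp: dist_norm)
    then have inv: "A ** matrix_inv A = ?I" by (intro matrix_inv_works) (simp add: invertible_det_nz)
    have "matrix_inv A = ?I - (A - ?I) ** matrix_inv A"
      by (simp add: matrix_mult_distribs inv)
    then have "norm (matrix_inv A) \<le> norm ?I + norm ((A - ?I) ** matrix_inv A)"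
      by (metis norm_triangle_ineq4)
    also have "norm ((A - ?I) ** matrix_inv A) \<le> norm (A - ?I) * norm (matrix_inv A) * C" by (rule C)
    also have "\<dots> \<le> e * norm (matrix_inv A) * C" using A C by (intro mult_right_mono) auto
    also have "\<dots> = (e * C) * norm (matrix_inv A)" by simp
    also have "\<dots> \<le> 1/2 * norm (matrix_inv A)" using e by (intro mult_right_mono) auto
    finally have "norm (matrix_inv A) \<le> 2 * norm ?I + 1" by simp
    then show "det A \<noteq> 0 \<and> norm (matrix_inv A) \<le> 2 * norm ?I + 1" using det by simp
  qed
qed

section \<open>Meromorphic functions up to the boundary\<close>

lemma pole_free_ball:
  fixes R :: "complex \<Rightarrow> complex^'n^'k"
  assumes mero: "\<And>i k. (\<lambda>z. R z $ i $ k) meromorphic_on upper_half 0" and z: "z \<in> upper_half 0"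
  obtains d where "d > 0" "\<And>w. w \<in> ball z d - {z} \<Longrightarrow> w \<in> upper_half 0 - poles R"
proof -
  have "\<forall>\<^sub>F w in at z. \<forall>i. \<forall>k. \<not> is_pole (\<lambda>w. R w $ i $ k) w"
  proof (intro eventually_all_finite)
    fix i k
    have "isolated_singularity_at (\<lambda>w. R w $ i $ k) z"
      using mero z by (auto simp: meromorphic_on_altdef)
    then show "\<forall>\<^sub>F w in at z. \<not> is_pole (\<lambda>w. R w $ i $ k) w"
      unfolding isolated_singularity_at_altdef
      by (rule eventually_mono) (rule analytic_at_imp_no_pole)
  qed
  moreover have "\<forall>\<^sub>F w in at z. w \<in> upper_half 0"
    using z by (intro eventually_at_in_open') (auto simp: upper_half_def open_halfspace_Im_gt)
  ultimately have "\<forall>\<^sub>F w in at z. w \<in> upper_half 0 - poles R"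
    by eventually_elim (auto simp: poles_def)
  then obtain d where "d > 0" "\<And>w. w \<noteq> z \<Longrightarrow> dist w z < d \<Longrightarrow> w \<in> upper_half 0 - poles R"
    unfolding eventually_at by blast
  then show ?thesis using that[of d] by (auto simp: dist_commute)
qed

text \<open>Poles are isolated, so continuity on the given set is full continuity at
  \<open>z\<close>. This rules out the wrong values at removable singularities that
  \<open>meromorphic_on\<close> permits.\<close>

lemma continuous_off_poles:
  fixes R :: "complex \<Rightarrow> complex^'n^'k"
  assumes mero: "\<And>i k. (\<lambda>z. R z $ i $ k) meromorphic_on upper_half 0"
    and cont: "continuous_on (T \<union> (upper_half 0 - poles R)) R"
    and z: "z \<in> upper_half 0 - poles R"
  shows "isCont R z" "(\<lambda>z. R z $ i $ k) analytic_on {z}"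
proof -
  obtain d where d: "d > 0" "\<And>w. w \<in> ball z d - {z} \<Longrightarrow> w \<in> upper_half 0 - poles R"
    using pole_free_ball[OF mero] z by (metis (no_types, lifting) DiffD1)
  have "ball z d \<subseteq> upper_half 0 - poles R" using d(2) z by blast
  then have "continuous_on (ball z d) R" by (intro continuous_on_subset[OF cont]) auto
  then show c: "isCont R z" using d(1) by (simp add: continuous_on_eq_continuous_at)
  have "isCont (\<lambda>z. R z $ i $ k) z"
    using bounded_linear.continuous[OF bounded_linear_entry c] .
  moreover have "(\<lambda>z. R z $ i $ k) meromorphic_on {z}"
    using mero z by (blast intro: meromorphic_on_subset)
  ultimately show "(\<lambda>z. R z $ i $ k) analytic_on {z}" by (intro meromorphic_at_isCont_imp_analytic)
qed

text \<open>Near \<open>t\<close> continuity keeps \<open>R\<close> bounded at all points that are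
  not poles, whereas a pole would have such points with arbitrarily large values arbitrarily close
  to it.\<close>

lemma no_poles_near_boundary_point:
  fixes R :: "complex \<Rightarrow> complex^'n^'k"
  assumes mero: "\<And>i k. (\<lambda>z. R z $ i $ k) meromorphic_on upper_half 0"
    and cont: "continuous_on (T \<union> (upper_half 0 - poles R)) R" and t: "t \<in> T"
  obtains r where "r > 0" "upper_half 0 \<inter> ball t r \<inter> poles R = {}"
proof -
  obtain r where r: "r > 0" "\<And>w. w \<in> T \<union> (upper_half 0 - poles R) \<Longrightarrow> dist w t < r \<Longrightarrow> dist (R w) (R t) < 1"
    using cont t unfolding continuous_on_iff by (metis UnI1 zero_less_one)
  have "z \<notin> poles R" if z: "z \<in> upper_half 0" "z \<in> ball t r" for z
  proof
    assume "z \<in> poles R"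
    then obtain i k where p: "is_pole (\<lambda>w. R w $ i $ k) z" by (auto simp: poles_def)
    obtain d where d: "d > 0" "\<And>w. w \<in> ball z d - {z} \<Longrightarrow> w \<in> upper_half 0 - poles R"
      by (rule pole_free_ball[OF mero z(1)]) (rule that)
    have "filterlim (\<lambda>w. R w $ i $ k) at_infinity (at z)" using p by (simp add: is_pole_def)
    then have "\<forall>\<^sub>F w in at z. cmod (R w $ i $ k) \<ge> norm (R t) + 1"
      using filterlim_at_infinity[OF order_refl, THEN iffD1, rule_format, of "\<lambda>w. R w $ i $ k" "at z" "norm (R t) + 1"]
      by (simp add: add_nonneg_pos)
    moreover have "\<forall>\<^sub>F w in at z. w \<in> ball z d \<and> w \<noteq> z"
      using d(1) by (auto simp: eventually_at dist_commute intro!: exI[of _ d])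
    moreover have "\<forall>\<^sub>F w in at z. w \<in> ball t r"
      using z(2) by (intro eventually_at_in_open') auto
    ultimately have "\<forall>\<^sub>F w in at z. False"
    proof eventually_elim
      case (elim w)
      then have "dist (R w) (R t) < 1" using d(2)[of w] by (intro r(2)) (auto simp: dist_commute)
      then have "norm (R w) < norm (R t) + 1"
        using norm_triangle_ineq2[of "R w" "R t"] by (simp add: dist_norm)
      then show ?case using elim(1) norm_entry_le[of "R w" i k] by linarith
    qed
    then show False by simp
  qed
  then show ?thesis using that[OF r(1)] by blast
qed

text \<open>Near a boundary point both functions are free of poles, so their difference vanishes on
  a half-disc by continuation across the segment. The identity theorem for meromorphic functions
  carries this to the whole connected half-plane, up to isolated points.\<close>

lemma meromorphic_boundary_unique:
  fixes R S :: "complex \<Rightarrow> complex^'n^'k"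
  assumes R: "\<And>i k. (\<lambda>z. R z $ i $ k) meromorphic_on upper_half 0"
      "continuous_on (complex_of_real ` {t. \<bar>t\<bar> > m} \<union> (upper_half 0 - poles R)) R"
    and S: "\<And>i k. (\<lambda>z. S z $ i $ k) meromorphic_on upper_half 0"
      "continuous_on (complex_of_real ` {t. \<bar>t\<bar> > m} \<union> (upper_half 0 - poles S)) S"
    and eq: "\<And>t. \<bar>t\<bar> > m \<Longrightarrow> S (complex_of_real t) = R (complex_of_real t)" and m: "m > 0"
  shows "poles S = poles R" "\<And>z. z \<in> upper_half 0 - poles R \<Longrightarrow> S z = R z"
proof -
  let ?T = "complex_of_real ` {t. \<bar>t\<bar> > m}"
  \<comment> \<open>Together with \<open>r \<le> 1\<close> this keeps the real points of the disc in
    the region where the boundary values agree.\<close>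
  define t where "t = m + 1"
  have tT: "complex_of_real t \<in> ?T" by (rule imageI) (use m in \<open>simp add: t_def\<close>)
  obtain r1 where r1: "r1 > 0" "upper_half 0 \<inter> ball (complex_of_real t) r1 \<inter> poles R = {}"
    by (rule no_poles_near_boundary_point[OF R tT]) (rule that)
  obtain r2 where r2: "r2 > 0" "upper_half 0 \<inter> ball (complex_of_real t) r2 \<inter> poles S = {}"
    by (rule no_poles_near_boundary_point[OF S tT]) (rule that)
  define r where "r = min 1 (min r1 r2)"
  have r: "r > 0" "r \<le> 1" "r \<le> r1" "r \<le> r2" using r1 r2 by (auto simp: r_def)
  let ?B = "ball (complex_of_real t) r"
  have B: "ball (complex_of_real t) r \<subseteq> ball (complex_of_real t) r1"
    "ball (complex_of_real t) r \<subseteq> ball (complex_of_real t) r2" using r by (auto intro: subset_ball)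
  have real_B: "\<bar>x\<bar> > m" if "complex_of_real x \<in> ?B" for x
  proof -
    have "cmod (complex_of_real t - complex_of_real x) < r" using that by (simp add: dist_norm)
    then have "\<bar>t - x\<bar> < 1" using r(2) by (metis norm_of_real of_real_diff order_less_le_trans real_norm_def)
    then show ?thesis by (simp add: t_def)
  qed
  have sub: "{z. 0 \<le> Im z} \<inter> ?B \<subseteq> ?T \<union> (upper_half 0 - poles R)" "{z. 0 \<le> Im z} \<inter> ?B \<subseteq> ?T \<union> (upper_half 0 - poles S)"
  proof -
    have "z \<in> ?T \<or> z \<in> upper_half 0 \<inter> ?B" if "0 \<le> Im z" "z \<in> ?B" for z
    proof (cases "Im z = 0")
      case True
      then have "z = complex_of_real (Re z)" by (simp add: complex_eq_iff)
      then show ?thesis using real_B[of "Re z"] that by (metis (mono_tags, lifting) imageI mem_Collect_eq)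
    qed (use that in \<open>auto simp: upper_half_def\<close>)
    then show "{z. 0 \<le> Im z} \<inter> ?B \<subseteq> ?T \<union> (upper_half 0 - poles R)" "{z. 0 \<le> Im z} \<inter> ?B \<subseteq> ?T \<union> (upper_half 0 - poles S)"
      using r1(2) r2(2) B by blast+
  qed
  have ev: "\<forall>\<^sub>F z in at w. S z $ i $ k = R z $ i $ k" if w: "w \<in> upper_half 0" for i k w
  proof -
    define f where "f = (\<lambda>z. S z $ i $ k - R z $ i $ k)"
    have fB: "f z = 0" if z: "0 \<le> Im z" "z \<in> ?B" for z
    proof (rule holomorphic_zero_on_real_segment[where f = f, OF _ _ _ z])
      show "continuous_on ({z. 0 \<le> Im z} \<inter> ?B) f"
        unfolding f_def
        by (intro continuous_on_diff continuous_on_entry continuous_on_subset[OF R(2) sub(1)] continuous_on_subset[OF S(2) sub(2)])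
      have "f analytic_on upper_half 0 \<inter> ?B"
        unfolding f_def
      proof (subst analytic_on_analytic_at, intro ballI analytic_on_diff)
        fix z assume "z \<in> upper_half 0 \<inter> ?B"
        then have "z \<in> upper_half 0 - poles R" "z \<in> upper_half 0 - poles S"
          using r1(2) r2(2) B by blast+
        then show "(\<lambda>z. S z $ i $ k) analytic_on {z}" "(\<lambda>z. R z $ i $ k) analytic_on {z}"
          using continuous_off_poles(2)[OF R] continuous_off_poles(2)[OF S] by blast+
      qed
      then show "f holomorphic_on upper_half 0 \<inter> ?B" by (rule analytic_imp_holomorphic)
      fix x assume "complex_of_real x \<in> ?B"
      then show "f (complex_of_real x) = 0" using eq real_B by (simp add: f_def)
    qed
    have mero: "f meromorphic_on upper_half 0" unfolding f_def by (intro meromorphic_intros R S)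
    have op: "open (upper_half 0)" and co: "connected (upper_half 0)"
      by (auto simp: upper_half_def open_halfspace_Im_gt intro: convex_connected convex_halfspace_Im_gt)
    \<comment> \<open>A point of the half-disc, where the alternative that the difference avoids 0
      near every point fails.\<close>
    define p where "p = complex_of_real t + \<i> * complex_of_real (r/2)"
    have p: "p \<in> upper_half 0" "p \<in> ?B" using r by (auto simp: p_def upper_half_def dist_norm norm_mult)
    from meromorphic_imp_constant_or_avoid[OF mero op co, of 0]
    have "\<forall>\<^sub>F z in cosparse (upper_half 0). f z = 0"
    proof
      assume "\<forall>\<^sub>F z in cosparse (upper_half 0). f z \<noteq> 0"
      then have "\<forall>\<^sub>F z in at p. f z \<noteq> 0" using p op by (simp add: eventually_cosparse_open_eq)
      moreover have "\<forall>\<^sub>F z in at p. z \<in> upper_half 0 \<inter> ?B"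
        using p op by (intro eventually_at_in_open') auto
      ultimately have "\<forall>\<^sub>F z in at p. False"
        by eventually_elim (use fB in \<open>auto simp: upper_half_def\<close>)
      then show ?thesis by simp
    qed
    then have "\<forall>\<^sub>F z in at w. f z = 0" using w op by (simp add: eventually_cosparse_open_eq)
    then show ?thesis by eventually_elim (simp add: f_def)
  qed
  have "is_pole (\<lambda>w. S w $ i $ k) z \<longleftrightarrow> is_pole (\<lambda>w. R w $ i $ k) z" if "z \<in> upper_half 0" for z i k
    by (rule is_pole_cong[OF ev[OF that] refl])
  then show pol: "poles S = poles R" by (simp add: poles_def cong: conj_cong)
  fix z assume z: "z \<in> upper_half 0 - poles R"
  have cR: "isCont R z" by (rule continuous_off_poles(1)[OF R z])
  have cS: "isCont S z" by (rule continuous_off_poles(1)[OF S]) (use z pol in simp)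
  \<comment> \<open>So far the functions agree in punctured neighbourhoods; the values at
    \<open>z\<close> itself follow from continuity of both.\<close>
  have "S z $ i $ k = R z $ i $ k" for i k
  proof (rule tendsto_unique[of "at z"])
    have "((\<lambda>w. S w $ i $ k) \<longlongrightarrow> S z $ i $ k) (at z)"
      by (intro bounded_linear.tendsto[OF bounded_linear_entry]) (use cS in \<open>simp add: continuous_at\<close>)
    then show "((\<lambda>w. R w $ i $ k) \<longlongrightarrow> S z $ i $ k) (at z)"
      by (rule Lim_transform_eventually) (use ev z in simp)
    show "((\<lambda>w. R w $ i $ k) \<longlongrightarrow> R z $ i $ k) (at z)"
      by (intro bounded_linear.tendsto[OF bounded_linear_entry]) (use cR in \<open>simp add: continuous_at\<close>)
  qed simp
  then show "S z = R z" by (simp add: vec_eq_iff)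
qed

text \<open>Multiplication by an exponential of modulus \<open>exp (2 * l * Im z)\<close> leaves a
  bounded function. By Phragmen-Lindelof its size is governed by the line \<open>Im z = m1\<close>,
  where the bound involves a factor independent of \<open>l\<close>; strictly above the line,
  letting \<open>l\<close> grow forces \<open>f\<close> to vanish.\<close>

lemma superexponential_decay_zero:
  fixes f :: "complex \<Rightarrow> complex"
  assumes hol: "f holomorphic_on {z. Im z > m}"
    and decay: "\<And>l. l > 0 \<Longrightarrow> \<exists>C. \<forall>z. Im z > m \<longrightarrow> cmod (f z) \<le> C * exp (- 2 * l * Im z)"
    and z: "Im z > m"
  shows "f z = 0"
proof -
  define m1 where "m1 = (m + Im z) / 2"
  have m1: "m < m1" "m1 < Im z" using z by (auto simp: m1_def)
  \<comment> \<open>The decay for \<open>l = 1\<close> gives the bound on the line with a constant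
    independent of \<open>l\<close>. The constant belonging to each \<open>l\<close> serves below as
    an a priori bound and does not enter the conclusion.\<close>
  obtain A where A: "\<And>z. Im z > m \<Longrightarrow> cmod (f z) \<le> A * exp (- 2 * 1 * Im z)"
    using decay[of 1] by auto
  define A' where "A' = A * exp (- 2 * m1)"
  have main: "cmod (f z) \<le> A' * exp (- 2 * l * (Im z - m1))" if l: "l > 0" for l
  proof -
    obtain C where C: "\<And>z. Im z > m \<Longrightarrow> cmod (f z) \<le> C * exp (- 2 * l * Im z)" using decay[OF l] by blast
    define H where "H = (\<lambda>w. f w * exp (- 2 * \<i> * complex_of_real l * w))"
    have cH: "cmod (H w) = cmod (f w) * exp (2 * l * Im w)" for w by (simp add: H_def norm_mult)
    have Hhol: "H holomorphic_on {z. Im z > m}" unfolding H_def by (intro holomorphic_intros hol)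
    have "cmod (H z) \<le> A' * exp (2 * l * m1)"
    proof (rule phragmen_lindelof_half_plane[where f = H and z = z and m = m1 and B = C])
      show "H holomorphic_on {z. m1 < Im z}" by (rule holomorphic_on_subset[OF Hhol]) (use m1 in auto)
      show "continuous_on {z. m1 \<le> Im z} H"
        by (rule continuous_on_subset[OF holomorphic_on_imp_continuous_on[OF Hhol]]) (use m1 in auto)
      fix w
      { assume "m1 \<le> Im w"
        then have "cmod (f w) * exp (2 * l * Im w) \<le> C * exp (- 2 * l * Im w) * exp (2 * l * Im w)"
          using m1 by (intro mult_right_mono C) auto
        then show "cmod (H w) \<le> C" by (simp add: cH mult_exp_exp mult.assoc) }
      { assume "Im w = m1"
        then show "cmod (H w) \<le> A' * exp (2 * l * m1)" using A[of w] m1 by (simp add: cH A'_def) }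
    qed (use m1 in auto)
    then have "cmod (f z) * exp (2 * l * Im z) * exp (- 2 * l * Im z) \<le> A' * exp (2 * l * m1) * exp (- 2 * l * Im z)"
      unfolding cH by (rule mult_right_mono) simp
    then show ?thesis by (simp add: mult.assoc mult_exp_exp algebra_simps)
  qed
  have "((\<lambda>l. A' * exp (- 2 * l * (Im z - m1))) \<longlongrightarrow> A' * 0) at_top"
  proof (intro tendsto_intros)
    have "filterlim (\<lambda>l. - (2 * (Im z - m1)) * l) at_bot at_top"
      using m1 by (intro filterlim_tendsto_neg_mult_at_bot[OF tendsto_const _ filterlim_ident]) auto
    then have "filterlim (\<lambda>l. - 2 * l * (Im z - m1)) at_bot at_top" by (simp add: algebra_simps)
    then show "((\<lambda>l. exp (- 2 * l * (Im z - m1))) \<longlongrightarrow> 0) at_top"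
      by (rule filterlim_compose[OF exp_at_bot])
  qed
  moreover have "\<forall>\<^sub>F l in at_top. cmod (f z) \<le> A' * exp (- 2 * l * (Im z - m1))"
    using eventually_gt_at_top[of 0] by eventually_elim (rule main)
  ultimately have "cmod (f z) \<le> A' * 0" by (intro tendsto_lowerbound) auto
  then show ?thesis by simp
qed

section \<open>The reflection coefficient\<close>

lemma norm_upper_block_le: "norm (upper_block A) \<le> norm (A :: complex^'n^('a::finite+'b::finite))"
proof -
  have "(norm (upper_block A))\<^sup>2 \<le> (norm A)\<^sup>2"
    by (simp add: norm_vec_def[of A] norm_vec_def[of "upper_block A"] L2_set_def sum_over_sum_type sum_nonneg)
  then show ?thesis by (rule power2_le_imp_le) simp
qed

lemma ac_deriv_continuous_on_atLeast:
  assumes "ac_deriv f f'"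
  shows "continuous_on {0..} f"
  unfolding continuous_on_eq_continuous_within
proof
  fix x :: real assume x: "x \<in> {0..}"
  have "at x within {0..} = at x within {0..x+1}"
    by (rule at_within_nhd[of x "{..<x+1}"]) auto
  moreover have "continuous (at x within {0..x+1}) f"
    using ac_deriv_continuous_on[OF assms order_refl, of "x+1"] x
    by (simp add: continuous_on_eq_continuous_within)
  ultimately show "continuous (at x within {0..}) f" by simp
qed

lemma sum_diagonal_cadj_mult:
  "(\<Sum>k\<in>UNIV. Re ((cadj w ** w) $ k $ k)) = (norm w)\<^sup>2" for w :: "complex^'n^'k"
proof -
  have "(\<Sum>k\<in>UNIV. Re ((cadj w ** w) $ k $ k)) = (\<Sum>k\<in>UNIV. \<Sum>i\<in>UNIV. inner (w $ i $ k) (w $ i $ k))"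
    by (simp add: matrix_mult_nth inner_complex_def)
  also have "\<dots> = inner w w" unfolding matrix_inner by (rule sum.swap)
  finally show ?thesis by (simp add: dot_square_norm)
qed

text \<open>The reflection coefficient depends on \<open>Y\<close> through its values at
  \<open>x = 0\<close>, so the link with the limit constructed above is recorded for these
  values.\<close>

locale dirac_jost = dirac_system v u
  for v :: "real \<Rightarrow> complex^'b::finite^'a::finite" and u +
  fixes Y :: "real \<Rightarrow> complex \<Rightarrow> complex^'a^('a + 'b)"
  assumes Y_0: "\<And>z. Im z \<ge> 0 \<Longrightarrow> Y 0 z = jost_value z"
begin

abbreviation "Y1 z \<equiv> upper_block (Y 0 z)"
abbreviation "R \<equiv> refl_coeff Y"

lemma Y0_continuous_on: "continuous_on {z. Im z \<ge> 0} (Y 0)"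
  using continuous_on_cong[OF refl, of "{z. Im z \<ge> 0}" "Y 0" jost_value] jost_value_continuous_on Y_0 by simp

lemma Y0_holomorphic: "(\<lambda>z. Y 0 z $ r $ c) holomorphic_on upper_half 0"
  by (rule holomorphic_transform[OF jost_value_holomorphic]) (simp add: Y_0 upper_half_def)

lemma det_Y1_continuous_on: "continuous_on {z. Im z \<ge> 0} (\<lambda>z. det (Y1 z))"
  by (intro det_continuous_on) (simp add: continuous_on_entry[OF Y0_continuous_on])

lemma det_Y1_holomorphic: "(\<lambda>z. det (Y1 z)) holomorphic_on upper_half 0"
  by (intro det_holomorphic) (simp add: Y0_holomorphic)

text \<open>The upper blocks range in a fixed ball, on which the determinant is bounded by
  compactness.\<close>

lemma det_Y1_bounded: "\<exists>B. \<forall>z. Im z \<ge> 0 \<longrightarrow> cmod (det (Y1 z)) \<le> B"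
proof -
  let ?r = "norm (first_columns :: complex^'a^('a + 'b))"
  have "continuous_on (cball 0 ?r) (\<lambda>A :: complex^'a^'a. det A)"
    by (intro det_continuous_on continuous_on_entry continuous_on_id)
  then have "bounded ((\<lambda>A :: complex^'a^'a. det A) ` cball 0 ?r)"
    by (intro compact_imp_bounded compact_continuous_image) auto
  then obtain B where "\<forall>x\<in>(\<lambda>A :: complex^'a^'a. det A) ` cball 0 ?r. cmod x \<le> B"
    unfolding bounded_iff by blast
  then have B: "cmod (det A) \<le> B" if "norm A \<le> ?r" for A :: "complex^'a^'a"
    using that by simp
  have "cmod (det (Y1 z)) \<le> B" if "Im z \<ge> 0" for z
    by (rule B) (use norm_upper_block_le[of "Y 0 z"] norm_jost_value_le[OF that] Y_0[OF that] in simp)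
  then show ?thesis by blast
qed

lemma refl_defined_iff: "refl_defined Y z \<longleftrightarrow> det (Y1 z) \<noteq> 0"
  by (simp add: refl_defined_def invertible_det_nz)

text \<open>A common threshold: beyond it the upper block is close to the identity, hence uniformly
  invertible, and solutions starting in the lower block keep at least half of their initial size
  after multiplication by the phase.\<close>

lemma large_z:
  obtains \<rho> K where "\<rho> > 0" "K > 0"
    "\<And>z. Im z \<ge> 0 \<Longrightarrow> cmod z > \<rho> \<Longrightarrow> det (Y1 z) \<noteq> 0 \<and> norm (matrix_inv (Y1 z)) \<le> K"
    "\<And>z X (\<eta> :: complex^'a^'b). \<lbrakk>Im z \<ge> 0; cmod z > \<rho>; X \<ge> 0\<rbrakk> \<Longrightarrow>
      norm (phase z X *\<^sub>M (u X z ** block_col 0 \<eta>)) \<ge> norm \<eta> / 2"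
proof -
  obtain e K where eK: "e > 0" "K > 0"
    "\<And>A :: complex^'a^'a. norm (A - mat 1) \<le> e \<Longrightarrow> det A \<noteq> 0 \<and> norm (matrix_inv A) \<le> K"
    by (rule matrix_inv_near_identity) (rule that)
  obtain \<rho>1 where \<rho>1: "\<rho>1 > 0" "\<And>z. \<lbrakk>cmod z > \<rho>1; Im z \<ge> 0\<rbrakk> \<Longrightarrow> norm (jost_value z - first_columns) \<le> e"
    by (rule jost_value_near[OF eK(1)]) (rule that)
  have half: "(1/2 :: real) > 0" by simp
  obtain \<rho>2 where \<rho>2: "\<rho>2 > 0" "\<And>z X (\<eta> :: complex^'a^'b). \<lbrakk>cmod z > \<rho>2; Im z \<ge> 0; X \<ge> 0\<rbrakk> \<Longrightarrow>
    norm (lower_block (phase z X *\<^sub>M (u X z ** block_col 0 \<eta>)) - \<eta>) \<le> 1/2 * norm \<eta>"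
    by (rule u_lower_near[OF half]) (rule that)
  show ?thesis
  proof (rule that[of "max \<rho>1 \<rho>2" K])
    show "max \<rho>1 \<rho>2 > 0" "K > 0" using \<rho>1 eK by auto
    fix z assume z: "Im z \<ge> 0" "cmod z > max \<rho>1 \<rho>2"
    have "Y1 z - mat 1 = upper_block (jost_value z - first_columns)"
      using z by (simp add: Y_0 vec_eq_iff)
    then have "norm (Y1 z - mat 1) \<le> e"
      using norm_upper_block_le[of "jost_value z - first_columns"] \<rho>1(2)[of z] z by simp
    then show "det (Y1 z) \<noteq> 0 \<and> norm (matrix_inv (Y1 z)) \<le> K" by (rule eK(3))
    fix X :: real and \<eta> :: "complex^'a^'b" assume X: "X \<ge> 0"
    let ?k = "phase z X *\<^sub>M (u X z ** block_col 0 \<eta>)"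
    have "norm \<eta> - norm (lower_block ?k) \<le> norm (lower_block ?k - \<eta>)"
      using norm_triangle_ineq2[of \<eta> "lower_block ?k"] by (simp add: norm_minus_commute)
    also have "\<dots> \<le> 1/2 * norm \<eta>" using \<rho>2(2)[of z X \<eta>] z X by simp
    finally have "norm \<eta> / 2 \<le> norm (lower_block ?k)" by simp
    then show "norm \<eta> / 2 \<le> norm ?k" using norm_block_le[of ?k] by linarith
  qed
qed

lemma AE_refl_defined: "AE t in lebesgue. refl_defined Y (complex_of_real t)"
proof (rule large_z)
  fix \<rho> K
  assume "\<rho> > 0" and *: "\<And>z. Im z \<ge> 0 \<Longrightarrow> cmod z > \<rho> \<Longrightarrow> det (Y1 z) \<noteq> 0 \<and> norm (matrix_inv (Y1 z)) \<le> K"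
  obtain B where B: "\<And>z. Im z \<ge> 0 \<Longrightarrow> cmod (det (Y1 z)) \<le> B" using det_Y1_bounded by blast
  have "negligible {t. det (Y1 (complex_of_real t)) = 0}"
    by (rule boundary_zeros_negligible[OF det_Y1_continuous_on det_Y1_holomorphic B _ \<open>\<rho> > 0\<close>]) (use * in auto)
  then show ?thesis
    unfolding eventually_ae_filter_negligible refl_defined_iff by (intro exI conjI) auto
qed

lemma det_Y1_nonzero: "\<exists>z\<in>upper_half 0. det (Y1 z) \<noteq> 0"
proof (rule large_z)
  fix \<rho> K
  assume "\<rho> > 0" and *: "\<And>z. Im z \<ge> 0 \<Longrightarrow> cmod z > \<rho> \<Longrightarrow> det (Y1 z) \<noteq> 0 \<and> norm (matrix_inv (Y1 z)) \<le> K"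
  then have "det (Y1 (\<i> * complex_of_real (\<rho> + 1))) \<noteq> 0" by (simp add: norm_mult)
  moreover have "\<i> * complex_of_real (\<rho> + 1) \<in> upper_half 0" using \<open>\<rho> > 0\<close> by (simp add: upper_half_def)
  ultimately show ?thesis by blast
qed

lemma eventually_det_Y1_nonzero:
  assumes z: "z \<in> upper_half 0"
  shows "\<forall>\<^sub>F w in at z. det (Y1 w) \<noteq> 0"
proof -
  obtain z0 where z0: "z0 \<in> upper_half 0" "det (Y1 z0) \<noteq> 0" using det_Y1_nonzero by blast
  have "connected (upper_half 0)"
    unfolding upper_half_def by (intro convex_connected convex_halfspace_Im_gt)
  from non_zero_neighbour_alt[OF det_Y1_holomorphic open_upper_half this z z0]
  show ?thesis by eventually_elim simp
qed

lemma refl_coeff_entry: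
  assumes "det (Y1 z) \<noteq> 0"
  shows "R z $ i $ k = (\<Sum>j\<in>UNIV. Y 0 z $ Inr i $ j * (det (\<chi> p l. if l = j then axis k 1 $ p else Y 0 z $ Inl p $ l) / det (Y1 z)))"
  by (simp add: refl_coeff_def matrix_mult_nth matrix_inv_entry[OF assms] cong: if_cong)

lemma refl_coeff_entry_holomorphic:
  assumes "S \<subseteq> upper_half 0" "\<And>z. z \<in> S \<Longrightarrow> det (Y1 z) \<noteq> 0"
  shows "(\<lambda>z. R z $ i $ k) holomorphic_on S"
proof (rule holomorphic_transform)
  note Yh = holomorphic_on_subset[OF Y0_holomorphic assms(1)]
  show "(\<lambda>z. \<Sum>j\<in>UNIV. Y 0 z $ Inr i $ j * (det (\<chi> p l. if l = j then axis k 1 $ p else Y 0 z $ Inl p $ l) / det (Y1 z)))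
     holomorphic_on S"
  proof (intro holomorphic_on_sum holomorphic_on_mult holomorphic_on_divide det_holomorphic Yh)
    fix j p l
    show "(\<lambda>z. (\<chi> p l. if l = j then axis k 1 $ p else Y 0 z $ Inl p $ l) $ p $ l) holomorphic_on S"
      by (cases "l = j") (simp_all add: Yh)
  qed (use assms(2) Yh in auto)
qed (simp add: refl_coeff_entry assms(2))

lemma refl_coeff_meromorphic: "(\<lambda>z. R z $ i $ k) meromorphic_on upper_half 0"
proof -
  have Ya: "(\<lambda>z. Y 0 z $ r $ c) meromorphic_on upper_half 0" for r c
    using Y0_holomorphic open_upper_half by (intro analytic_on_imp_meromorphic_on) (simp add: analytic_on_open)
  have da: "(\<lambda>z. det (\<chi> p l. if l = j then axis k 1 $ p else Y 0 z $ Inl p $ l)) meromorphic_on upper_half 0" for j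
  proof -
    have "(\<lambda>z. det (\<chi> p l. if l = j then axis k 1 $ p else Y 0 z $ Inl p $ l)) holomorphic_on upper_half 0"
    proof (rule det_holomorphic)
      fix p l
      show "(\<lambda>z. (\<chi> p l. if l = j then axis k 1 $ p else Y 0 z $ Inl p $ l) $ p $ l) holomorphic_on upper_half 0"
        by (cases "l = j") (simp_all add: Y0_holomorphic)
    qed
    then show ?thesis using open_upper_half
      by (intro analytic_on_imp_meromorphic_on) (simp add: analytic_on_open)
  qed
  have dY: "(\<lambda>z. det (Y1 z)) meromorphic_on upper_half 0"
    using det_Y1_holomorphic open_upper_half by (intro analytic_on_imp_meromorphic_on) (simp add: analytic_on_open)
  let ?h = "\<lambda>z. \<Sum>j\<in>UNIV. Y 0 z $ Inr i $ j * (det (\<chi> p l. if l = j then axis k 1 $ p else Y 0 z $ Inl p $ l) / det (Y1 z))"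
  have "?h meromorphic_on upper_half 0"
    by (intro meromorphic_on_sum meromorphic_on_mult meromorphic_on_divide Ya da dY)
  \<comment> \<open>At zeros of the determinant \<open>matrix_inv\<close> has no specified value, so
    the quotient formula is asserted in punctured neighbourhoods, which is what meromorphy depends
    on.\<close>
  moreover have "\<forall>\<^sub>F w in at z. R w $ i $ k = ?h w" if "z \<in> upper_half 0" for z
    using eventually_det_Y1_nonzero[OF that] by eventually_elim (rule refl_coeff_entry)
  ultimately show ?thesis using meromorphic_on_cong[OF _ refl, of "upper_half 0" "\<lambda>z. R z $ i $ k" ?h] by blast
qed

lemma refl_coeff_mult: "det (Y1 z) \<noteq> 0 \<Longrightarrow> R z ** Y1 z = lower_block (Y 0 z)"
  by (simp add: refl_coeff_def matrix_mul_assoc[symmetric] matrix_inv_works invertible_det_nz)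

lemma block_col_refl_coeff:
  assumes "det (Y1 z) \<noteq> 0"
  shows "block_col (mat 1) (R z) = Y 0 z ** matrix_inv (Y1 z)"
proof -
  have "Y 0 z ** matrix_inv (Y1 z) = block_col (Y1 z ** matrix_inv (Y1 z)) (R z)"
    by (subst block_col_split[symmetric, of "Y 0 z"]) (simp only: block_col_mult refl_coeff_def)
  then show ?thesis using assms by (simp add: matrix_inv_works invertible_det_nz)
qed

lemma refl_coeff_continuous_on:
  assumes "S \<subseteq> {z. Im z \<ge> 0}" "\<And>z. z \<in> S \<Longrightarrow> det (Y1 z) \<noteq> 0"
  shows "continuous_on S R"
  unfolding refl_coeff_def
  by (intro bounded_bilinear.continuous_on[OF bounded_bilinear_matrix_mult] matrix_inv_continuous_on
      bounded_linear.continuous_on[OF bounded_linear_lower_block] bounded_linear.continuous_on[OF bounded_linear_upper_block]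
      continuous_on_subset[OF Y0_continuous_on] assms)

text \<open>The reason is that \<^term>\<open>u x z ** Y 0 z\<close> is asymptotic to \<open>exp (\<i> * z * x)\<close> times \<open>first_columns\<close>.\<close>

lemma Y0_injective:
  fixes Z :: "complex^'a^'a"
  assumes z: "Im z \<ge> 0" and Z: "Y 0 z ** Z = 0"
  shows "Z = 0"
proof -
  obtain C where C: "C > 0" "\<And>(A :: complex^'a^('a + 'b)) (B :: complex^'a^'a). norm (A ** B) \<le> norm A * norm B * C"
    by (rule matrix_mult_norm_bound) (rule that)
  \<comment> \<open>This accuracy makes the error term at most \<open>norm Z / 2\<close>, so that it
    can be absorbed.\<close>
  have pos: "1 / (2 * C) > 0" using C by simp
  obtain x where x: "x \<ge> 0" "\<And>x' z. x' \<ge> x \<Longrightarrow> Im z \<ge> 0 \<Longrightarrow>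
     norm (antiphase z x' *\<^sub>M (u x' z ** jost_value z) - first_columns) \<le> 1 / (2 * C)"
    by (rule jost_value_asymptotics[OF pos]) (rule that)
  let ?A = "antiphase z x *\<^sub>M (u x z ** jost_value z)"
  have "?A ** Z = 0"
    using Z by (simp add: Y_0[OF z] cscale_mult_left matrix_mul_assoc[symmetric] matrix_mult_distribs cscale_simps)
  then have "(?A - first_columns) ** Z = - block_col Z 0"
    by (simp add: matrix_mult_distribs block_col_mult)
  then have "norm (block_col Z 0 :: complex^'a^('a + 'b)) = norm ((?A - first_columns) ** Z)" by simp
  also have "\<dots> \<le> norm (?A - first_columns) * norm Z * C" by (rule C)
  also have "\<dots> \<le> 1 / (2 * C) * norm Z * C" using x z C by (intro mult_right_mono) auto
  also have "\<dots> = norm Z / 2" using C by simp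
  finally have "norm (block_col Z 0 :: complex^'a^('a + 'b)) \<le> norm Z / 2" .
  moreover have "norm Z \<le> norm (block_col Z 0 :: complex^'a^('a + 'b))"
  proof -
    have "upper_block (block_col Z 0 :: complex^'a^('a + 'b)) = Z" by (simp add: vec_eq_iff)
    then show ?thesis using norm_upper_block_le[of "block_col Z 0 :: complex^'a^('a + 'b)"] by simp
  qed
  ultimately have "norm Z \<le> 0" by linarith
  then show ?thesis by simp
qed

text \<open>Were the determinant zero without a pole, \<open>R\<close> would have a finite limit
  \<open>L\<close> with \<open>L ** Y1 z\<close> equal to the lower block. A kernel vector of the
  upper block would then be annihilated by the lower block as well, contradicting the full column
  rank of \<open>Y 0 z\<close>.\<close>

lemma not_pole_imp_refl_defined:
  assumes z: "z \<in> upper_half 0 - poles R"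
  shows "det (Y1 z) \<noteq> 0"
proof
  assume det0: "det (Y1 z) = 0"
  have zu: "z \<in> upper_half 0" "Im z \<ge> 0" using z by (auto simp: upper_half_def)
  have "\<exists>l. ((\<lambda>w. R w $ i $ k) \<longlongrightarrow> l) (at z)" for i k
  proof -
    have "not_essential (\<lambda>w. R w $ i $ k) z"
      using refl_coeff_meromorphic zu by (auto simp: meromorphic_on_altdef)
    then show ?thesis using z unfolding not_essential_def poles_def by blast
  qed
  then have "\<forall>p. \<exists>l. ((\<lambda>w. R w $ fst p $ snd p) \<longlongrightarrow> l) (at z)" by blast
  from choice[OF this] obtain l where l: "\<forall>p. ((\<lambda>w. R w $ fst p $ snd p) \<longlongrightarrow> l p) (at z)" by blast
  define L :: "complex^'a^'b" where "L = (\<chi> i k. l (i, k))"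
  have "(R \<longlongrightarrow> L) (at z)"
  proof (intro vec_tendstoI)
    fix i k show "((\<lambda>w. R w $ i $ k) \<longlongrightarrow> L $ i $ k) (at z)"
      using l[rule_format, of "(i, k)"] by (simp add: L_def)
  qed
  moreover have Yt: "(Y 0 \<longlongrightarrow> Y 0 z) (at z)"
  proof -
    have "continuous_on (upper_half 0) (Y 0)"
      by (rule continuous_on_subset[OF Y0_continuous_on]) (auto simp: upper_half_def)
    then show ?thesis using zu(1) open_upper_half by (simp add: continuous_on_eq_continuous_at continuous_at)
  qed
  ultimately have "((\<lambda>w. R w ** Y1 w) \<longlongrightarrow> L ** Y1 z) (at z)"
    by (intro bounded_bilinear.tendsto[OF bounded_bilinear_matrix_mult] bounded_linear.tendsto[OF bounded_linear_upper_block])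
  moreover have "\<forall>\<^sub>F w in at z. R w ** Y1 w = lower_block (Y 0 w)"
    using eventually_det_Y1_nonzero[OF zu(1)] by eventually_elim (rule refl_coeff_mult)
  ultimately have "((\<lambda>w. lower_block (Y 0 w)) \<longlongrightarrow> L ** Y1 z) (at z)" by (rule Lim_transform_eventually)
  moreover have "((\<lambda>w. lower_block (Y 0 w)) \<longlongrightarrow> lower_block (Y 0 z)) (at z)"
    by (intro bounded_linear.tendsto[OF bounded_linear_lower_block] Yt)
  ultimately have LY: "L ** Y1 z = lower_block (Y 0 z)" by (intro tendsto_unique[of "at z"]) auto
  have "\<not> (\<exists>B. B ** Y1 z = mat 1)"
    using det0 by (simp add: invertible_left_inverse[symmetric] invertible_det_nz)
  then obtain x where x: "Y1 z *v x = 0" "x \<noteq> 0" unfolding matrix_left_invertible_ker by blast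
  \<comment> \<open>All columns are copies of the kernel vector, to fit the matrix form of
    \<open>Y0_injective\<close>.\<close>
  define Z :: "complex^'a^'a" where "Z = (\<chi> i j. x $ i)"
  have YZ: "Y1 z ** Z = 0"
    using x(1) by (simp add: vec_eq_iff matrix_mult_nth matrix_vector_mult_def Z_def)
  then have "lower_block (Y 0 z) ** Z = 0"
    unfolding LY[symmetric] by (simp add: matrix_mul_assoc[symmetric] matrix_mult_distribs)
  then have "block_col (Y1 z) (lower_block (Y 0 z)) ** Z = 0"
    by (simp only: block_col_mult YZ) (simp add: vec_eq_iff block_col_def split: sum.split)
  then have "Y 0 z ** Z = 0" by (simp only: block_col_split)
  then have "Z = 0" by (rule Y0_injective[OF zu(2)])
  then show False using x(2) by (simp add: Z_def vec_eq_iff)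
qed

lemma refl_extension_refl_coeff:
  assumes "\<And>t. \<bar>t\<bar> > m \<Longrightarrow> det (Y1 (complex_of_real t)) \<noteq> 0"
  shows "refl_extension Y m R"
  unfolding refl_extension_def
proof (intro conjI allI impI)
  show "continuous_on (complex_of_real ` {t. m < \<bar>t\<bar>} \<union> (upper_half 0 - poles R)) R"
    by (rule refl_coeff_continuous_on) (use assms not_pole_imp_refl_defined in \<open>auto simp: upper_half_def\<close>)
qed (auto intro: refl_coeff_meromorphic)

section \<open>Weyl functions and GW-functions\<close>

lemma block_col_diff: "block_col (mat 1) \<phi> - block_col (mat 1) \<psi> = block_col 0 (\<phi> - \<psi>)"
  by (simp add: vec_eq_iff block_col_def split: sum.split)

text \<open>The solution starting at \<open>[I; R z]\<close> is the Jost solution times the inverse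
  of \<open>Y1 z\<close>. \<open>K\<close> is kept as a parameter: the norm of the inverse at one
  \<open>z\<close> serves the Weyl condition, a bound uniform in \<open>z\<close> the GW
  property.\<close>

lemma weyl_solution_bound:
  assumes z: "Im z \<ge> 0" and det: "det (Y1 z) \<noteq> 0" and K: "norm (matrix_inv (Y1 z)) \<le> K"
    and C: "C > 0" "\<And>(A :: complex^'a^('a + 'b)) (B :: complex^'a^'a). norm (A ** B) \<le> norm A * norm B * C" and x: "x \<ge> 0"
  shows "norm (antiphase z x *\<^sub>M (u x z ** block_col (mat 1) (R z)))
    \<le> norm (first_columns :: complex^'a^('a + 'b)) * K * C"
proof -
  have "antiphase z x *\<^sub>M (u x z ** block_col (mat 1) (R z))
      = (antiphase z x *\<^sub>M (u x z ** jost_value z)) ** matrix_inv (Y1 z)"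
    by (simp add: block_col_refl_coeff[OF det] Y_0[OF z] cscale_mult_left matrix_mul_assoc)
  then have "norm (antiphase z x *\<^sub>M (u x z ** block_col (mat 1) (R z)))
     \<le> norm (antiphase z x *\<^sub>M (u x z ** jost_value z)) * norm (matrix_inv (Y1 z)) * C"
    using C(2) by metis
  also have "\<dots> \<le> norm (first_columns :: complex^'a^('a + 'b)) * K * C"
    using C(1) K jost_value_bound[OF z x] by (intro mult_right_mono mult_mono) auto
  finally show ?thesis .
qed

lemma norm_exp_cscale: "norm (antiphase z x *\<^sub>M A) = exp (Im z * x) * norm A"
  and norm_exp_cscale': "norm (phase z x *\<^sub>M A) = exp (- Im z * x) * norm A"
  by (simp_all add: norm_cscale)

text \<open>By the previous bound the solution decays like \<open>exp (- Im z * x)\<close>, so the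
  continuous integrand is dominated by an integrable exponential.\<close>

lemma weyl_condition_refl_coeff:
  assumes z: "Im z > 0" and det: "det (Y1 z) \<noteq> 0"
  shows "(\<lambda>x. cadj (block_col (mat 1) (R z)) ** cadj (u x z) ** u x z ** block_col (mat 1) (R z)) absolutely_integrable_on {0..}"
proof -
  define w where "w = (\<lambda>x. u x z ** block_col (mat 1) (R z))"
  have eq: "cadj (block_col (mat 1) (R z)) ** cadj (u x z) ** u x z ** block_col (mat 1) (R z) = cadj (w x) ** w x" for x
    by (simp add: w_def cadj_mult matrix_mul_assoc)
  obtain C where C: "C > 0" "\<And>(A :: complex^'a^('a + 'b)) (B :: complex^'a^'a). norm (A ** B) \<le> norm A * norm B * C"
    by (rule matrix_mult_norm_bound) (rule that)
  obtain C' where C': "C' > 0" "\<And>(A :: complex^('a + 'b)^'a) (B :: complex^'a^('a + 'b)). norm (A ** B) \<le> norm A * norm B * C'"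
    by (rule matrix_mult_norm_bound) (rule that)
  obtain D where D: "D > 0" "\<And>A :: complex^'a^('a + 'b). norm (cadj A) \<le> norm A * D"
    using bounded_linear.pos_bounded[OF bounded_linear_cadj] by metis
  define E where "E = norm (first_columns :: complex^'a^('a + 'b)) * norm (matrix_inv (Y1 z)) * C"
  have wE: "norm (w x) \<le> E * exp (- Im z * x)" if "x \<ge> 0" for x
  proof -
    have "exp (Im z * x) * norm (w x) \<le> E"
      using weyl_solution_bound[OF less_imp_le[OF z] det order_refl C that]
      unfolding norm_exp_cscale w_def E_def .
    then have "exp (- Im z * x) * (exp (Im z * x) * norm (w x)) \<le> exp (- Im z * x) * E"
      by (rule mult_left_mono) simp
    moreover have "exp (- Im z * x) * (exp (Im z * x) * norm (w x)) = norm (w x)"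
      by (simp add: mult.assoc[symmetric] mult_exp_exp)
    ultimately show ?thesis by (simp only: mult.commute[of E])
  qed
  have E0: "E \<ge> 0" using C by (simp add: E_def)
  have wc: "continuous_on {0..} w"
    unfolding w_def by (rule ac_deriv_continuous_on_atLeast[OF ac_deriv_mult_right[OF u_deriv]])
  have "(\<lambda>x. cadj (w x) ** w x) absolutely_integrable_on {0..}"
  proof (rule measurable_bounded_by_integrable_imp_absolutely_integrable)
    show "(\<lambda>x. cadj (w x) ** w x) \<in> borel_measurable (lebesgue_on {0..})"
      by (intro continuous_imp_measurable_on_sets_lebesgue bounded_bilinear.continuous_on[OF bounded_bilinear_matrix_mult]
          bounded_linear.continuous_on[OF bounded_linear_cadj] wc) auto
    have "(\<lambda>x. (D * E * E * C') * exp (- (2 * Im z) * x)) integrable_on {0..}"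
      using integrable_on_cmult_left[OF integrable_on_exp_minus_to_infinity[of "2 * Im z" 0], of "D * E * E * C'"] z by simp
    then show "(\<lambda>x. (D * E * E * C') * exp (- (2 * Im z) * x)) integrable_on {0..}" .
    fix x :: real assume "x \<in> {0..}"
    then have x: "x \<ge> 0" by simp
    have "norm (cadj (w x) ** w x) \<le> norm (cadj (w x)) * norm (w x) * C'" by (rule C')
    also have "\<dots> \<le> (norm (w x) * D) * norm (w x) * C'"
      using D C' by (intro mult_right_mono) auto
    also have "\<dots> \<le> (E * exp (- Im z * x) * D) * (E * exp (- Im z * x)) * C'"
      using D C' E0 wE[OF x] by (intro mult_right_mono mult_mono) auto
    also have "\<dots> = (D * E * E * C') * exp (- (2 * Im z) * x)"
    proof -
      have "exp (- (2 * Im z) * x) = exp (- Im z * x) * exp (- Im z * x)" by (simp add: mult_exp_exp)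
      then show ?thesis by (simp only: mult_ac)
    qed
    finally show "norm (cadj (w x) ** w x) \<le> (D * E * E * C') * exp (- (2 * Im z) * x)" .
  qed auto
  then show ?thesis by (simp add: eq)
qed

text \<open>The real part of the trace turns the matrix integral into a scalar one.\<close>

lemma weyl_condition_norm_integrable:
  assumes "(\<lambda>x. cadj (block_col (mat 1) \<phi>) ** cadj (u x z) ** u x z ** block_col (mat 1) \<phi>) absolutely_integrable_on {0..}"
  shows "(\<lambda>x. (norm (u x z ** block_col (mat 1) \<phi>))\<^sup>2) integrable_on {0..}"
proof -
  have eq: "cadj (block_col (mat 1) \<phi>) ** cadj (u x z) ** u x z ** block_col (mat 1) \<phi>
     = cadj (u x z ** block_col (mat 1) \<phi>) ** (u x z ** block_col (mat 1) \<phi>)" for x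
    by (simp add: cadj_mult matrix_mul_assoc)
  have int: "(\<lambda>x. cadj (u x z ** block_col (mat 1) \<phi>) ** (u x z ** block_col (mat 1) \<phi>)) integrable_on {0..}"
    using assms by (simp add: eq absolutely_integrable_on_def)
  have "(\<lambda>x. Re ((cadj (u x z ** block_col (mat 1) \<phi>) ** (u x z ** block_col (mat 1) \<phi>)) $ k $ k)) integrable_on {0..}" for k
    using integrable_linear[OF int bounded_linear_compose[OF bounded_linear_Re bounded_linear_entry], of k k] by (simp add: o_def)
  then have "(\<lambda>x. \<Sum>k\<in>UNIV. Re ((cadj (u x z ** block_col (mat 1) \<phi>) ** (u x z ** block_col (mat 1) \<phi>)) $ k $ k)) integrable_on {0..}"
    by (intro integrable_sum) auto
  then show ?thesis unfolding sum_diagonal_cadj_mult .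
qed

text \<open>The difference of two Weyl solutions starts at \<open>[0; \<eta>]\<close> and stays
  bounded below by \<open>norm \<eta> / 2\<close>. This is incompatible with square integrability of
  both unless \<eta> vanishes.\<close>

lemma weyl_unique:
  assumes z: "Im z > 0" and det: "det (Y1 z) \<noteq> 0"
    and growth: "\<And>X (\<eta> :: complex^'a^'b). X \<ge> 0 \<Longrightarrow>
      norm (phase z X *\<^sub>M (u X z ** block_col 0 \<eta>)) \<ge> norm \<eta> / 2"
    and \<phi>: "(\<lambda>x. cadj (block_col (mat 1) \<phi>) ** cadj (u x z) ** u x z ** block_col (mat 1) \<phi>) absolutely_integrable_on {0..}"
  shows "R z = \<phi>"
proof (rule ccontr)
  assume "R z \<noteq> \<phi>"
  define c where "c = (norm (\<phi> - R z) / 2)\<^sup>2"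
  have c: "c > 0" using \<open>R z \<noteq> \<phi>\<close> by (simp add: c_def)
  define h where "h = (\<lambda>x. 2 * (norm (u x z ** block_col (mat 1) \<phi>))\<^sup>2 + 2 * (norm (u x z ** block_col (mat 1) (R z)))\<^sup>2)"
  have hi: "h integrable_on {0..}"
    unfolding h_def
    by (intro integrable_add integrable_on_cmult_left[of _ _ "2 :: real", simplified]
        weyl_condition_norm_integrable \<phi> weyl_condition_refl_coeff z det)
  have ch: "c \<le> h x" if x: "x \<ge> 0" for x
  proof -
    let ?a = "u x z ** block_col (mat 1) \<phi>" and ?b = "u x z ** block_col (mat 1) (R z)"
    have d: "?a - ?b = u x z ** block_col 0 (\<phi> - R z)"
      by (simp add: block_col_diff[symmetric] matrix_mult_distribs)
    have "norm (\<phi> - R z) / 2 \<le> exp (- Im z * x) * norm (?a - ?b)"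
      using growth[OF x, of "\<phi> - R z"] unfolding norm_exp_cscale' d .
    also have "\<dots> \<le> 1 * norm (?a - ?b)" using z x by (intro mult_right_mono) auto
    also have "\<dots> \<le> norm ?a + norm ?b" by (simp add: norm_triangle_ineq4)
    finally have "c \<le> (norm ?a + norm ?b)\<^sup>2" unfolding c_def by (intro power_mono) auto
    also have "\<dots> \<le> h x"
      using sum_squares_bound[of "norm ?a" "norm ?b"] by (simp add: h_def power2_sum)
    finally show ?thesis .
  qed
  \<comment> \<open>On \<open>{0..real n}\<close> the lower bound \<open>c\<close> alone exceeds the
    total integral of \<open>h\<close>.\<close>
  obtain n :: nat where n: "integral {0..} h / c < real n" using reals_Archimedean2 by blast
  have h0: "h x \<ge> 0" for x by (simp add: h_def)
  have hn: "h integrable_on {0..real n}" by (rule integrable_on_subinterval[OF hi]) auto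
  have "real n * c = integral {0..real n} (\<lambda>x. c)" by simp
  also have "\<dots> \<le> integral {0..real n} h" by (rule integral_le[OF _ hn]) (use ch in auto)
  also have "\<dots> \<le> integral {0..} h" by (rule integral_subset_le[OF _ hn hi]) (use h0 in auto)
  finally show False using n c by (simp add: field_simps)
qed

lemma gw_bounded_refl_coeff:
  assumes M: "M \<ge> 0" and K: "\<And>z. Im z > M \<Longrightarrow> det (Y1 z) \<noteq> 0 \<and> norm (matrix_inv (Y1 z)) \<le> K"
  shows "gw_bounded_on u M R"
  unfolding gw_bounded_on_def
proof (intro allI impI)
  fix l :: real
  obtain C where C: "C > 0" "\<And>(A :: complex^'a^('a + 'b)) (B :: complex^'a^'a). norm (A ** B) \<le> norm A * norm B * C"
    by (rule matrix_mult_norm_bound) (rule that)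
  have "norm (exp (- \<i> * complex_of_real x * z) *\<^sub>M (u x z ** block_col (mat 1) (R z)))
       \<le> norm (first_columns :: complex^'a^('a + 'b)) * K * C" if "x \<in> {0..l}" "z \<in> upper_half M" for x z
  proof -
    have "Im z > M" using that by (simp add: upper_half_def)
    then show ?thesis
      using weyl_solution_bound[of z K C x] K[of z] C that M by (simp add: mult_ac)
  qed
  then show "bdd_above {norm (exp (- \<i> * complex_of_real x * z) *\<^sub>M (u x z ** block_col (mat 1) (R z))) | x z.
      x \<in> {0..l} \<and> z \<in> upper_half M}"
    by (intro bdd_aboveI[where M = "norm (first_columns :: complex^'a^('a + 'b)) * K * C"]) blast
qed

lemma gw_bounded_at:
  assumes \<phi>: "gw_bounded_on u M \<phi>" and l: "l > 0"
  shows "\<exists>C. \<forall>z. Im z > M \<longrightarrow> norm (antiphase z l *\<^sub>M (u l z ** block_col (mat 1) (\<phi> z))) \<le> C"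
proof -
  obtain C where C: "\<And>a. a \<in> {norm (exp (- \<i> * complex_of_real x * z) *\<^sub>M (u x z ** block_col (mat 1) (\<phi> z))) | x z.
           x \<in> {0..l} \<and> z \<in> upper_half M} \<Longrightarrow> a \<le> C"
    using \<phi> l unfolding gw_bounded_on_def bdd_above_def by blast
  have "norm (antiphase z l *\<^sub>M (u l z ** block_col (mat 1) (\<phi> z))) \<le> C" if "Im z > M" for z
  proof (rule C, rule CollectI, intro exI conjI)
    show "norm (antiphase z l *\<^sub>M (u l z ** block_col (mat 1) (\<phi> z)))
        = norm (exp (- \<i> * complex_of_real l * z) *\<^sub>M (u l z ** block_col (mat 1) (\<phi> z)))"
      by (simp add: mult_ac)
  qed (use l that in \<open>auto simp: upper_half_def\<close>)
  then show ?thesis by blast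
qed

text \<open>At \<open>x = l\<close> the growth estimate and the two GW bounds each contribute a
  factor \<open>exp (- Im z * l)\<close> to the difference of the candidates. As \<open>l\<close> is
  arbitrary, the decay exceeds every exponential.\<close>

lemma gw_unique:
  fixes \<phi> \<psi> :: "complex \<Rightarrow> complex^'a^'b"
  assumes m: "m \<ge> 0"
    and growth: "\<And>z X (\<eta> :: complex^'a^'b). Im z > m \<Longrightarrow> X \<ge> 0 \<Longrightarrow>
      norm (phase z X *\<^sub>M (u X z ** block_col 0 \<eta>)) \<ge> norm \<eta> / 2"
    and hol: "\<And>i k. (\<lambda>z. \<phi> z $ i $ k) holomorphic_on upper_half m" "\<And>i k. (\<lambda>z. \<psi> z $ i $ k) holomorphic_on upper_half m"
    and bd: "gw_bounded_on u M \<phi>" "gw_bounded_on u M' \<psi>" "M \<le> m" "M' \<le> m" and z: "Im z > m"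
  shows "\<phi> z = \<psi> z"
proof -
  have "\<phi> z $ i $ k - \<psi> z $ i $ k = 0" for i k
  proof (rule superexponential_decay_zero[where m = m and z = z and f = "\<lambda>z. \<phi> z $ i $ k - \<psi> z $ i $ k"])
    show "(\<lambda>z. \<phi> z $ i $ k - \<psi> z $ i $ k) holomorphic_on {z. m < Im z}"
      using hol unfolding upper_half_def by (intro holomorphic_intros)
    fix l :: real assume l: "l > 0"
    obtain C1 where C1: "\<And>z. Im z > M \<Longrightarrow> norm (antiphase z l *\<^sub>M (u l z ** block_col (mat 1) (\<phi> z))) \<le> C1"
      using gw_bounded_at[OF bd(1) l] by blast
    obtain C2 where C2: "\<And>z. Im z > M' \<Longrightarrow> norm (antiphase z l *\<^sub>M (u l z ** block_col (mat 1) (\<psi> z))) \<le> C2"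
      using gw_bounded_at[OF bd(2) l] by blast
    have "cmod (\<phi> z $ i $ k - \<psi> z $ i $ k) \<le> 2 * (C1 + C2) * exp (- 2 * l * Im z)" if z: "Im z > m" for z
    proof -
      let ?a = "u l z ** block_col (mat 1) (\<phi> z)" and ?b = "u l z ** block_col (mat 1) (\<psi> z)"
      have d: "?a - ?b = u l z ** block_col 0 (\<phi> z - \<psi> z)"
        by (simp add: block_col_diff[symmetric] matrix_mult_distribs)
      have "exp (Im z * l) * norm (?a - ?b) \<le> exp (Im z * l) * (norm ?a + norm ?b)"
        by (intro mult_left_mono norm_triangle_ineq4) simp
      also have "\<dots> \<le> C1 + C2"
        using C1[of z] C2[of z] z bd(3,4) unfolding norm_exp_cscale distrib_left by (intro add_mono) auto
      finally have up: "exp (Im z * l) * norm (?a - ?b) \<le> C1 + C2" .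
      have "norm (\<phi> z - \<psi> z) / 2 \<le> exp (- Im z * l) * norm (?a - ?b)"
        using growth[OF z, of l "\<phi> z - \<psi> z"] l unfolding norm_exp_cscale' d by simp
      also have "\<dots> = exp (- 2 * l * Im z) * (exp (Im z * l) * norm (?a - ?b))"
      proof -
        have "exp (- 2 * l * Im z) * exp (Im z * l) = exp (- Im z * l)" by (simp add: mult_exp_exp algebra_simps)
        then show ?thesis by (simp only: mult.assoc[symmetric])
      qed
      also have "\<dots> \<le> exp (- 2 * l * Im z) * (C1 + C2)" by (intro mult_left_mono up) simp
      finally have "norm (\<phi> z - \<psi> z) \<le> 2 * (exp (- 2 * l * Im z) * (C1 + C2))" by simp
      then have "norm (\<phi> z - \<psi> z) \<le> 2 * (C1 + C2) * exp (- 2 * l * Im z)" by (simp only: mult_ac)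
      then show ?thesis using norm_entry_le[of "\<phi> z - \<psi> z" i k] by simp
    qed
    then show "\<exists>C. \<forall>z. m < Im z \<longrightarrow> cmod (\<phi> z $ i $ k - \<psi> z $ i $ k) \<le> C * exp (- 2 * l * Im z)" by blast
  qed (rule z)
  then show ?thesis by (simp add: vec_eq_iff)
qed

end

section \<open>Proof of the theorem from the constructed limit\<close>

lemma jost_extension_value:
  fixes v :: "real \<Rightarrow> complex^'b::finite^'a::finite" and Y :: "real \<Rightarrow> complex \<Rightarrow> complex^'a^('a + 'b)"
  assumes sys: "dirac_system v u" and F: "jost_solution v F" and Y: "jost_extension v F Y" and z: "Im z \<ge> 0"
  shows "Y 0 z = dirac_system.jost_value u z"
proof -
  interpret dirac_system v u by (rule sys)
  have Yr: "Y 0 (complex_of_real t) = jost_value (complex_of_real t)" for t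
    using Y jost_solution_value[OF F, of t] by (simp add: jost_extension_def)
  have Yc: "continuous_on {z. Im z \<ge> 0} (Y 0)" and Yh: "\<And>r c. (\<lambda>z. Y 0 z $ r $ c) holomorphic_on upper_half 0"
    using Y by (auto simp: jost_extension_def)
  \<comment> \<open>A disc about 0 large enough to contain \<open>z\<close>: boundary values agree
    on the whole real line, so the continuation argument may be run in a disc of any size.\<close>
  let ?B = "ball (complex_of_real 0) (cmod z + 1)"
  have "Y 0 z $ r $ c - jost_value z $ r $ c = 0" for r c
  proof (rule holomorphic_zero_on_real_segment[where f = "\<lambda>z. Y 0 z $ r $ c - jost_value z $ r $ c" and t = 0 and r = "cmod z + 1"])
    show "continuous_on ({z. 0 \<le> Im z} \<inter> ?B) (\<lambda>z. Y 0 z $ r $ c - jost_value z $ r $ c)"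
      by (intro continuous_on_diff continuous_on_entry continuous_on_subset[OF Yc] continuous_on_subset[OF jost_value_continuous_on]) auto
    show "(\<lambda>z. Y 0 z $ r $ c - jost_value z $ r $ c) holomorphic_on upper_half 0 \<inter> ?B"
      by (intro holomorphic_on_diff holomorphic_on_subset[OF Yh] holomorphic_on_subset[OF jost_value_holomorphic]) auto
  qed (use z Yr in auto)
  then show ?thesis by (simp add: vec_eq_iff)
qed

theorem theorem3p9:
  fixes v :: "real \<Rightarrow> complex^'b::finite^'a::finite"
    and u :: "real \<Rightarrow> complex \<Rightarrow> complex^('a + 'b)^('a + 'b)"
    and F :: "real \<Rightarrow> real \<Rightarrow> complex^('a + 'b)^('a + 'b)"
    and Y :: "real \<Rightarrow> complex \<Rightarrow> complex^'a^('a + 'b)"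
  assumes V_L1: "\<And>r c. (\<lambda>x. potential (v x) $ r $ c) absolutely_integrable_on {0..}"
    and u: "normalized_fundamental v u"
    and F: "jost_solution v F"
    and Y: "jost_extension v F Y"
  shows "(AE t in lebesgue. refl_defined Y (complex_of_real t)) \<and>
    (\<exists>M>0. \<exists>Mh>0. \<exists>R.
       (\<forall>t::real. \<bar>t\<bar> > Mh \<longrightarrow> refl_defined Y (complex_of_real t)) \<and>
       refl_extension Y Mh R \<and>
       (\<forall>S. refl_extension Y Mh S \<longrightarrow>
          poles S = poles R \<and>
          (\<forall>z \<in> complex_of_real ` {t. \<bar>t\<bar> > Mh} \<union> (upper_half 0 - poles R). S z = R z)) \<and>
       (\<forall>z \<in> upper_half 0 - poles R. refl_defined Y z \<and> R z = refl_coeff Y z) \<and>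
       weyl_function_on u M R \<and>
       (\<forall>M' \<phi>. weyl_function_on u M' \<phi> \<longrightarrow>
          (\<forall>z \<in> upper_half M \<inter> upper_half M'. R z = \<phi> z)) \<and>
       gw_function_on u M R \<and>
       (\<forall>M' \<phi>. gw_function_on u M' \<phi> \<longrightarrow>
          (\<forall>z \<in> upper_half M \<inter> upper_half M'. R z = \<phi> z)))"
proof -
  have sys: "dirac_system v u" by (rule dirac_system.intro[OF V_L1 u])
  interpret dirac_jost v u Y
    by (rule dirac_jost.intro[OF sys]) (unfold_locales, rule jost_extension_value[OF sys F Y])
  \<comment> \<open>This \<rho> is the witness for both \<open>M\<close> and \<open>Mh\<close>: on
    the real line it bounds \<open>\<bar>t\<bar>\<close>, and in the half-plane
    \<open>Im z > \<rho>\<close> already gives \<open>cmod z > \<rho>\<close>.\<close>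
  obtain \<rho> K where \<rho>: "\<rho> > 0" and "K > 0"
    and K: "\<And>z. Im z \<ge> 0 \<Longrightarrow> cmod z > \<rho> \<Longrightarrow> det (Y1 z) \<noteq> 0 \<and> norm (matrix_inv (Y1 z)) \<le> K"
    and growth: "\<And>z X (\<eta> :: complex^'a^'b). \<lbrakk>Im z \<ge> 0; cmod z > \<rho>; X \<ge> 0\<rbrakk> \<Longrightarrow>
      norm (phase z X *\<^sub>M (u X z ** block_col 0 \<eta>)) \<ge> norm \<eta> / 2"
    by (rule large_z) (rule that)
  have Im_large: "Im z \<ge> 0" "cmod z > \<rho>" if "Im z > \<rho>" for z
    using that \<rho> abs_Im_le_cmod[of z] by linarith+
  have det_real: "det (Y1 (complex_of_real t)) \<noteq> 0" if "\<bar>t\<bar> > \<rho>" for t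
    using K[of "complex_of_real t"] that by simp
  then have real_defined: "refl_defined Y (complex_of_real t)" if "\<bar>t\<bar> > \<rho>" for t
    using that by (simp add: refl_defined_iff)
  have ext: "refl_extension Y \<rho> R" by (rule refl_extension_refl_coeff[OF det_real])
  have weyl: "weyl_function_on u \<rho> R"
    unfolding weyl_function_on_def
    using \<rho> K Im_large by (auto simp: upper_half_def intro!: weyl_condition_refl_coeff)
  have R_hol: "(\<lambda>z. R z $ i $ k) holomorphic_on upper_half \<rho>" for i k
    by (rule refl_coeff_entry_holomorphic) (use \<rho> K Im_large in \<open>auto simp: upper_half_def\<close>)
  have R_gw: "gw_bounded_on u \<rho> R"
    by (rule gw_bounded_refl_coeff[of _ K]) (use \<rho> K Im_large in auto)
  have unique: "poles S = poles R \<and> (\<forall>z \<in> complex_of_real ` {t. \<bar>t\<bar> > \<rho>} \<union> (upper_half 0 - poles R). S z = R z)"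
    if S: "refl_extension Y \<rho> S" for S
  proof -
    have real: "S (complex_of_real t) = R (complex_of_real t)" if "\<bar>t\<bar> > \<rho>" for t
      using S det_real[OF that] by (simp add: refl_extension_def refl_defined_iff)
    have Rc: "continuous_on (complex_of_real ` {t. \<bar>t\<bar> > \<rho>} \<union> (upper_half 0 - poles R)) R"
      using ext by (simp add: refl_extension_def)
    have Sm: "(\<lambda>z. S z $ i $ k) meromorphic_on upper_half 0" for i k
      using S by (simp add: refl_extension_def)
    have Sc: "continuous_on (complex_of_real ` {t. \<bar>t\<bar> > \<rho>} \<union> (upper_half 0 - poles S)) S"
      using S by (simp add: refl_extension_def)
    note SR = meromorphic_boundary_unique[OF refl_coeff_meromorphic Rc Sm Sc real \<rho>]
    show ?thesis
    proof (intro conjI ballI SR(1))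
      fix z assume "z \<in> complex_of_real ` {t. \<bar>t\<bar> > \<rho>} \<union> (upper_half 0 - poles R)"
      then show "S z = R z" using real SR(2) by blast
    qed
  qed
  have weyl_eq: "R z = \<phi> z" if \<phi>: "weyl_function_on u M' \<phi>" and z: "z \<in> upper_half \<rho> \<inter> upper_half M'" for M' \<phi> z
  proof (rule weyl_unique)
    have "Im z > \<rho>" using z by (simp add: upper_half_def)
    then show "Im z > 0" "det (Y1 z) \<noteq> 0"
      "\<And>X (\<eta> :: complex^'a^'b). X \<ge> 0 \<Longrightarrow> norm (phase z X *\<^sub>M (u X z ** block_col 0 \<eta>)) \<ge> norm \<eta> / 2"
      using K growth Im_large \<rho> by auto
  qed (use \<phi> z in \<open>simp add: weyl_function_on_def\<close>)
  have gw_eq: "R z = \<phi> z" if \<phi>: "gw_function_on u M' \<phi>" and z: "z \<in> upper_half \<rho> \<inter> upper_half M'" for M' \<phi> z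
  \<comment> \<open>The two candidates are compared on the intersection of their half-planes, which
    is the half-plane above \<open>max \<rho> M'\<close>.\<close>
  proof (rule gw_unique[where m = "max \<rho> M'"])
    show "gw_bounded_on u \<rho> R" by (rule R_gw)
    show "gw_bounded_on u M' \<phi>" using \<phi> by (simp add: gw_function_on_def)
    show "(\<lambda>z. R z $ i $ k) holomorphic_on upper_half (max \<rho> M')" for i k
      by (rule holomorphic_on_subset[OF R_hol]) (auto simp: upper_half_def)
    show "(\<lambda>z. \<phi> z $ i $ k) holomorphic_on upper_half (max \<rho> M')" for i k
    proof (rule holomorphic_on_subset)
      show "(\<lambda>z. \<phi> z $ i $ k) holomorphic_on upper_half M'" using \<phi> by (simp add: gw_function_on_def)
    qed (auto simp: upper_half_def)
    show "max \<rho> M' < Im z" using z by (simp add: upper_half_def)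
    fix z X and \<eta> :: "complex^'a^'b" assume "max \<rho> M' < Im z" "(X::real) \<ge> 0"
    then show "norm \<eta> / 2 \<le> norm (phase z X *\<^sub>M (u X z ** block_col 0 \<eta>))"
      by (intro growth Im_large) auto
  qed (use \<rho> in auto)
  have pole: "refl_defined Y z" if "z \<in> upper_half 0 - poles R" for z
    using not_pole_imp_refl_defined[OF that] by (simp add: refl_defined_iff)
  show ?thesis
  proof (intro conjI exI[of _ \<rho>] exI[of _ R] allI impI ballI)
    fix S assume "refl_extension Y \<rho> S"
    note SR = unique[OF this]
    show "poles S = poles R" using SR by blast
    fix z assume "z \<in> complex_of_real ` {t. \<bar>t\<bar> > \<rho>} \<union> (upper_half 0 - poles R)"
    then show "S z = R z" using SR by blast
  next
    show "gw_function_on u \<rho> R" using \<rho> R_hol R_gw by (simp add: gw_function_on_def)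
  qed (assumption | rule AE_refl_defined \<rho> real_defined ext pole refl weyl | erule (1) weyl_eq gw_eq)+
qed

end
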